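(* The function $F$ satisfies $$11 \leq F(4) \leq 2087 \qquad\text{and}\qquad 2.58\cdot 10^{12} < F(5) < 10^{187.63}.$$
   Context: Games are normal play two-player (Left and Right) perfect-information games $X=\{L(X)\mid R(X)\}$, with finitely many options and ending in finitely many turns; a player who cannot move on their turn loses. Equality $X=Y$ means that for every game $Z$ the disjunctive sums $X+Z$ and $Y+Z$ have the same outcome. The birthday $b(X)$ of a game $X$ is the least non-negative integer strictly greater than the birthdays of all the (Left and Right) options of $X$; $X$ is born by day $b$ if $b(X)\le b$. Digraph placement: let $G=(V,E)$ be a finite directed graph (no loops or multiple arcs; both $(u,v)$ and $(v,u)$ may be present) with a (not necessarily proper) colouring $\phi:V\to\{\text{blue},\text{red}\}$. The players alternate; on her turn Left chooses a blue vertex $u$ and deletes its closed out-neighbourhood $N^+[u]$ (that is, $u$ and all out-neighbours of $u$); on his turn Right chooses a red vertex $v$ and deletes $N^+[v]$. A player with no vertex of their colour remaining at the beginning of their turn loses. The coloured digraph $(G,\phi)$, regarded as a combinatorial game in this way, is called a digraph placement game and is denoted $G$. For a game $X$, $f(X)$ denotes the least integer such that there exists a digraph placement game $G$ on $f(X)$ vertices with $G=X$ (it is known that every game $X$ is equal to some digraph placement game, so $f(X)$ is well defined). For a non-negative integer $b$, $F(b)$ is the maximum of $f(X)$ over all games $X$ born by day $b$. *)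

theory Defs
  imports Complex_Main "HOL-Library.FSet" "Graph_Theory.Digraph_Component"
begin

section \<open>Short normal-play games\<close>

datatype game = Game (left_opts: "game fset") (right_opts: "game fset")

text \<open>A game without options has birthday 0, since the condition on \<open>n\<close> is then vacuous.\<close>

primrec birthday :: "game \<Rightarrow> nat" where
  "birthday (Game L R) = (LEAST n. \<forall>k. k |\<in>| birthday |`| L |\<union>| birthday |`| R \<longrightarrow> k < n)"

definition born_by :: "nat \<Rightarrow> game set" where
  "born_by b = {X. birthday X \<le> b}"

lemma size_opt [termination_simp]:
  fixes X :: game
  assumes "X |\<in>| A"
  shows "size X < Suc ((\<Sum>Y\<in>fset A. Suc (size Y)) + n)"
    and "size X < Suc (n + (\<Sum>Y\<in>fset A. Suc (size Y)))"
proof -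
  have "Suc (size X) \<le> (\<Sum>Y\<in>fset A. Suc (size Y))"
    by (rule member_le_sum) (use assms in auto)
  then show "size X < Suc ((\<Sum>Y\<in>fset A. Suc (size Y)) + n)"
    and "size X < Suc (n + (\<Sum>Y\<in>fset A. Suc (size Y)))" by auto
qed

fun left_wins_first :: "game \<Rightarrow> bool"
  and right_wins_first :: "game \<Rightarrow> bool" where
  "left_wins_first (Game L R) \<longleftrightarrow> fBex L (\<lambda>X. \<not> right_wins_first X)"
| "right_wins_first (Game L R) \<longleftrightarrow> fBex R (\<lambda>X. \<not> left_wins_first X)"

datatype outcome = Left_Wins | Right_Wins | Next_Wins | Previous_Wins

definition outcome :: "game \<Rightarrow> outcome" where
  "outcome X =
    (if left_wins_first X
     then (if right_wins_first X then Next_Wins else Left_Wins)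
     else (if right_wins_first X then Right_Wins else Previous_Wins))"

declare fset.map_cong [fundef_cong]

fun disj_sum :: "game \<Rightarrow> game \<Rightarrow> game" where
  "disj_sum (Game L R) (Game L' R') =
     Game ((\<lambda>X. disj_sum X (Game L' R')) |`| L |\<union>| (\<lambda>Y. disj_sum (Game L R) Y) |`| L')
          ((\<lambda>X. disj_sum X (Game L' R')) |`| R |\<union>| (\<lambda>Y. disj_sum (Game L R) Y) |`| R')"

definition game_eq :: "game \<Rightarrow> game \<Rightarrow> bool" where
  "game_eq X Y \<longleftrightarrow> (\<forall>Z. outcome (disj_sum X Z) = outcome (disj_sum Y Z))"

section \<open>Digraph placement\<close>

datatype colour = Blue | Red

definition closed_out_nbhd :: "('v, 'e) pre_digraph \<Rightarrow> 'v \<Rightarrow> 'v set" where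
  "closed_out_nbhd G u = insert u {v. u \<rightarrow>\<^bsub>G\<^esub> v}"

definition play_vertex :: "('v, 'e) pre_digraph \<Rightarrow> 'v \<Rightarrow> ('v, 'e) pre_digraph" where
  "play_vertex G u = G \<restriction> (verts G - closed_out_nbhd G u)"

definition colour_class :: "('v, 'e) pre_digraph \<Rightarrow> ('v \<Rightarrow> colour) \<Rightarrow> colour \<Rightarrow> 'v set" where
  "colour_class G \<phi> c = {u \<in> verts G. \<phi> u = c}"

text \<open>The finiteness test only serves to make the recursion well founded;
  see \<open>placement_game_opts\<close> below for the characterisation on finite digraphs.\<close>

function placement_game :: "('v, 'e) pre_digraph \<Rightarrow> ('v \<Rightarrow> colour) \<Rightarrow> game" where
  "placement_game G \<phi> =
    (if finite (verts G)
     then Game ((\<lambda>u. placement_game (play_vertex G u) \<phi>) |`| Abs_fset (colour_class G \<phi> Blue))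
               ((\<lambda>u. placement_game (play_vertex G u) \<phi>) |`| Abs_fset (colour_class G \<phi> Red))
     else undefined)"
  by pat_completeness auto

lemma finite_colour_class: "finite (verts G) \<Longrightarrow> finite (colour_class G \<phi> c)"
  by (simp add: colour_class_def)

lemma card_play_vertex:
  assumes "finite (verts G)" "u \<in> verts G"
  shows "card (verts (play_vertex G u)) < card (verts G)"
  using assms by (auto simp: play_vertex_def closed_out_nbhd_def intro!: psubset_card_mono)

termination
  by (relation "measure (\<lambda>(G, \<phi>). card (verts G))")
     (auto simp: finite_colour_class Abs_fset_inverse colour_class_def card_play_vertex)

declare placement_game.simps [simp del]

lemma placement_game_opts:
  assumes "finite (verts G)"
  shows "fset (left_opts (placement_game G \<phi>)) =
           {placement_game (play_vertex G u) \<phi> | u. u \<in> verts G \<and> \<phi> u = Blue}"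
    and "fset (right_opts (placement_game G \<phi>)) =
           {placement_game (play_vertex G u) \<phi> | u. u \<in> verts G \<and> \<phi> u = Red}"
  using assms finite_colour_class[OF assms, of \<phi>]
  by (auto simp: placement_game.simps[of G] Abs_fset_inverse colour_class_def)

text \<open>Since the digraphs are finite and have no multiple arcs, it is no restriction to take
  natural numbers as vertices and pairs of natural numbers as arcs.\<close>

definition representable_on :: "game \<Rightarrow> nat \<Rightarrow> bool" where
  "representable_on X n \<longleftrightarrow>
    (\<exists>(G :: (nat, nat \<times> nat) pre_digraph) \<phi>.
       digraph G \<and> card (verts G) = n \<and> game_eq (placement_game G \<phi>) X)"

text \<open>Every game is equal to some digraph placement game, so the least element exists.\<close>

definition min_verts :: "game \<Rightarrow> nat" where
  "min_verts X = (LEAST n. representable_on X n)"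

definition F :: "nat \<Rightarrow> nat" where
  "F b = Max (min_verts ` born_by b)"

text \<open>The maximum is taken over a nonempty finite set.\<close>

lemma birthday_less:
  assumes "X |\<in>| L |\<union>| R"
  shows "birthday X < birthday (Game L R)"
proof -
  have "\<exists>n. \<forall>k. k |\<in>| birthday |`| L |\<union>| birthday |`| R \<longrightarrow> k < n"
    using finite_nat_set_iff_bounded[of "fset (birthday |`| L |\<union>| birthday |`| R)"] by auto
  from LeastI_ex[OF this] show ?thesis using assms by auto
qed

lemma finite_born_by: "finite (born_by b)"
proof (induction b rule: less_induct)
  case (less b)
  define S where "S = {X. birthday X < b}"
  have "S = (\<Union>c<b. born_by c)" unfolding S_def born_by_def by auto
  then have "finite S" using less by simp
  have "finite {A. fset A \<subseteq> S}"
  proof (rule finite_imageD)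
    show "finite (fset ` {A. fset A \<subseteq> S})"
      by (rule finite_subset[of _ "Pow S"]) (use \<open>finite S\<close> in auto)
    show "inj_on fset {A. fset A \<subseteq> S}"
      by (simp add: inj_on_def fset_inject)
  qed
  moreover have "born_by b \<subseteq> case_prod Game ` ({A. fset A \<subseteq> S} \<times> {A. fset A \<subseteq> S})"
  proof
    fix X assume X: "X \<in> born_by b"
    obtain L R where XLR: "X = Game L R" by (cases X)
    have "birthday Y < b" if "Y |\<in>| L |\<union>| R" for Y
      using birthday_less[OF that] X unfolding XLR born_by_def by simp
    then show "X \<in> case_prod Game ` ({A. fset A \<subseteq> S} \<times> {A. fset A \<subseteq> S})"
      unfolding XLR S_def by (intro image_eqI[of _ _ "(L, R)"]) auto
  qed
  ultimately show ?case
    by (meson finite_SigmaI finite_imageI finite_subset)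
qed

lemma born_by_nonempty: "born_by b \<noteq> {}"
proof -
  have "Game {||} {||} \<in> born_by b" by (simp add: born_by_def)
  then show ?thesis by blast
qed

end

theory Submission
  imports Defs
begin

text \<open>The values born by day \<open>k\<close> form a finite poset \<open>P\<^sub>k\<close>, and a value born by day \<open>k + 1\<close> is the
  same thing as a pair of a down-set \<open>D\<close> and an up-set \<open>U\<close> of \<open>P\<^sub>k\<close> with \<open>D\<close> below \<open>U\<close>, ordered by
  inclusion and reverse inclusion. This makes \<open>P\<^sub>3\<close> with its 1474 elements explicit.

  Lower bounds. Antichains \<open>A\<close> and \<open>B\<close> of \<open>P\<^sub>k\<close> with \<open>A\<close> below \<open>B\<close> give a Boolean lattice of rank
  \<open>|A| + |B|\<close> in \<open>P\<^sub>k\<^sub>+\<^sub>1\<close>. In \<open>P\<^sub>3\<close> one finds \<open>79 + 20 = 99\<close>, so that \<open>P\<^sub>4\<close> has at least \<open>2\<^sup>9\<^sup>9\<close> elements and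
  an antichain of size \<open>99 choose 49\<close>, which in turn gives a Boolean lattice of that rank in \<open>P\<^sub>5\<close>. On the
  other hand there are at most \<open>(n + 1)\<^sup>2 2\<^bsup>n (n - 1)\<^esup>\<close> coloured digraphs on at most \<open>n\<close> vertices.

  Upper bounds. A coloured digraph all of whose induced subgraphs together realise \<open>P\<^sub>k\<close> extends to one
  for \<open>P\<^sub>k\<^sub>+\<^sub>1\<close> by one blue and one red vertex per element of \<open>P\<^sub>k\<close> and a gadget of linear size; a
  single game needs only the vertices for its undominated options. A partition of \<open>P\<^sub>3\<close> into 96 chains
  bounds the number of these options for day 4, and also bounds \<open>|P\<^sub>4|\<close>, because \<open>(D, U)\<close> cuts each chain
  into an initial, a middle and a final segment.\<close>

section \<open>The order on games\<close>

text \<open>Two obstacles shape the argument. In a digraph placement game every vertex still present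
  is a legal move of its owner, so a digraph that realises the options of \<open>X\<close> also
  offers moves that \<open>X\<close> does not have. These must lose for every \<open>X\<close> at
  once. This is possible because all values born by day \<open>m\<close> lie between the integers
  \<open>-m\<close> and \<open>m\<close>, and an independent one-coloured set of vertices is such an
  integer. Since one vertex can delete everything outside a prescribed induced subgraph, the digraph
  of the earlier day is paid for once and not once per option. The second obstacle is that
  antichains and chains are needed in the actual poset of day 3, which is processed by rewriting:
  hence codes ordered by pointwise implication, counts that prune, and a certificate tree checked in
  one traversal.

  The counting bound fixes the first constant: \<open>2^99\<close> exceeds
  \<open>11^2 * 2^90\<close> but not \<open>12^2 * 2^110\<close>. The other three are met with room
  to spare: the upper bounds come out as 318 and \<open>10^183\<close>.\<close>

function game_le :: "game \<Rightarrow> game \<Rightarrow> bool" where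
  "game_le (Game L R) (Game L' R') \<longleftrightarrow>
     fBall L (\<lambda>X. \<not> game_le (Game L' R') X) \<and> fBall R' (\<lambda>Y. \<not> game_le Y (Game L R))"
  by pat_completeness auto

termination
  by (relation "measure (\<lambda>(X, Y). size X + size Y)")
     (auto simp: add.assoc intro: less_le_trans[OF size_opt(1)] less_le_trans[OF size_opt(2)])

lemma game_le_iff:
  "game_le X Y \<longleftrightarrow> (\<forall>X' |\<in>| left_opts X. \<not> game_le Y X') \<and> (\<forall>Y' |\<in>| right_opts Y. \<not> game_le Y' X)"
  by (cases X; cases Y) simp

declare game_le.simps [simp del]

lemma size_left_opts: "Y |\<in>| left_opts X \<Longrightarrow> size Y < size X"
  by (cases X) (use size_opt in auto)

lemma size_right_opts: "Y |\<in>| right_opts X \<Longrightarrow> size Y < size X"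
  by (cases X) (use size_opt in auto)

lemma game_induct [case_names game]:
  assumes "\<And>X. (\<And>Y. Y |\<in>| left_opts X \<or> Y |\<in>| right_opts X \<Longrightarrow> P Y) \<Longrightarrow> P X"
  shows "P X"
  by (induction X rule: measure_induct_rule[where f = size])
     (use assms size_left_opts size_right_opts in blast)

lemma game_le_refl [simp]: "game_le X X"
proof (induction X rule: game_induct)
  case (game X)
  then show ?case by (subst game_le_iff) (metis game_le_iff)
qed

lemma left_opt_not_ge: "Y |\<in>| left_opts X \<Longrightarrow> \<not> game_le X Y"
  by (meson game_le_iff game_le_refl)

lemma right_opt_not_le: "Y |\<in>| right_opts X \<Longrightarrow> \<not> game_le Y X"
  by (meson game_le_iff game_le_refl)

text \<open>A counterexample rotates: a Left option \<open>X'\<close> of \<open>X\<close> above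
  \<open>Z\<close> turns the triple \<open>X, Y, Z\<close> into \<open>Y, Z, X'\<close>, and a Right
  option of \<open>Z\<close> works likewise. The total size is invariant under rotation and drops
  with the option.\<close>

lemma game_le_trans: "game_le X Y \<Longrightarrow> game_le Y Z \<Longrightarrow> game_le X Z"
proof (induction "size X + size Y + size Z" arbitrary: X Y Z rule: less_induct)
  case less
  show ?case
  proof (subst game_le_iff, intro conjI ballI notI)
    fix X' assume X': "X' |\<in>| left_opts X" and "game_le Z X'"
    then have "game_le Y X'"
      using less.hyps[of Y Z X'] less.prems size_left_opts[OF X'] by simp
    with less.prems(1) X' show False by (meson game_le_iff)
  next
    fix Z' assume Z': "Z' |\<in>| right_opts Z" and "game_le Z' X"
    then have "game_le Z' Y"
      using less.hyps[of Z' X Y] less.prems size_right_opts[OF Z'] by simp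
    with less.prems(2) Z' show False by (meson game_le_iff)
  qed
qed

section \<open>Equality of values and the outcomes of sums\<close>

definition equal_val :: "game \<Rightarrow> game \<Rightarrow> bool" (infix "\<approx>" 50) where
  "X \<approx> Y \<longleftrightarrow> game_le X Y \<and> game_le Y X"

lemma equal_val_refl [simp]: "X \<approx> X"
  and equal_val_sym: "X \<approx> Y \<Longrightarrow> Y \<approx> X"
  and equal_val_trans [trans]: "X \<approx> Y \<Longrightarrow> Y \<approx> Z \<Longrightarrow> X \<approx> Z"
  unfolding equal_val_def using game_le_trans by auto

lemma wins_first_iff:
  "left_wins_first X \<longleftrightarrow> (\<exists>Y |\<in>| left_opts X. \<not> right_wins_first Y)"
  "right_wins_first X \<longleftrightarrow> (\<exists>Y |\<in>| right_opts X. \<not> left_wins_first Y)"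
  by (cases X; simp)+

lemma opts_disj_sum:
  "left_opts (disj_sum X Y) = (\<lambda>X'. disj_sum X' Y) |`| left_opts X |\<union>| disj_sum X |`| left_opts Y"
  "right_opts (disj_sum X Y) = (\<lambda>X'. disj_sum X' Y) |`| right_opts X |\<union>| disj_sum X |`| right_opts Y"
  by (cases X; cases Y; simp)+

lemma left_wins_first_sum:
  "left_wins_first (disj_sum X Y) \<longleftrightarrow>
     (\<exists>X' |\<in>| left_opts X. \<not> right_wins_first (disj_sum X' Y)) \<or>
     (\<exists>Y' |\<in>| left_opts Y. \<not> right_wins_first (disj_sum X Y'))"
  by (subst wins_first_iff) (auto simp: opts_disj_sum)

lemma right_wins_first_sum:
  "right_wins_first (disj_sum X Y) \<longleftrightarrow>
     (\<exists>X' |\<in>| right_opts X. \<not> left_wins_first (disj_sum X' Y)) \<or>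
     (\<exists>Y' |\<in>| right_opts Y. \<not> left_wins_first (disj_sum X Y'))"
  by (subst wins_first_iff) (auto simp: opts_disj_sum)

primrec neg :: "game \<Rightarrow> game" where
  "neg (Game L R) = Game (neg |`| R) (neg |`| L)"

lemma opts_neg: "left_opts (neg X) = neg |`| right_opts X" "right_opts (neg X) = neg |`| left_opts X"
  by (cases X; simp)+

text \<open>This identifies the recursive order with play: \<open>X\<close> \<le> \<open>Y\<close>
  says that Left, moving second, survives in the difference \<open>Y - X\<close>. The two halves
  need a joint induction, since each move in the difference swaps the player to move.\<close>

lemma wins_first_diff:
  "(right_wins_first (disj_sum Y (neg X)) \<longleftrightarrow> \<not> game_le X Y) \<and>
   (left_wins_first (disj_sum Y (neg X)) \<longleftrightarrow> \<not> game_le Y X)"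
proof (induction "size X + size Y" arbitrary: X Y rule: less_induct)
  case less
  have IH: "right_wins_first (disj_sum Y' (neg X')) \<longleftrightarrow> \<not> game_le X' Y'"
           "left_wins_first (disj_sum Y' (neg X')) \<longleftrightarrow> \<not> game_le Y' X'"
    if "size X' + size Y' < size X + size Y" for X' Y'
    using less.hyps[OF that] by auto
  have 1: "left_wins_first (disj_sum Y' (neg X)) \<longleftrightarrow> \<not> game_le Y' X"
    if "Y' |\<in>| right_opts Y" for Y'
    using IH size_right_opts[OF that] by simp
  have 2: "left_wins_first (disj_sum Y (neg X')) \<longleftrightarrow> \<not> game_le Y X'"
    if "X' |\<in>| left_opts X" for X'
    using IH size_left_opts[OF that] by simp
  have 3: "right_wins_first (disj_sum Y' (neg X)) \<longleftrightarrow> \<not> game_le X Y'"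
    if "Y' |\<in>| left_opts Y" for Y'
    using IH size_left_opts[OF that] by simp
  have 4: "right_wins_first (disj_sum Y (neg X')) \<longleftrightarrow> \<not> game_le X' Y"
    if "X' |\<in>| right_opts X" for X'
    using IH size_right_opts[OF that] by simp
  have "right_wins_first (disj_sum Y (neg X)) \<longleftrightarrow> \<not> game_le X Y"
    unfolding right_wins_first_sum game_le_iff[of X Y] opts_neg using 1 2 by auto
  moreover have "left_wins_first (disj_sum Y (neg X)) \<longleftrightarrow> \<not> game_le Y X"
    unfolding left_wins_first_sum game_le_iff[of Y X] opts_neg using 3 4 by auto
  ultimately show ?case by blast
qed

text \<open>Left's strategy is carried over from \<open>X + Z\<close> to \<open>Y + Z\<close>.
  Suppose it moves to \<open>X'\<close> in \<open>X\<close>. As \<open>X'\<close> is not above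
  \<open>Y\<close>, either \<open>Y\<close> has a Left option above \<open>X'\<close>, which is
  played instead, or \<open>X'\<close> has a Right option \<open>X''\<close> below \<open>Y\<close>.
  In the latter case Left, who wins against all replies, also wins \<open>X'' + Z\<close> moving
  first, and the induction applies to \<open>X''\<close> and \<open>Y\<close>.\<close>

lemma game_le_sum_wins:
  assumes "game_le X Y"
  shows "(left_wins_first (disj_sum X Z) \<longrightarrow> left_wins_first (disj_sum Y Z)) \<and>
         (\<not> right_wins_first (disj_sum X Z) \<longrightarrow> \<not> right_wins_first (disj_sum Y Z))"
  using assms
proof (induction "size X + size Y + size Z" arbitrary: X Y Z rule: less_induct)
  case less
  have L: "left_wins_first (disj_sum Y' Z')"
    if "left_wins_first (disj_sum X' Z')" "game_le X' Y'"
      "size X' + size Y' + size Z' < size X + size Y + size Z" for X' Y' Z'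
    using less.hyps that by blast
  have R: "\<not> right_wins_first (disj_sum Y' Z')"
    if "\<not> right_wins_first (disj_sum X' Z')" "game_le X' Y'"
      "size X' + size Y' + size Z' < size X + size Y + size Z" for X' Y' Z'
    using less.hyps that by blast
  have "left_wins_first (disj_sum Y Z)" if X: "left_wins_first (disj_sum X Z)"
    using X[unfolded left_wins_first_sum]
  proof (elim disjE bexE)
    fix X' assume X': "X' |\<in>| left_opts X" and w: "\<not> right_wins_first (disj_sum X' Z)"
    from X' less.prems have "\<not> game_le Y X'" by (meson game_le_iff)
    then consider Y' where "Y' |\<in>| left_opts Y" "game_le X' Y'"
      | X'' where "X'' |\<in>| right_opts X'" "game_le X'' Y"
      by (subst (asm) game_le_iff) auto
    then show ?thesis
    proof cases
      case 1
      have "\<not> right_wins_first (disj_sum Y' Z)"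
        by (rule R[OF w 1(2)]) (use size_left_opts[OF 1(1)] size_left_opts[OF X'] in simp)
      with 1(1) show ?thesis unfolding left_wins_first_sum by blast
    next
      case 2
      have "left_wins_first (disj_sum X'' Z)" using w 2(1) unfolding right_wins_first_sum by blast
      then show ?thesis
        by (rule L[OF _ 2(2)]) (use size_right_opts[OF 2(1)] size_left_opts[OF X'] in simp)
    qed
  next
    fix Z' assume Z': "Z' |\<in>| left_opts Z" and w: "\<not> right_wins_first (disj_sum X Z')"
    have "\<not> right_wins_first (disj_sum Y Z')"
      by (rule R[OF w less.prems]) (use size_left_opts[OF Z'] in simp)
    with Z' show ?thesis unfolding left_wins_first_sum by blast
  qed
  moreover have "\<not> right_wins_first (disj_sum Y Z)" if X: "\<not> right_wins_first (disj_sum X Z)"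
  proof (subst right_wins_first_sum, intro notI, elim disjE bexE)
    fix Y' assume Y': "Y' |\<in>| right_opts Y" and w: "\<not> left_wins_first (disj_sum Y' Z)"
    from Y' less.prems have "\<not> game_le Y' X" by (meson game_le_iff)
    then consider X' where "X' |\<in>| right_opts X" "game_le X' Y'"
      | Y'' where "Y'' |\<in>| left_opts Y'" "game_le X Y''"
      by (subst (asm) game_le_iff) auto
    then show False
    proof cases
      case 1
      have "left_wins_first (disj_sum X' Z)" using X 1(1) unfolding right_wins_first_sum by blast
      then have "left_wins_first (disj_sum Y' Z)"
        by (rule L[OF _ 1(2)]) (use size_right_opts[OF 1(1)] size_right_opts[OF Y'] in simp)
      with w show False by blast
    next
      case 2
      have "\<not> right_wins_first (disj_sum Y'' Z)"
        by (rule R[OF X 2(2)]) (use size_left_opts[OF 2(1)] size_right_opts[OF Y'] in simp)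
      with 2(1) w show False unfolding left_wins_first_sum by blast
    qed
  next
    fix Z' assume Z': "Z' |\<in>| right_opts Z" and w: "\<not> left_wins_first (disj_sum Y Z')"
    have "left_wins_first (disj_sum X Z')" using X Z' unfolding right_wins_first_sum by blast
    then have "left_wins_first (disj_sum Y Z')"
      by (rule L[OF _ less.prems]) (use size_right_opts[OF Z'] in simp)
    with w show False by blast
  qed
  ultimately show ?case by blast
qed

lemma outcome_eq_iff:
  "outcome X = outcome Y \<longleftrightarrow> (left_wins_first X \<longleftrightarrow> left_wins_first Y) \<and> (right_wins_first X \<longleftrightarrow> right_wins_first Y)"
  by (auto simp: outcome_def)

lemma game_eq_iff: "game_eq X Y \<longleftrightarrow> X \<approx> Y"
proof
  assume "game_eq X Y"
  \<comment> \<open>The test game \<open>neg X\<close> suffices: the second player wins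
    \<open>X - X\<close>, hence also \<open>Y - X\<close>, and these two failures of the first
    player are the two inequalities.\<close>
  then have "outcome (disj_sum X (neg X)) = outcome (disj_sum Y (neg X))"
    unfolding game_eq_def by blast
  then show "X \<approx> Y"
    by (simp add: outcome_eq_iff wins_first_diff equal_val_def)
next
  assume "X \<approx> Y"
  then show "game_eq X Y"
    unfolding game_eq_def outcome_eq_iff equal_val_def using game_le_sum_wins by blast
qed

text \<open>Used to pass to undominated options and to replace options by equal
  representatives.\<close>

lemma equal_val_Game:
  assumes "\<And>X. X |\<in>| L \<Longrightarrow> \<exists>Y |\<in>| L'. game_le X Y" "\<And>X. X |\<in>| L' \<Longrightarrow> \<exists>Y |\<in>| L. game_le X Y"
    and "\<And>X. X |\<in>| R \<Longrightarrow> \<exists>Y |\<in>| R'. game_le Y X" "\<And>X. X |\<in>| R' \<Longrightarrow> \<exists>Y |\<in>| R. game_le Y X"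
  shows "Game L R \<approx> Game L' R'"
proof -
  have *: "game_le (Game L R) (Game L' R')"
    if L: "\<And>X. X |\<in>| L \<Longrightarrow> \<exists>Y |\<in>| L'. game_le X Y"
      and R: "\<And>X. X |\<in>| R' \<Longrightarrow> \<exists>Y |\<in>| R. game_le Y X" for L R L' R'
  proof (subst game_le_iff, intro conjI ballI notI)
    fix X assume "X |\<in>| left_opts (Game L R)" and le: "game_le (Game L' R') X"
    then obtain Y where "Y |\<in>| L'" "game_le X Y" using L by auto
    then show False using le left_opt_not_ge[of Y "Game L' R'"] game_le_trans by auto
  next
    fix X assume "X |\<in>| right_opts (Game L' R')" and le: "game_le X (Game L R)"
    then obtain Y where "Y |\<in>| R" "game_le Y X" using R by auto
    then show False using le right_opt_not_le[of Y "Game L R"] game_le_trans by auto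
  qed
  show ?thesis unfolding equal_val_def using *[of L L' R' R] *[of L' L R R'] assms by blast
qed

section \<open>Games born by a given day\<close>

lemma born_by_Suc_iff:
  "X \<in> born_by (Suc k) \<longleftrightarrow> (\<forall>Y. Y |\<in>| left_opts X \<or> Y |\<in>| right_opts X \<longrightarrow> Y \<in> born_by k)"
proof (cases X)
  case (Game L R)
  have "birthday X \<le> Suc k" if "\<forall>Y. Y |\<in>| L \<or> Y |\<in>| R \<longrightarrow> birthday Y \<le> k"
    unfolding Game by (simp, rule Least_le) (use that in auto)
  moreover have "birthday Y < birthday X" if "Y |\<in>| L \<or> Y |\<in>| R" for Y
    using birthday_less[of Y L R] that Game by auto
  ultimately show ?thesis
    unfolding born_by_def using Game by fastforce
qed

lemma born_by_0_iff: "X \<in> born_by 0 \<longleftrightarrow> X = Game {||} {||}"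
proof (cases X)
  case (Game L R)
  have "birthday Y < birthday X" if "Y |\<in>| L \<or> Y |\<in>| R" for Y
    using birthday_less[of Y L R] that Game by auto
  then have "birthday X = 0 \<Longrightarrow> L = {||} \<and> R = {||}" by fastforce
  moreover have "birthday (Game {||} {||}) = 0" by simp
  ultimately show ?thesis unfolding born_by_def using Game by auto
qed

lemma born_by_mono: "k \<le> l \<Longrightarrow> born_by k \<subseteq> born_by l"
  by (auto simp: born_by_def)

text \<open>The test games that matter are the options of \<open>X\<close> and \<open>Y\<close>,
  which are born by day \<open>k\<close>: a Left option \<open>H\<close> of \<open>X\<close> above
  \<open>Y\<close> would have to be above \<open>X\<close>, and a Right option of \<open>Y\<close>
  below \<open>X\<close> would have to be below \<open>Y\<close>.\<close>

lemma born_by_le_iff: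
  assumes "X \<in> born_by (Suc k)" "Y \<in> born_by (Suc k)"
  shows "game_le X Y \<longleftrightarrow> (\<forall>H\<in>born_by k. (game_le H X \<longrightarrow> game_le H Y) \<and> (game_le Y H \<longrightarrow> game_le X H))"
proof
  show "game_le X Y \<Longrightarrow> \<forall>H\<in>born_by k. (game_le H X \<longrightarrow> game_le H Y) \<and> (game_le Y H \<longrightarrow> game_le X H)"
    using game_le_trans by blast
  assume *: "\<forall>H\<in>born_by k. (game_le H X \<longrightarrow> game_le H Y) \<and> (game_le Y H \<longrightarrow> game_le X H)"
  show "game_le X Y"
    using assms * left_opt_not_ge right_opt_not_le
    by (subst game_le_iff) (auto simp: born_by_Suc_iff)
qed

lemma born_by_realise:
  assumes D: "\<And>H K. H \<in> born_by k \<Longrightarrow> K \<in> D \<Longrightarrow> game_le H K \<Longrightarrow> H \<in> D"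
    and U: "\<And>H K. H \<in> born_by k \<Longrightarrow> K \<in> U \<Longrightarrow> game_le K H \<Longrightarrow> H \<in> U"
    and DU: "\<And>H K. H \<in> D \<Longrightarrow> K \<in> U \<Longrightarrow> game_le H K"
    and sub: "D \<subseteq> born_by k" "U \<subseteq> born_by k"
  obtains X where "X \<in> born_by (Suc k)"
    "\<And>H. H \<in> born_by k \<Longrightarrow> game_le H X \<longleftrightarrow> H \<in> D" "\<And>H. H \<in> born_by k \<Longrightarrow> game_le X H \<longleftrightarrow> H \<in> U"
proof
  \<comment> \<open>The largest possible option sets: a game outside \<open>U\<close> must not be
    above \<open>X\<close>, which being a Left option guarantees, and a game in \<open>U\<close>
    must not be a Left option. The Right options are dual.\<close>
  define X where "X = Game (Abs_fset (born_by k - U)) (Abs_fset (born_by k - D))"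
  have opts: "H |\<in>| left_opts X \<longleftrightarrow> H \<in> born_by k - U" "H |\<in>| right_opts X \<longleftrightarrow> H \<in> born_by k - D" for H
    using finite_born_by[of k] by (simp_all add: X_def Abs_fset_inverse)
  show "X \<in> born_by (Suc k)" using opts by (auto simp: born_by_Suc_iff)
  have opt_born: "H' \<in> born_by k" if "H \<in> born_by k" "H' |\<in>| left_opts H \<or> H' |\<in>| right_opts H" for H H'
  proof (cases k)
    case 0 with that show ?thesis by (auto simp: born_by_0_iff)
  next
    case (Suc j) with that show ?thesis using born_by_Suc_iff[of H j] born_by_mono[of j k] by auto
  qed
  fix H assume H: "H \<in> born_by k"
  show "game_le H X \<longleftrightarrow> H \<in> D"
  proof
    show "game_le H X \<Longrightarrow> H \<in> D" using H opts right_opt_not_le by blast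
    assume "H \<in> D"
    show "game_le H X"
    proof (subst game_le_iff, intro conjI ballI notI)
      \<comment> \<open>An offending \<open>H'\<close> is itself born by day \<open>k\<close>, so it
        belongs to \<open>U\<close> and is therefore above \<open>H\<close>, which no Left option of
        \<open>H\<close> is.\<close>
      fix H' assume H': "H' |\<in>| left_opts H" and "game_le X H'"
      then have "H' \<in> U" using opt_born[OF H, of H'] opts left_opt_not_ge by blast
      then have "game_le H H'" using DU \<open>H \<in> D\<close> by blast
      with H' show False using left_opt_not_ge by blast
    next
      fix Y assume "Y |\<in>| right_opts X" "game_le Y H"
      with D \<open>H \<in> D\<close> show False by (auto simp: opts)
    qed
  qed
  show "game_le X H \<longleftrightarrow> H \<in> U"
  proof
    show "game_le X H \<Longrightarrow> H \<in> U" using H opts left_opt_not_ge by blast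
    assume "H \<in> U"
    show "game_le X H"
    proof (subst game_le_iff, intro conjI ballI notI)
      fix H' assume H': "H' |\<in>| right_opts H" and "game_le H' X"
      then have "H' \<in> D" using opt_born[OF H, of H'] opts right_opt_not_le by blast
      then have "game_le H' H" using DU \<open>H \<in> U\<close> by blast
      with H' show False using right_opt_not_le by blast
    next
      fix Y assume "Y |\<in>| left_opts X" "game_le H Y"
      with U \<open>H \<in> U\<close> show False by (auto simp: opts)
    qed
  qed
qed

section \<open>Digraphs given by an arc relation\<close>

lemma dominates_play_vertex:
  "x \<rightarrow>\<^bsub>play_vertex G u\<^esub> y \<longleftrightarrow> x \<rightarrow>\<^bsub>G\<^esub> y \<and> x \<in> verts (play_vertex G u) \<and> y \<in> verts (play_vertex G u)"
  by (auto simp: play_vertex_def arcs_ends_def arc_to_ends_def image_iff)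

lemma verts_play_vertex: "verts (play_vertex G u) = verts G - closed_out_nbhd G u"
  by (simp add: play_vertex_def)

text \<open>Arcs are compared only between distinct vertices: a played vertex is deleted in any
  case, so loops do not affect the game. This lets later constructions use relations with
  loops.\<close>

lemma placement_game_iso:
  assumes "finite (verts G)" "inj_on f (verts G)" "verts G' = f ` verts G"
    and "\<And>u v. u \<in> verts G \<Longrightarrow> v \<in> verts G \<Longrightarrow> u \<noteq> v \<Longrightarrow> f u \<rightarrow>\<^bsub>G'\<^esub> f v \<longleftrightarrow> u \<rightarrow>\<^bsub>G\<^esub> v"
    and "\<And>u. u \<in> verts G \<Longrightarrow> \<phi>' (f u) = \<phi> u"
  shows "placement_game G' \<phi>' = placement_game G \<phi>"
  using assms
proof (induction "card (verts G)" arbitrary: G G' rule: less_induct)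
  case less
  have fin': "finite (verts G')" using less.prems by simp
  have IH: "placement_game (play_vertex G' (f u)) \<phi>' = placement_game (play_vertex G u) \<phi>"
    if u: "u \<in> verts G" for u
  proof (rule less.hyps)
    show "card (verts (play_vertex G u)) < card (verts G)"
      using less.prems(1) u by (rule card_play_vertex)
    show fin: "finite (verts (play_vertex G u))"
      using less.prems(1) by (simp add: verts_play_vertex)
    show "inj_on f (verts (play_vertex G u))"
      using less.prems(2) by (rule inj_on_subset) (simp add: verts_play_vertex)
    show *: "verts (play_vertex G' (f u)) = f ` verts (play_vertex G u)"
    proof -
      have "f v \<in> closed_out_nbhd G' (f u) \<longleftrightarrow> v \<in> closed_out_nbhd G u" if v: "v \<in> verts G" for v
        using less.prems(2,4) u v by (cases "u = v") (auto simp: closed_out_nbhd_def inj_on_eq_iff)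
      then show ?thesis using less.prems(3) by (auto simp: verts_play_vertex)
    qed
    show "f x \<rightarrow>\<^bsub>play_vertex G' (f u)\<^esub> f y \<longleftrightarrow> x \<rightarrow>\<^bsub>play_vertex G u\<^esub> y"
      if "x \<in> verts (play_vertex G u)" "y \<in> verts (play_vertex G u)" "x \<noteq> y" for x y
      using that less.prems(4)[of x y] unfolding dominates_play_vertex *
      by (auto simp: verts_play_vertex)
    show "\<phi>' (f x) = \<phi> x" if "x \<in> verts (play_vertex G u)" for x
      using that less.prems(5) by (simp add: verts_play_vertex)
  qed
  have opts: "{placement_game (play_vertex G' v) \<phi>' | v. v \<in> verts G' \<and> \<phi>' v = c} =
        {placement_game (play_vertex G u) \<phi> | u. u \<in> verts G \<and> \<phi> u = c}" for c
  proof -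
    have "{v \<in> verts G'. \<phi>' v = c} = f ` {u \<in> verts G. \<phi> u = c}"
      using less.prems(3,5) by auto
    then have "(\<lambda>v. placement_game (play_vertex G' v) \<phi>') ` {v \<in> verts G'. \<phi>' v = c} =
        (\<lambda>u. placement_game (play_vertex G u) \<phi>) ` {u \<in> verts G. \<phi> u = c}"
      using IH by (auto simp: image_image)
    then show ?thesis by (simp add: setcompr_eq_image)
  qed
  show ?case
    by (rule game.expand)
       (simp add: fset_inject[symmetric] placement_game_opts[OF fin'] placement_game_opts[OF less.prems(1)] opts)
qed

text \<open>With one fixed relation for all induced subgraphs, a position is just the set of
  remaining vertices.\<close>

definition rel_digraph :: "('a \<times> 'a) set \<Rightarrow> 'a set \<Rightarrow> ('a, 'a \<times> 'a) pre_digraph" where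
  "rel_digraph E S = \<lparr>verts = S, arcs = E \<inter> S \<times> S, tail = fst, head = snd\<rparr>"

lemma verts_rel_digraph [simp]: "verts (rel_digraph E S) = S"
  by (simp add: rel_digraph_def)

lemma dominates_rel_digraph: "u \<rightarrow>\<^bsub>rel_digraph E S\<^esub> v \<longleftrightarrow> (u, v) \<in> E \<and> u \<in> S \<and> v \<in> S"
  by (auto simp: rel_digraph_def arcs_ends_def arc_to_ends_def image_iff)

lemma digraph_rel_digraph:
  assumes "finite S" "irrefl E"
  shows "digraph (rel_digraph E S)"
  by unfold_locales (use assms in \<open>auto simp: rel_digraph_def arc_to_ends_def irrefl_def\<close>)

lemma play_rel_digraph:
  assumes "u \<in> S"
  shows "play_vertex (rel_digraph E S) u = rel_digraph E (S - insert u (E `` {u}))"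
proof -
  have "S - closed_out_nbhd (rel_digraph E S) u = S - insert u (E `` {u})"
    using assms by (auto simp: closed_out_nbhd_def dominates_rel_digraph)
  moreover have "rel_digraph E S \<restriction> T = rel_digraph E T" if "T \<subseteq> S" for T
    using that by (auto simp: rel_digraph_def induce_subgraph_def)
  ultimately show ?thesis by (simp add: play_vertex_def)
qed

abbreviation rel_game :: "('a \<times> 'a) set \<Rightarrow> ('a \<Rightarrow> colour) \<Rightarrow> 'a set \<Rightarrow> game" where
  "rel_game E \<phi> S \<equiv> placement_game (rel_digraph E S) \<phi>"

lemma opts_rel_game:
  assumes "finite S"
  shows "X |\<in>| left_opts (rel_game E \<phi> S) \<longleftrightarrow> (\<exists>u\<in>S. \<phi> u = Blue \<and> X = rel_game E \<phi> (S - insert u (E `` {u})))"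
    and "X |\<in>| right_opts (rel_game E \<phi> S) \<longleftrightarrow> (\<exists>u\<in>S. \<phi> u = Red \<and> X = rel_game E \<phi> (S - insert u (E `` {u})))"
  using assms by (auto simp: placement_game_opts; metis play_rel_digraph)+

lemma rel_game_iso:
  assumes "finite S" "inj_on f S"
    and "\<And>u v. u \<in> S \<Longrightarrow> v \<in> S \<Longrightarrow> u \<noteq> v \<Longrightarrow> (f u, f v) \<in> E' \<longleftrightarrow> (u, v) \<in> E"
    and "\<And>u. u \<in> S \<Longrightarrow> \<phi>' (f u) = \<phi> u"
  shows "rel_game E' \<phi>' (f ` S) = rel_game E \<phi> S"
  by (rule placement_game_iso[where f = f]) (use assms in \<open>auto simp: dominates_rel_digraph\<close>)

lemma min_verts_le_rel_game:
  fixes E :: "('a \<times> 'a) set"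
  assumes "finite S" "rel_game E \<phi> S \<approx> X"
  shows "representable_on X (card S)" "min_verts X \<le> card S"
proof -
  obtain f :: "'a \<Rightarrow> nat" and n where f: "inj_on f S" "f ` S = {i. i < n}"
    using finite_imp_inj_to_nat_seg[OF assms(1)] by blast
  \<comment> \<open>Loops of \<open>E\<close> are discarded here, so that the renamed relation gives
    a genuine digraph with the same game.\<close>
  define E' where "E' = {(f u, f v) | u v. u \<in> S \<and> v \<in> S \<and> u \<noteq> v \<and> (u, v) \<in> E}"
  have "rel_game E' (\<phi> \<circ> inv_into S f) (f ` S) = rel_game E \<phi> S"
    by (rule rel_game_iso) (use assms f in \<open>auto simp: E'_def inj_on_eq_iff\<close>)
  moreover have "irrefl E'"
    using f by (auto simp: irrefl_def E'_def inj_on_eq_iff)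
  ultimately show "representable_on X (card S)"
    unfolding representable_on_def
    using assms digraph_rel_digraph[of "f ` S" E'] f(1)
    by (intro exI[of _ "rel_digraph E' (f ` S)"] exI[of _ "\<phi> \<circ> inv_into S f"])
       (auto simp: game_eq_iff card_image)
  then show "min_verts X \<le> card S" unfolding min_verts_def by (rule Least_le)
qed

section \<open>Universal coloured digraphs\<close>

text \<open>\<open>Opt c H\<close> is the move to \<open>H\<close>. The hubs and points form a gadget that punishes every other
  move: \<open>Hub c s\<close> keeps only the points of side \<open>s\<close>, of which the first mover there keeps just
  those of their own colour. All other moves of a player delete the points of that player's
  colour on some side, so that the opponent's hub of this side is a winning reply.\<close>

datatype 'a vertex = Old 'a | Opt colour game | Hub colour bool | Pt colour bool nat

primrec vertex_colour :: "('a \<Rightarrow> colour) \<Rightarrow> 'a vertex \<Rightarrow> colour" where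
  "vertex_colour \<phi> (Old u) = \<phi> u"
| "vertex_colour \<phi> (Opt c H) = c"
| "vertex_colour \<phi> (Hub c s) = c"
| "vertex_colour \<phi> (Pt c s i) = c"

text \<open>A point deletes the other colour on its own side and its own colour on the other side.
  The first kind of arc wins the position left by a hub for the player who moves there first; the
  second makes a point a bad opening move, as the opponent retreats to the other side. Points of
  equal colour and side are independent.\<close>

fun vertex_arc :: "('a \<times> 'a) set \<Rightarrow> ('a \<Rightarrow> colour) \<Rightarrow> (game \<Rightarrow> 'a set) \<Rightarrow> 'a vertex \<Rightarrow> 'a vertex \<Rightarrow> bool" where
  "vertex_arc E \<phi> S (Old u) (Old v) = ((u, v) \<in> E)"
| "vertex_arc E \<phi> S (Old u) (Pt c s i) = (c = \<phi> u)"
| "vertex_arc E \<phi> S (Old u) _ = False"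
| "vertex_arc E \<phi> S (Opt c H) w = (w \<notin> Old ` S H)"
| "vertex_arc E \<phi> S (Hub c s) w = (\<forall>c' i. w \<noteq> Pt c' s i)"
| "vertex_arc E \<phi> S (Pt c s i) (Pt c' s' j) = ((c = c') = (s \<noteq> s'))"
| "vertex_arc E \<phi> S (Pt c s i) _ = False"

definition vertex_rel where "vertex_rel E \<phi> S = {(u, v). vertex_arc E \<phi> S u v}"

text \<open>There are \<open>m + 1\<close> points per colour and side because the first mover after
  a hub spends one of them and must still keep \<open>m\<close>.\<close>

definition gadget :: "nat \<Rightarrow> 'a vertex set" where
  "gadget m = range (case_prod Hub) \<union> (\<lambda>(c, s, i). Pt c s i) ` (UNIV \<times> UNIV \<times> {..m})"

lemma UNIV_colour: "(UNIV :: colour set) = {Blue, Red}"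
  using colour.exhaust by auto

instance colour :: finite
  by standard (simp add: UNIV_colour)

lemma finite_gadget [simp]: "finite (gadget m)"
  by (simp add: gadget_def)

lemma card_gadget: "card (gadget m :: 'a vertex set) \<le> 4 * m + 8"
proof -
  have 2: "card (UNIV :: colour set) = 2" unfolding UNIV_colour by simp
  have "card (range (case_prod Hub) :: 'a vertex set) \<le> card ((UNIV :: colour set) \<times> (UNIV :: bool set))"
    unfolding UNIV_Times_UNIV by (rule card_image_le) simp
  moreover have "card ((\<lambda>(c, s, i). Pt c s i) ` (UNIV \<times> UNIV \<times> {..m}) :: 'a vertex set)
      \<le> card ((UNIV :: colour set) \<times> (UNIV :: bool set) \<times> {..m})"
    by (rule card_image_le) simp
  ultimately have "card (range (case_prod Hub) :: 'a vertex set) \<le> 4"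
    "card ((\<lambda>(c, s, i). Pt c s i) ` (UNIV \<times> UNIV \<times> {..m}) :: 'a vertex set) \<le> 4 * m + 4"
    unfolding card_cartesian_product 2 by simp_all
  then show ?thesis
    unfolding gadget_def by (intro order.trans[OF card_Un_le]) linarith
qed

lemma card_extension:
  assumes "finite V" "finite A" "finite B"
  shows "card (Old ` V \<union> Opt Blue ` A \<union> Opt Red ` B \<union> gadget m) \<le> card V + card A + card B + (4 * m + 8)"
  using assms by (intro order.trans[OF card_Un_le] add_mono card_gadget card_image_le)

text \<open>At least \<open>n\<close> free moves for Right and none for Left form an integer at most
  \<open>-n\<close>, the least value born by day \<open>n\<close>: along any line of Right moves in
  \<open>X\<close>, Right can match each move here.\<close>

lemma red_independent_le:
  assumes "finite S" "n \<le> card S" "\<And>u. u \<in> S \<Longrightarrow> \<phi> u = Red" "E \<inter> S \<times> S \<subseteq> Id" "X \<in> born_by n"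
  shows "game_le (rel_game E \<phi> S) X"
  using assms
proof (induction n arbitrary: S X)
  case 0
  then show ?case by (subst game_le_iff) (auto simp: opts_rel_game born_by_0_iff)
next
  case (Suc n)
  from Suc.prems(2) obtain u where u: "u \<in> S" by fastforce
  define S' where "S' = S - insert u (E `` {u})"
  have S': "S' = S - {u}" using Suc.prems(4) u by (auto simp: S'_def)
  have opt: "rel_game E \<phi> S' |\<in>| right_opts (rel_game E \<phi> S)"
    using Suc.prems(1,3) u by (auto simp: opts_rel_game S'_def)
  have "game_le (rel_game E \<phi> S') Y" if "Y |\<in>| right_opts X" for Y
    by (rule Suc.IH) (use Suc.prems that u in \<open>auto simp: S' born_by_Suc_iff\<close>)
  then have "\<not> game_le Y (rel_game E \<phi> S)" if "Y |\<in>| right_opts X" for Y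
    using that opt right_opt_not_le game_le_trans by blast
  then show ?case
    using Suc.prems(1,3) by (subst game_le_iff) (auto simp: opts_rel_game)
qed

lemma blue_independent_ge:
  assumes "finite S" "n \<le> card S" "\<And>u. u \<in> S \<Longrightarrow> \<phi> u = Blue" "E \<inter> S \<times> S \<subseteq> Id" "X \<in> born_by n"
  shows "game_le X (rel_game E \<phi> S)"
  using assms
proof (induction n arbitrary: S X)
  case 0
  then show ?case by (subst game_le_iff) (auto simp: opts_rel_game born_by_0_iff)
next
  case (Suc n)
  from Suc.prems(2) obtain u where u: "u \<in> S" by fastforce
  define S' where "S' = S - insert u (E `` {u})"
  have S': "S' = S - {u}" using Suc.prems(4) u by (auto simp: S'_def)
  have opt: "rel_game E \<phi> S' |\<in>| left_opts (rel_game E \<phi> S)"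
    using Suc.prems(1,3) u by (auto simp: opts_rel_game S'_def)
  have "game_le Y (rel_game E \<phi> S')" if "Y |\<in>| left_opts X" for Y
    by (rule Suc.IH) (use Suc.prems that u in \<open>auto simp: S' born_by_Suc_iff\<close>)
  then have "\<not> game_le (rel_game E \<phi> S) Y" if "Y |\<in>| left_opts X" for Y
    using that opt left_opt_not_ge game_le_trans by blast
  then show ?case
    using Suc.prems(1,3) by (subst game_le_iff) (auto simp: opts_rel_game)
qed

lemma points_le:
  fixes E :: "('a \<times> 'a) set"
  assumes "X \<in> born_by m" "card A \<ge> m" "finite A"
  shows "game_le (rel_game (vertex_rel E \<phi> S) (vertex_colour \<phi>) (Pt Red s ` A)) X"
    and "game_le X (rel_game (vertex_rel E \<phi> S) (vertex_colour \<phi>) (Pt Blue s ` A))"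
proof -
  have "card (Pt c s ` A :: 'a vertex set) = card A" for c by (rule card_image) (simp add: inj_on_def)
  with assms show "game_le (rel_game (vertex_rel E \<phi> S) (vertex_colour \<phi>) (Pt Red s ` A)) X"
    "game_le X (rel_game (vertex_rel E \<phi> S) (vertex_colour \<phi>) (Pt Blue s ` A))"
    by (intro red_independent_le[where n = m] blue_independent_ge[where n = m]; auto simp: vertex_rel_def)+
qed

text \<open>The \<open>Opt\<close> moves lead to exactly the options of \<open>X\<close>, up to
  equality. After any other move the opponent can reach an integer at least as good for them as
  every value born by day \<open>m\<close>, in particular as \<open>X\<close>, so such a move cannot
  spoil either inequality.\<close>

lemma rel_game_extension:
  fixes E :: "('a \<times> 'a) set"
  assumes V: "finite V" and X: "X \<in> born_by m"
    and S: "\<And>H. H |\<in>| left_opts X \<or> H |\<in>| right_opts X \<Longrightarrow> S H \<subseteq> V \<and> rel_game E \<phi> (S H) \<approx> H"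
  defines "W \<equiv> Old ` V \<union> Opt Blue ` fset (left_opts X) \<union> Opt Red ` fset (right_opts X) \<union> gadget m"
  shows "rel_game (vertex_rel E \<phi> S) (vertex_colour \<phi>) W \<approx> X"
proof -
  let ?E = "vertex_rel E \<phi> S" and ?\<phi> = "vertex_colour \<phi>"
  let ?g = "rel_game ?E ?\<phi>"
  define G where "G = ?g W"
  define after where "after T u = T - insert u (?E `` {u})" for T u
  have finW: "finite W" using V by (simp add: W_def)
  have fin_after: "finite (after T u)" if "finite T" for T u using that by (simp add: after_def)
  have L: "Y |\<in>| left_opts (?g T) \<longleftrightarrow> (\<exists>u\<in>T. ?\<phi> u = Blue \<and> Y = ?g (after T u))"
   and R: "Y |\<in>| right_opts (?g T) \<longleftrightarrow> (\<exists>u\<in>T. ?\<phi> u = Red \<and> Y = ?g (after T u))" if "finite T" for Y T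
    using opts_rel_game[OF that] by (auto simp: after_def)
  have after_Opt: "?g (after W (Opt c H)) \<approx> H"
    if H: "H |\<in>| left_opts X \<or> H |\<in>| right_opts X" for c H
  proof -
    have "after W (Opt c H) = Old ` S H"
      using S[OF H] by (auto simp: after_def vertex_rel_def W_def)
    moreover have "?g (Old ` S H) = rel_game E \<phi> (S H)"
      using finite_subset[OF _ V] S[OF H] by (intro rel_game_iso) (auto simp: vertex_rel_def inj_on_def)
    ultimately show ?thesis using S[OF H] by simp
  qed
  have Hub_W: "Hub c s \<in> W" for c s by (force simp: W_def gadget_def)
  have Pt_W: "Pt c s i \<in> W \<longleftrightarrow> i \<le> m" for c s i by (auto simp: W_def gadget_def image_iff)
  have after_Hub: "after W (Hub c s) = (\<lambda>(c, i). Pt c s i) ` (UNIV \<times> {..m})" for c s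
    by (auto simp: after_def vertex_rel_def Pt_W)
  have after_Hub_Pt: "after (after W (Hub c s)) (Pt c' s 0) = Pt c' s ` ({..m} - {0})" for c c' s
    unfolding after_Hub by (auto simp: after_def vertex_rel_def)
  have two: "c = c'" if "c \<noteq> d" "c' \<noteq> d" for c c' d :: colour
    using that by (cases c; cases c'; cases d) auto
  have Pt_after_Hub: "Pt c' s 0 \<in> after W (Hub c s)" for c c' s
    by (auto simp: after_Hub)
  have punish: "\<exists>s. after (after W u) (Hub c s) = Pt c s ` {..m} \<and> Hub c s \<in> after W u"
    if c: "?\<phi> u \<noteq> c" and u: "u \<in> W" "\<And>c H. u \<noteq> Opt c H" "\<And>c s. u \<noteq> Hub c s" for u c
  proof (cases u)
    case (Old v)
    have "after (after W u) (Hub c False) = Pt c False ` {..m}"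
      using c unfolding Old
      by (auto simp: after_def vertex_rel_def Pt_W image_iff dest: two[of _ c])
    moreover have "Hub c False \<in> after W u" by (simp add: after_def Old Hub_W vertex_rel_def)
    ultimately show ?thesis by blast
  next
    case (Pt d s i)
    have "after (after W u) (Hub c (\<not> s)) = Pt c (\<not> s) ` {..m}"
      using c unfolding Pt
      by (auto simp: after_def vertex_rel_def Pt_W image_iff dest: two[of _ c])
    moreover have "Hub c (\<not> s) \<in> after W u" by (simp add: after_def Pt Hub_W vertex_rel_def)
    ultimately show ?thesis by blast
  qed (use u in auto)
  have "game_le G X"
  proof (subst game_le_iff, intro conjI ballI)
    fix Y assume "Y |\<in>| left_opts G"
    then obtain u where u: "u \<in> W" "?\<phi> u = Blue" and Y: "Y = ?g (after W u)"
      using L[OF finW] unfolding G_def by blast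
    consider c H where "u = Opt c H" | c s where "u = Hub c s" | "\<And>c H. u \<noteq> Opt c H" "\<And>c s. u \<noteq> Hub c s"
      by blast
    then show "\<not> game_le X Y"
    proof cases
      case 1
      with u have H: "H |\<in>| left_opts X" by (auto simp: W_def gadget_def)
      then show ?thesis
        using after_Opt[of H c] left_opt_not_ge[OF H] game_le_trans unfolding Y 1 equal_val_def by blast
    next
      case 2
      \<comment> \<open>Right replies with point 0 on the side kept by the hub. This removes all
        blue points there and leaves \<open>m\<close> red ones.\<close>
      have "?g (Pt Red s ` ({..m} - {0})) |\<in>| right_opts Y"
        unfolding Y R[OF fin_after[OF finW]] 2 by (rule bexI[OF _ Pt_after_Hub[where c' = Red]]) (simp add: after_Hub_Pt)
      moreover have "game_le (?g (Pt Red s ` ({..m} - {0}))) X"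
        by (rule points_le(1)[OF X]) auto
      ultimately show ?thesis using right_opt_not_le game_le_trans by blast
    next
      \<comment> \<open>An old vertex or a point: Right's hub now keeps a side that has red points
        only.\<close>
      case 3
      then obtain s where s: "after (after W u) (Hub Red s) = Pt Red s ` {..m}" "Hub Red s \<in> after W u"
        using punish[of u Red] u by auto
      have "?g (Pt Red s ` {..m}) |\<in>| right_opts Y"
        unfolding Y R[OF fin_after[OF finW]] by (rule bexI[OF _ s(2)]) (simp add: s(1))
      moreover have "game_le (?g (Pt Red s ` {..m})) X"
        by (rule points_le(1)[OF X]) auto
      ultimately show ?thesis using right_opt_not_le game_le_trans by blast
    qed
  next
    fix H assume H: "H |\<in>| right_opts X"
    have "?g (after W (Opt Red H)) |\<in>| right_opts G"
      unfolding G_def R[OF finW] by (rule bexI[of _ "Opt Red H"]) (use H in \<open>auto simp: W_def\<close>)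
    then show "\<not> game_le H G"
      using after_Opt[of H Red] H right_opt_not_le game_le_trans unfolding equal_val_def by blast
  qed
  moreover have "game_le X G"
  proof (subst game_le_iff, intro conjI ballI)
    fix Y assume "Y |\<in>| right_opts G"
    then obtain u where u: "u \<in> W" "?\<phi> u = Red" and Y: "Y = ?g (after W u)"
      using R[OF finW] unfolding G_def by blast
    consider c H where "u = Opt c H" | c s where "u = Hub c s" | "\<And>c H. u \<noteq> Opt c H" "\<And>c s. u \<noteq> Hub c s"
      by blast
    then show "\<not> game_le Y X"
    proof cases
      case 1
      with u have H: "H |\<in>| right_opts X" by (auto simp: W_def gadget_def)
      then show ?thesis
        using after_Opt[of H c] right_opt_not_le[OF H] game_le_trans unfolding Y 1 equal_val_def by blast
    next
      case 2
      have "?g (Pt Blue s ` ({..m} - {0})) |\<in>| left_opts Y"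
        unfolding Y L[OF fin_after[OF finW]] 2 by (rule bexI[OF _ Pt_after_Hub[where c' = Blue]]) (simp add: after_Hub_Pt)
      moreover have "game_le X (?g (Pt Blue s ` ({..m} - {0})))"
        by (rule points_le(2)[OF X]) auto
      ultimately show ?thesis using left_opt_not_ge game_le_trans by blast
    next
      case 3
      then obtain s where s: "after (after W u) (Hub Blue s) = Pt Blue s ` {..m}" "Hub Blue s \<in> after W u"
        using punish[of u Blue] u by auto
      have "?g (Pt Blue s ` {..m}) |\<in>| left_opts Y"
        unfolding Y L[OF fin_after[OF finW]] by (rule bexI[OF _ s(2)]) (simp add: s(1))
      moreover have "game_le X (?g (Pt Blue s ` {..m}))"
        by (rule points_le(2)[OF X]) auto
      ultimately show ?thesis using left_opt_not_ge game_le_trans by blast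
    qed
  next
    fix H assume H: "H |\<in>| left_opts X"
    have "?g (after W (Opt Blue H)) |\<in>| left_opts G"
      unfolding G_def L[OF finW] by (rule bexI[of _ "Opt Blue H"]) (use H in \<open>auto simp: W_def\<close>)
    then show "\<not> game_le G H"
      using after_Opt[of H Blue] H left_opt_not_ge game_le_trans unfolding equal_val_def by blast
  qed
  ultimately show ?thesis unfolding equal_val_def G_def by blast
qed

section \<open>Digraphs whose induced subgraphs realise a whole day\<close>

definition universal :: "nat \<Rightarrow> nat \<Rightarrow> bool" where
  "universal k n \<longleftrightarrow> (\<exists>(V :: nat set) E \<phi> S. finite V \<and> card V \<le> n \<and>
     (\<forall>X\<in>born_by k. S X \<subseteq> V \<and> rel_game E \<phi> (S X) \<approx> X))"

definition representatives :: "nat \<Rightarrow> game set \<Rightarrow> bool" where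
  "representatives k \<R> \<longleftrightarrow> finite \<R> \<and> \<R> \<subseteq> born_by k \<and> (\<forall>X\<in>born_by k. \<exists>Y\<in>\<R>. X \<approx> Y)"

lemma universal_0: "universal 0 0"
proof -
  have "left_opts (rel_game {} (\<lambda>_. Blue) ({} :: nat set)) = {||}"
    "right_opts (rel_game {} (\<lambda>_. Blue) ({} :: nat set)) = {||}"
    using opts_rel_game[of "{} :: nat set"] by blast+
  then have "rel_game {} (\<lambda>_. Blue) ({} :: nat set) = X" if "X \<in> born_by 0" for X
    using that by (simp add: game.expand born_by_0_iff)
  then show ?thesis
    unfolding universal_def
    by (intro exI[of _ "{}"] exI[of _ "\<lambda>_. Blue"] exI[of _ "\<lambda>_. {}"]) simp
qed

text \<open>The number \<open>w\<close> bounds the options that remain after discarding dominated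
  ones. It is left abstract because it is used both with the number of all representatives and with
  the number of chains of a cover.\<close>

lemma options_in_representatives:
  assumes R: "representatives k \<R>" and X: "X \<in> born_by (Suc k)"
    and max: "\<And>A. A \<subseteq> \<R> \<Longrightarrow> \<exists>B\<subseteq>A. card B \<le> w \<and> (\<forall>a\<in>A. \<exists>b\<in>B. game_le a b)"
    and min: "\<And>A. A \<subseteq> \<R> \<Longrightarrow> \<exists>B\<subseteq>A. card B \<le> w \<and> (\<forall>a\<in>A. \<exists>b\<in>B. game_le b a)"
  obtains L R where "L \<subseteq> \<R>" "R \<subseteq> \<R>" "card L \<le> w" "card R \<le> w" "X \<approx> Game (Abs_fset L) (Abs_fset R)"
proof -
  define A where "A = {Y\<in>\<R>. \<exists>H. H |\<in>| left_opts X \<and> H \<approx> Y}"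
  define B where "B = {Y\<in>\<R>. \<exists>H. H |\<in>| right_opts X \<and> H \<approx> Y}"
  obtain L where L: "L \<subseteq> A" "card L \<le> w" "\<forall>a\<in>A. \<exists>b\<in>L. game_le a b"
    using max[of A] by (auto simp: A_def)
  obtain R where R': "R \<subseteq> B" "card R \<le> w" "\<forall>a\<in>B. \<exists>b\<in>R. game_le b a"
    using min[of B] by (auto simp: B_def)
  have "L \<subseteq> \<R>" "R \<subseteq> \<R>" using L(1) R'(1) by (auto simp: A_def B_def)
  moreover have "finite \<R>" using R by (simp add: representatives_def)
  ultimately have fin: "finite L" "finite R" by (blast intro: finite_subset)+
  have left: "\<exists>Y\<in>A. H \<approx> Y" if "H |\<in>| left_opts X" for H
  proof -
    from that X have "H \<in> born_by k" by (auto simp: born_by_Suc_iff)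
    then obtain Y where "Y \<in> \<R>" "H \<approx> Y" using R by (auto simp: representatives_def)
    then show ?thesis using that by (auto simp: A_def)
  qed
  have right: "\<exists>Y\<in>B. H \<approx> Y" if "H |\<in>| right_opts X" for H
  proof -
    from that X have "H \<in> born_by k" by (auto simp: born_by_Suc_iff)
    then obtain Y where "Y \<in> \<R>" "H \<approx> Y" using R by (auto simp: representatives_def)
    then show ?thesis using that by (auto simp: B_def)
  qed
  have "Game (left_opts X) (right_opts X) \<approx> Game (Abs_fset L) (Abs_fset R)"
  proof (rule equal_val_Game)
    fix H
    show "\<exists>Y|\<in>|Abs_fset L. game_le H Y" if H: "H |\<in>| left_opts X"
    proof -
      obtain Y where "Y \<in> A" "game_le H Y" using left[OF H] by (auto simp: equal_val_def)
      moreover from this L(3) obtain Z where "Z \<in> L" "game_le Y Z" by blast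
      ultimately show ?thesis using fin game_le_trans[of H Y Z] by (auto simp: Abs_fset_inverse)
    qed
    show "\<exists>Y|\<in>|Abs_fset R. game_le Y H" if H: "H |\<in>| right_opts X"
    proof -
      obtain Y where "Y \<in> B" "game_le Y H" using right[OF H] by (auto simp: equal_val_def)
      moreover from this R'(3) obtain Z where "Z \<in> R" "game_le Z Y" by blast
      ultimately show ?thesis using fin game_le_trans[of Z Y H] by (auto simp: Abs_fset_inverse)
    qed
    show "H |\<in>| Abs_fset L \<Longrightarrow> \<exists>Y|\<in>|left_opts X. game_le H Y"
      using L(1) fin by (auto simp: Abs_fset_inverse A_def equal_val_def)
    show "H |\<in>| Abs_fset R \<Longrightarrow> \<exists>Y|\<in>|right_opts X. game_le Y H"
      using R'(1) fin by (auto simp: Abs_fset_inverse B_def equal_val_def)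
  qed
  then show ?thesis using that[of L R] L R' by (auto simp: A_def B_def)
qed

text \<open>A single copy of the gadget and of the old digraph serves all values of the new day: the
  induced subgraph for \<open>X\<close> differs only in which \<open>Opt\<close> vertices it keeps.
  The increment is two such vertices per representative plus the gadget size
  \<open>4 (k + 1) + 8\<close>.\<close>

lemma universal_Suc:
  assumes U: "universal k n" and R: "representatives k \<R>"
  shows "universal (Suc k) (n + 2 * card \<R> + 4 * k + 12)"
proof -
  obtain V :: "nat set" and E \<phi> S where V: "finite V" "card V \<le> n"
    and S: "\<forall>H\<in>born_by k. S H \<subseteq> V \<and> rel_game E \<phi> (S H) \<approx> H"
    using U unfolding universal_def by (elim exE conjE) (rule that)
  have finR: "finite \<R>" using R by (simp add: representatives_def)
  define W where "W = Old ` V \<union> Opt Blue ` \<R> \<union> Opt Red ` \<R> \<union> gadget (Suc k)"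
  have finW: "finite W" using V finR by (simp add: W_def)
  have cardW: "card W \<le> n + 2 * card \<R> + 4 * k + 12"
    using card_extension[OF V(1) finR finR, of "Suc k"] V(2) by (simp add: W_def)
  \<comment> \<open>Renaming the vertices as natural numbers keeps the vertex type fixed, so that
    the construction can be iterated over the days.\<close>
  obtain f :: "nat vertex \<Rightarrow> nat" and m where f: "inj_on f W" "f ` W = {i. i < m}"
    using finite_imp_inj_to_nat_seg[OF finW] by blast
  define E' where "E' = {(f u, f v) | u v. u \<in> W \<and> v \<in> W \<and> (u, v) \<in> vertex_rel E \<phi> S}"
  define \<phi>' where "\<phi>' = vertex_colour \<phi> \<circ> inv_into W f"
  have "\<exists>T\<subseteq>f ` W. rel_game E' \<phi>' T \<approx> X" if X: "X \<in> born_by (Suc k)" for X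
  proof -
    \<comment> \<open>No reduction of the options is wanted here: with \<open>w\<close> the number
      of all representatives, every set is its own extremal subset.\<close>
    obtain A B where AB: "A \<subseteq> \<R>" "B \<subseteq> \<R>" "X \<approx> Game (Abs_fset A) (Abs_fset B)"
    proof (rule options_in_representatives[OF R X, of "card \<R>"])
      fix A assume "A \<subseteq> \<R>"
      then have "card A \<le> card \<R>" by (rule card_mono[OF finR])
      then show "\<exists>B\<subseteq>A. card B \<le> card \<R> \<and> (\<forall>a\<in>A. \<exists>b\<in>B. game_le a b)"
        and "\<exists>B\<subseteq>A. card B \<le> card \<R> \<and> (\<forall>a\<in>A. \<exists>b\<in>B. game_le b a)"
        by (intro exI[of _ A], use game_le_refl in blast)+
    qed
    let ?X = "Game (Abs_fset A) (Abs_fset B)"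
    have fin: "finite A" "finite B" using AB finR finite_subset by blast+
    have opts: "fset (left_opts ?X) = A" "fset (right_opts ?X) = B"
      using fin by (simp_all add: Abs_fset_inverse)
    have S_opt: "S H \<subseteq> V \<and> rel_game E \<phi> (S H) \<approx> H" if "H \<in> A \<or> H \<in> B" for H
      using that AB R S by (auto simp: representatives_def)
    have X': "?X \<in> born_by (Suc k)"
      using opts AB R by (auto simp: born_by_Suc_iff representatives_def)
    let ?T = "Old ` V \<union> Opt Blue ` A \<union> Opt Red ` B \<union> gadget (Suc k)"
    have sub: "?T \<subseteq> W" using AB by (auto simp: W_def)
    have "rel_game (vertex_rel E \<phi> S) (vertex_colour \<phi>) ?T \<approx> ?X"
      using rel_game_extension[OF V(1) X', of S E \<phi>] S_opt unfolding opts by blast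
    moreover have "rel_game E' \<phi>' (f ` ?T) = rel_game (vertex_rel E \<phi> S) (vertex_colour \<phi>) ?T"
    proof (rule rel_game_iso)
      show "finite ?T" using sub finW by (rule finite_subset)
      show "inj_on f ?T" using f(1) sub by (rule inj_on_subset)
      show "(f u, f v) \<in> E' \<longleftrightarrow> (u, v) \<in> vertex_rel E \<phi> S" if "u \<in> ?T" "v \<in> ?T" for u v
        using subsetD[OF sub that(1)] subsetD[OF sub that(2)] f(1) by (auto simp: E'_def inj_on_eq_iff)
      show "\<phi>' (f u) = vertex_colour \<phi> u" if "u \<in> ?T" for u
        using subsetD[OF sub that] f(1) by (simp add: \<phi>'_def)
    qed
    ultimately have "rel_game E' \<phi>' (f ` ?T) \<approx> ?X" by simp
    then have "rel_game E' \<phi>' (f ` ?T) \<approx> X"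
      by (rule equal_val_trans[OF _ equal_val_sym[OF AB(3)]])
    then show ?thesis using sub by (intro exI[of _ "f ` ?T"] conjI image_mono)
  qed
  then have "\<exists>T. \<forall>X\<in>born_by (Suc k). T X \<subseteq> f ` W \<and> rel_game E' \<phi>' (T X) \<approx> X"
    by (intro bchoice) blast
  moreover have "card (f ` W) \<le> n + 2 * card \<R> + 4 * k + 12"
    using cardW card_image_le[OF finW] le_trans by blast
  moreover have "finite (f ` W)" using finW by simp
  ultimately show ?thesis unfolding universal_def by blast
qed

text \<open>For a single game only the \<open>Opt\<close> vertices of at most \<open>w\<close>
  options on each side are built, whereas a universal digraph needs them for all
  representatives.\<close>

lemma min_verts_le_extension:
  assumes U: "universal k n" and R: "representatives k \<R>" and X: "X \<in> born_by (Suc k)"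
    and max: "\<And>A. A \<subseteq> \<R> \<Longrightarrow> \<exists>B\<subseteq>A. card B \<le> w \<and> (\<forall>a\<in>A. \<exists>b\<in>B. game_le a b)"
    and min: "\<And>A. A \<subseteq> \<R> \<Longrightarrow> \<exists>B\<subseteq>A. card B \<le> w \<and> (\<forall>a\<in>A. \<exists>b\<in>B. game_le b a)"
  shows "min_verts X \<le> n + 2 * w + 4 * k + 12"
proof -
  obtain V :: "nat set" and E \<phi> S where V: "finite V" "card V \<le> n"
    and S: "\<forall>H\<in>born_by k. S H \<subseteq> V \<and> rel_game E \<phi> (S H) \<approx> H"
    using U unfolding universal_def by (elim exE conjE) (rule that)
  have finR: "finite \<R>" using R by (simp add: representatives_def)
  obtain A B where AB: "A \<subseteq> \<R>" "B \<subseteq> \<R>" "card A \<le> w" "card B \<le> w" "X \<approx> Game (Abs_fset A) (Abs_fset B)"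
    by (rule options_in_representatives[OF R X max min])
  let ?X = "Game (Abs_fset A) (Abs_fset B)"
  have fin: "finite A" "finite B" using AB finR finite_subset by blast+
  have opts: "fset (left_opts ?X) = A" "fset (right_opts ?X) = B"
    using fin by (simp_all add: Abs_fset_inverse)
  have S_opt: "S H \<subseteq> V \<and> rel_game E \<phi> (S H) \<approx> H" if "H \<in> A \<or> H \<in> B" for H
    using that AB R S by (auto simp: representatives_def)
  have X': "?X \<in> born_by (Suc k)"
    using opts AB R by (auto simp: born_by_Suc_iff representatives_def)
  let ?T = "Old ` V \<union> Opt Blue ` A \<union> Opt Red ` B \<union> gadget (Suc k)"
  have "rel_game (vertex_rel E \<phi> S) (vertex_colour \<phi>) ?T \<approx> ?X"
    using rel_game_extension[OF V(1) X', of S E \<phi>] S_opt unfolding opts by blast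
  then have "rel_game (vertex_rel E \<phi> S) (vertex_colour \<phi>) ?T \<approx> X"
    by (rule equal_val_trans[OF _ equal_val_sym[OF AB(5)]])
  then have "min_verts X \<le> card ?T"
    by (rule min_verts_le_rel_game(2)[rotated]) (use V fin in auto)
  also have "\<dots> \<le> n + w + w + (4 * Suc k + 8)"
    using card_extension[OF V(1) fin, of "Suc k"] V(2) AB(3,4) by linarith
  finally show ?thesis by simp
qed

lemma F_le_iff: "F k \<le> n \<longleftrightarrow> (\<forall>X\<in>born_by k. min_verts X \<le> n)"
  unfolding F_def using finite_born_by born_by_nonempty by (subst Max_le_iff) auto

section \<open>Counting the values of digraphs with few vertices\<close>

lemma representatives_born_by: "representatives k (born_by k)"
  unfolding representatives_def using finite_born_by equal_val_refl by blast

text \<open>Only existence matters here, so the finite set \<open>born_by k\<close> itself serves as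
  its own set of representatives.\<close>

lemma ex_universal: "\<exists>n. universal k n"
  by (induction k) (use universal_0 universal_Suc representatives_born_by in blast)+

text \<open>Makes the \<open>LEAST\<close> in \<open>min_verts\<close> attained, as needed to
  extract an actual digraph from a bound on \<open>F\<close>.\<close>

lemma ex_representable:
  assumes "X \<in> born_by k"
  shows "representable_on X (min_verts X)"
proof -
  obtain n V E \<phi> S where "finite (V :: nat set)" "S X \<subseteq> V" "rel_game E \<phi> (S X) \<approx> X"
    using ex_universal[of k] assms unfolding universal_def by blast
  then have "representable_on X (card (S X))"
    by (intro min_verts_le_rel_game(1)) (auto intro: finite_subset)
  then show ?thesis unfolding min_verts_def by (rule LeastI)
qed

text \<open>Numbering the blue vertices first, the colouring is described by a single number.\<close>

lemma representable_on_standard: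
  assumes "representable_on X m"
  shows "\<exists>b\<le>m. \<exists>E\<subseteq>{(i, j). i < m \<and> j < m \<and> i \<noteq> j}.
           rel_game E (\<lambda>i. if i < b then Blue else Red) {..<m} \<approx> X"
proof -
  obtain G :: "(nat, nat \<times> nat) pre_digraph" and \<phi> where
    G: "digraph G" "card (verts G) = m" "placement_game G \<phi> \<approx> X"
    using assms unfolding representable_on_def game_eq_iff by blast
  interpret digraph G by (rule G(1))
  define Bl where "Bl = {u \<in> verts G. \<phi> u = Blue}"
  define Rd where "Rd = {u \<in> verts G. \<phi> u = Red}"
  define b where "b = card Bl"
  have verts: "verts G = Bl \<union> Rd" "Bl \<inter> Rd = {}" "finite Bl" "finite Rd"
    by (auto simp: Bl_def Rd_def intro: colour.exhaust[of "\<phi> _"])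
  then have m: "b + card Rd = m" using G(2) by (simp add: b_def card_Un_disjoint)
  have "\<exists>f1. bij_betw f1 Bl {..<b}"
    by (rule finite_same_card_bij) (use verts(3) in \<open>simp_all add: b_def\<close>)
  then obtain f1 where f1: "bij_betw f1 Bl {..<b}" ..
  have "\<exists>f2. bij_betw f2 Rd {b..<m}"
    by (rule finite_same_card_bij) (use verts(4) m in simp_all)
  then obtain f2 where f2: "bij_betw f2 Rd {b..<m}" ..
  define f where "f u = (if \<phi> u = Blue then f1 u else f2 u)" for u
  have "bij_betw f Bl {..<b}" using f1 by (subst bij_betw_cong[of _ _ f1]) (auto simp: f_def Bl_def)
  moreover have "bij_betw f Rd {b..<m}" using f2 by (subst bij_betw_cong[of _ _ f2]) (auto simp: f_def Rd_def)
  ultimately have f: "bij_betw f (verts G) {..<m}" and fb: "\<And>u. u \<in> verts G \<Longrightarrow> f u < b \<longleftrightarrow> \<phi> u = Blue"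
  proof -
    assume *: "bij_betw f Bl {..<b}" "bij_betw f Rd {b..<m}"
    have "bij_betw f (Bl \<union> Rd) ({..<b} \<union> {b..<m})" by (rule bij_betw_combine) (use * in auto)
    moreover have "{..<b} \<union> {b..<m} = {..<m}" using m by auto
    ultimately show "bij_betw f (verts G) {..<m}" using verts by simp
    show "f u < b \<longleftrightarrow> \<phi> u = Blue" if "u \<in> verts G" for u
    proof (cases "\<phi> u = Blue")
      case True
      with that have "u \<in> Bl" by (simp add: Bl_def)
      then show ?thesis using True bij_betwE[OF *(1)] by auto
    next
      case False
      with that have "u \<in> Rd" unfolding Rd_def by (cases "\<phi> u") auto
      then show ?thesis using False bij_betwE[OF *(2)] by auto
    qed
  qed
  define E where "E = {(f u, f v) | u v. u \<in> verts G \<and> v \<in> verts G \<and> u \<noteq> v \<and> u \<rightarrow>\<^bsub>G\<^esub> v}"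
  have inj: "inj_on f (verts G)" and img: "f ` verts G = {..<m}"
    using f by (auto simp: bij_betw_def)
  have "placement_game (rel_digraph E {..<m}) (\<lambda>i. if i < b then Blue else Red) = placement_game G \<phi>"
  proof (rule placement_game_iso)
    show "finite (verts G)" "inj_on f (verts G)" "verts (rel_digraph E {..<m}) = f ` verts G"
      using inj img by simp_all
    show "f u \<rightarrow>\<^bsub>rel_digraph E {..<m}\<^esub> f v \<longleftrightarrow> u \<rightarrow>\<^bsub>G\<^esub> v"
      if "u \<in> verts G" "v \<in> verts G" "u \<noteq> v" for u v
      using that inj unfolding dominates_rel_digraph img[symmetric] by (auto simp: E_def inj_on_eq_iff)
    show "(if f u < b then Blue else Red) = \<phi> u" if "u \<in> verts G" for u
      using fb[OF that] by (cases "\<phi> u") auto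
  qed
  moreover have "E \<subseteq> {(i, j). i < m \<and> j < m \<and> i \<noteq> j}"
  proof -
    have "f u < m" if "u \<in> verts G" for u using img that by auto
    then show ?thesis using inj by (auto simp: E_def inj_on_eq_iff)
  qed
  moreover have "b \<le> m" using m by simp
  ultimately show ?thesis
    using G(3) by (intro exI[of _ b] exI[of _ E] conjI) simp_all
qed

lemma card_off_diagonal: "card {(i, j). i < n \<and> j < n \<and> i \<noteq> j} = n * (n - 1)"
proof -
  have "{(i, j). i < n \<and> j < n \<and> i \<noteq> j} = (SIGMA i:{..<n}. {..<n} - {i})" by auto
  then show ?thesis by simp
qed

lemma card_values_le:
  assumes F: "F k \<le> n" and sub: "\<G> \<subseteq> born_by k"
    and distinct: "\<And>X Y. X \<in> \<G> \<Longrightarrow> Y \<in> \<G> \<Longrightarrow> X \<approx> Y \<Longrightarrow> X = Y"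
  shows "card \<G> \<le> (n + 1) ^ 2 * 2 ^ (n * (n - 1))"
proof -
  define val where "val = (\<lambda>(m, b, E). rel_game E (\<lambda>i :: nat. if i < b then Blue else Red) {..<m :: nat})"
  \<comment> \<open>A triple consists of the number of vertices, the number of blue ones and the
    arcs. The arcs are drawn from the largest vertex set, so that all sizes share one set of
    codes.\<close>
  define Codes where "Codes = {..n} \<times> {..n} \<times> Pow {(i, j). i < n \<and> j < n \<and> i \<noteq> j}"
  have fin: "finite {(i, j). i < n \<and> j < n \<and> i \<noteq> (j :: nat)}"
    by (rule finite_subset[of _ "{..<n} \<times> {..<n}"]) auto
  have "\<exists>c\<in>Codes. val c \<approx> X" if X: "X \<in> \<G>" for X
  proof -
    have "representable_on X (min_verts X)" using ex_representable X sub by blast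
    from representable_on_standard[OF this] obtain b E where
      bE: "b \<le> min_verts X" "E \<subseteq> {(i, j). i < min_verts X \<and> j < min_verts X \<and> i \<noteq> j}"
        "rel_game E (\<lambda>i. if i < b then Blue else Red) {..<min_verts X} \<approx> X" by blast
    have "min_verts X \<le> n" using F X sub by (auto simp: F_le_iff)
    with bE show ?thesis
      by (intro bexI[of _ "(min_verts X, b, E)"]) (fastforce simp: val_def Codes_def)+
  qed
  then obtain c where c: "\<And>X. X \<in> \<G> \<Longrightarrow> c X \<in> Codes \<and> val (c X) \<approx> X" by metis
  have "inj_on c \<G>"
  proof (rule inj_onI)
    fix X Y assume XY: "X \<in> \<G>" "Y \<in> \<G>" "c X = c Y"
    have "val (c X) \<approx> X" "val (c X) \<approx> Y" using c[of X] c[of Y] XY by auto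
    then show "X = Y" using distinct[OF XY(1,2)] equal_val_trans[OF equal_val_sym] by blast
  qed
  moreover have "c ` \<G> \<subseteq> Codes" using c by blast
  moreover have "finite Codes" using fin by (simp add: Codes_def)
  ultimately have "card \<G> \<le> card Codes" by (rule card_inj_on_le)
  also have "\<dots> = (n + 1) ^ 2 * 2 ^ (n * (n - 1))"
    using fin by (simp add: Codes_def card_cartesian_product card_Pow card_off_diagonal power2_eq_square algebra_simps)
  finally show ?thesis .
qed

section \<open>Boolean lattices of games\<close>

text \<open>A set \<open>S\<close> is read off from \<open>f S\<close>: an element of
  \<open>A\<close> lies below \<open>f S\<close> exactly if it is in \<open>S\<close>, and an
  element of \<open>B\<close> lies above \<open>f S\<close> exactly if it is not in
  \<open>S\<close>.\<close>

lemma boolean_lattice: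
  assumes sub: "A \<union> B \<subseteq> born_by k"
    and A: "\<And>a a'. a \<in> A \<Longrightarrow> a' \<in> A \<Longrightarrow> game_le a a' \<Longrightarrow> a = a'"
    and B: "\<And>b b'. b \<in> B \<Longrightarrow> b' \<in> B \<Longrightarrow> game_le b b' \<Longrightarrow> b = b'"
    and AB: "\<And>a b. a \<in> A \<Longrightarrow> b \<in> B \<Longrightarrow> game_le a b"
  obtains f where "\<And>S. f S \<in> born_by (Suc k)"
    "\<And>S T. S \<subseteq> A \<union> B \<Longrightarrow> T \<subseteq> A \<union> B \<Longrightarrow> game_le (f S) (f T) \<longleftrightarrow> S \<subseteq> T"
proof -
  define D where "D S = {H \<in> born_by k. \<exists>a\<in>A \<inter> S. game_le H a}" for S
  \<comment> \<open>The complement is taken because a larger game has fewer upper bounds. Membership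
    of an element of \<open>A\<close> or \<open>B\<close> can be recovered since each generator is
    comparable only to itself within its antichain.\<close>
  define U where "U S = {H \<in> born_by k. \<exists>b\<in>B - S. game_le b H}" for S
  have "\<exists>X\<in>born_by (Suc k). \<forall>H\<in>born_by k. (game_le H X \<longleftrightarrow> H \<in> D S) \<and> (game_le X H \<longleftrightarrow> H \<in> U S)" for S
  proof (rule born_by_realise[of k "D S" "U S"])
    show "H \<in> D S" if "H \<in> born_by k" "K \<in> D S" "game_le H K" for H K
      using that game_le_trans unfolding D_def by blast
    show "H \<in> U S" if "H \<in> born_by k" "K \<in> U S" "game_le K H" for H K
      using that game_le_trans unfolding U_def by blast
    show "game_le H K" if HK: "H \<in> D S" "K \<in> U S" for H K
    proof -
      from HK obtain a b where ab: "a \<in> A" "b \<in> B" "game_le H a" "game_le b K" by (auto simp: D_def U_def)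
      from game_le_trans[OF ab(3) AB[OF ab(1,2)]] ab(4) show ?thesis by (rule game_le_trans)
    qed
  next
    fix X assume "X \<in> born_by (Suc k)" "\<And>H. H \<in> born_by k \<Longrightarrow> game_le H X \<longleftrightarrow> H \<in> D S"
      "\<And>H. H \<in> born_by k \<Longrightarrow> game_le X H \<longleftrightarrow> H \<in> U S"
    then show ?thesis by blast
  qed (auto simp: D_def U_def)
  then obtain f where f: "\<And>S. f S \<in> born_by (Suc k)"
    "\<And>S H. H \<in> born_by k \<Longrightarrow> game_le H (f S) \<longleftrightarrow> H \<in> D S"
    "\<And>S H. H \<in> born_by k \<Longrightarrow> game_le (f S) H \<longleftrightarrow> H \<in> U S"
    by metis
  show ?thesis
  proof (rule that[of f, OF f(1)])
    fix S T assume ST: "S \<subseteq> A \<union> B" "T \<subseteq> A \<union> B"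
    show "game_le (f S) (f T) \<longleftrightarrow> S \<subseteq> T"
    proof
      assume le: "game_le (f S) (f T)"
      show "S \<subseteq> T"
      proof
        fix x assume x: "x \<in> S"
        have born: "x \<in> born_by k" using x ST sub by blast
        show "x \<in> T"
        proof (cases "x \<in> A")
          case True
          then have "game_le x (f S)" using x born game_le_refl unfolding f(2)[OF born] D_def by blast
          then have "game_le x (f T)" using le by (rule game_le_trans)
          then obtain a where "a \<in> A \<inter> T" "game_le x a" using born by (auto simp: f(2) D_def)
          then show ?thesis using A[OF True] by auto
        next
          case False
          then have xB: "x \<in> B" using x ST by blast
          show ?thesis
          proof (rule ccontr)
            assume "x \<notin> T"
            then have "game_le (f T) x" using xB born game_le_refl unfolding f(3)[OF born] U_def by blast
            with le have "game_le (f S) x" by (rule game_le_trans)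
            then obtain b where "b \<in> B - S" "game_le b x" using born by (auto simp: f(3) U_def)
            then show False using B[of b x] xB x by auto
          qed
        qed
      qed
    next
      assume "S \<subseteq> T"
      then show "game_le (f S) (f T)"
        unfolding born_by_le_iff[OF f(1) f(1)] by (auto simp: f(2,3) D_def U_def)
    qed
  qed
qed

lemma le_F_of_boolean_lattice:
  assumes f: "\<And>S. f S \<in> born_by k" "\<And>S T. S \<subseteq> C \<Longrightarrow> T \<subseteq> C \<Longrightarrow> game_le (f S) (f T) \<longleftrightarrow> S \<subseteq> T"
    and C: "finite C" and n: "(n + 1) ^ 2 * 2 ^ (n * (n - 1)) < (2 :: nat) ^ card C"
  shows "n < F k"
proof (rule ccontr)
  assume "\<not> n < F k"
  then have "card (f ` Pow C) \<le> (n + 1) ^ 2 * 2 ^ (n * (n - 1))"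
    by (intro card_values_le[of k]) (use f in \<open>auto simp: equal_val_def\<close>)
  moreover have "inj_on f (Pow C)"
    by (rule inj_onI) (use f(2) game_le_refl in \<open>metis PowD subset_antisym\<close>)
  ultimately show False using n C by (simp add: card_image card_Pow)
qed

text \<open>One level of the lattice: distinct sets of equal finite size are never nested.\<close>

lemma antichain_of_boolean_lattice:
  assumes f: "\<And>S. f S \<in> born_by k" "\<And>S T. S \<subseteq> C \<Longrightarrow> T \<subseteq> C \<Longrightarrow> game_le (f S) (f T) \<longleftrightarrow> S \<subseteq> T"
    and C: "finite C"
  obtains A where "A \<subseteq> born_by k" "card A = card C choose h"
    "\<And>a a'. a \<in> A \<Longrightarrow> a' \<in> A \<Longrightarrow> game_le a a' \<Longrightarrow> a = a'"
proof
  let ?P = "{S. S \<subseteq> C \<and> card S = h}"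
  show "f ` ?P \<subseteq> born_by k" using f(1) by blast
  have "inj_on f ?P"
    by (rule inj_onI) (use f(2) game_le_refl in \<open>metis (lifting) mem_Collect_eq subset_antisym\<close>)
  then show "card (f ` ?P) = card C choose h" using n_subsets[OF C] by (simp add: card_image)
  fix a a' assume "a \<in> f ` ?P" "a' \<in> f ` ?P" "game_le a a'"
  then obtain S T where ST: "S \<subseteq> C" "T \<subseteq> C" "card S = card T" "a = f S" "a' = f T" "S \<subseteq> T"
    using f(2) by auto
  then have "S = T" using card_subset_eq[of T S] finite_subset[OF _ C] by auto
  with ST show "a = a'" by simp
qed

section \<open>Codes for the games born by a given day\<close>

text \<open>Write \<open>P\<^sub>k\<close> for the poset of values born by day \<open>k\<close>. A value \<open>X\<close> born by day
  \<open>k + 1\<close> is determined by the down-sets \<open>{H \<in> P\<^sub>k. H \<le> X}\<close> and \<open>{H \<in> P\<^sub>k. \<not> X \<le> H}\<close>, and a pair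
  of down-sets \<open>D\<close>, \<open>N\<close> arises in this way if and only if every element of \<open>D\<close> lies below every element
  outside \<open>N\<close>. The pair is coded by the list of truth values of membership in \<open>D\<close> and then in \<open>N\<close>.
  So the codes are the down-sets of a poset with \<open>2 |P\<^sub>k|\<close> elements, given by the list of its rows:
  the row of an element says which of the later elements lie below it.\<close>

fun imp :: "bool list \<Rightarrow> bool list \<Rightarrow> bool" where
  "imp (True # p) (False # q) = False"
| "imp (True # p) (True # q) = imp p q"
| "imp (False # p) (b # q) = imp p q"
| "imp p q = True"

text \<open>The rows arrive from the last element to the first, so \<open>p\<close> already decides
  every element that the row \<open>r\<close> speaks about; \<open>True\<close> may be prepended
  only if all elements marked by \<open>r\<close> have been taken.\<close>

fun extensions :: "bool list list \<Rightarrow> bool list \<Rightarrow> bool list list" where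
  "extensions [] p = [p]"
| "extensions (r # rs) p =
     (if imp r p then extensions rs (True # p) @ extensions rs (False # p) else extensions rs (False # p))"

fun rows :: "bool list list \<Rightarrow> bool list list" where
  "rows [] = []"
| "rows (p # ps) = map (\<lambda>q. imp q p) ps # rows ps"

text \<open>These are the rows of the elements in their role as members of \<open>D\<close>. The
  second block records that \<open>p\<close> in \<open>D\<close> forces \<open>q\<close> into
  \<open>N\<close> unless \<open>p\<close> lies below \<open>q\<close>, since everything outside
  \<open>N\<close> must be above \<open>D\<close>.\<close>

fun upper_rows :: "bool list list \<Rightarrow> bool list list \<Rightarrow> bool list list" where
  "upper_rows qs [] = []"
| "upper_rows qs (p # ps) = (map (\<lambda>q. imp q p) ps @ map (\<lambda>q. \<not> imp p q) qs) # upper_rows qs ps"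

definition pair_rows :: "bool list list \<Rightarrow> bool list list" where
  "pair_rows ps = upper_rows ps ps @ rows ps"

primrec codes :: "nat \<Rightarrow> bool list list" where
  "codes 0 = [[]]"
| "codes (Suc k) = extensions (rev (pair_rows (codes k))) []"

fun down_closed :: "bool list list \<Rightarrow> bool list \<Rightarrow> bool" where
  "down_closed (r # rs) (b # p) = ((b \<longrightarrow> imp r p) \<and> down_closed rs p)"
| "down_closed [] p = True"
| "down_closed (r # rs) [] = False"

section \<open>Correctness of the enumeration of codes\<close>

lemma imp_append:
  "length p = length p' \<Longrightarrow> imp (p @ q) (p' @ q') \<longleftrightarrow> imp p p' \<and> imp q q'"
proof (induction p p' rule: list_induct2)
  case (Cons b p b' p')
  then show ?case by (cases b; cases b') auto
qed simp

lemma imp_map: "imp (map f xs) (map g xs) \<longleftrightarrow> (\<forall>x\<in>set xs. f x \<longrightarrow> g x)"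
proof (induction xs)
  case (Cons x xs)
  then show ?case by (cases "f x"; cases "g x") auto
qed simp

lemma down_closed_append:
  "length rs = length p \<Longrightarrow> down_closed (rs @ ss) (p @ q) \<longleftrightarrow> down_closed rs (p @ q) \<and> down_closed ss q"
  by (induction rs p rule: list_induct2) auto

lemma set_extensions:
  "set (extensions (rev rs) p) = {q @ p | q. length q = length rs \<and> down_closed rs (q @ p)}"
proof (induction rs arbitrary: p rule: rev_induct)
  case Nil
  then show ?case by simp
next
  case (snoc r rs)
  have *: "{q @ p | q. length q = Suc (length rs) \<and> Q q} =
      {q @ b # p | q b. length q = length rs \<and> Q (q @ [b])}" for Q
  proof (intro equalityI subsetI)
    fix x assume "x \<in> {q @ p | q. length q = Suc (length rs) \<and> Q q}"
    then obtain q where q: "x = q @ p" "length q = Suc (length rs)" "Q q" by blast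
    then obtain q' b where "q = q' @ [b]" by (metis length_Suc_conv_rev)
    with q show "x \<in> {q @ b # p | q b. length q = length rs \<and> Q (q @ [b])}" by auto
  next
    fix x assume "x \<in> {q @ b # p | q b. length q = length rs \<and> Q (q @ [b])}"
    then obtain q b where "x = (q @ [b]) @ p" "length (q @ [b]) = Suc (length rs)" "Q (q @ [b])" by auto
    then show "x \<in> {q @ p | q. length q = Suc (length rs) \<and> Q q}" by blast
  qed
  have dc: "down_closed (rs @ [r]) (q @ b # p) \<longleftrightarrow> down_closed rs (q @ b # p) \<and> (b \<longrightarrow> imp r p)"
    if "length q = length rs" for q b
    using that by (subst down_closed_append) auto
  have "{q @ p | q. length q = length (rs @ [r]) \<and> down_closed (rs @ [r]) (q @ p)} =
      {q @ b # p | q b. length q = length rs \<and> down_closed rs (q @ b # p) \<and> (b \<longrightarrow> imp r p)}"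
    using dc by (auto simp: *)
  also have "\<dots> = set (extensions (rev (rs @ [r])) p)"
    by (auto simp: snoc.IH) (metis (full_types))+
  finally show ?case by simp
qed

text \<open>Codes with \<open>True\<close> at the branching place are listed before those with
  \<open>False\<close> there, and the former never imply the latter. So whatever lies below a code
  comes after it, which is why a row of the next day need only look at later elements.\<close>

lemma sorted_extensions: "sorted_wrt (\<lambda>p q. \<not> imp p q) (extensions rs p)"
proof (induction rs arbitrary: p)
  case (Cons r rs)
  have "\<not> imp (q @ True # p) (q' @ False # p)" if "length q = length q'" for q q'
    using that by (subst imp_append) auto
  moreover have "\<exists>q. x = q @ b # p \<and> length q = length rs" if "x \<in> set (extensions rs (b # p))" for x b
    using that set_extensions[of "rev rs" "b # p"] by auto
  ultimately have "\<not> imp x y" if "x \<in> set (extensions rs (True # p))" "y \<in> set (extensions rs (False # p))" for x y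
    using that by metis
  then show ?case using Cons.IH by (auto simp: sorted_wrt_append)
qed simp

lemma sorted_codes: "sorted_wrt (\<lambda>p q. \<not> imp p q) (codes k)"
  by (cases k) (simp_all add: sorted_extensions)

lemma imp_refl [simp]: "imp p p"
proof (induction p)
  case (Cons b p)
  then show ?case by (cases b) auto
qed simp

lemma distinct_codes: "distinct (codes k)"
proof -
  have "sorted_wrt (\<lambda>p q. \<not> imp p q) ps \<Longrightarrow> distinct ps" for ps
    by (induction ps) auto
  then show ?thesis using sorted_codes by blast
qed

lemma sorted_wrt_imp_iff:
  assumes "sorted_wrt (\<lambda>p q. \<not> imp p q) ps"
  shows "sorted_wrt (\<lambda>p q. imp q p \<longrightarrow> f p \<longrightarrow> f q) ps \<longleftrightarrow>
           (\<forall>p\<in>set ps. \<forall>q\<in>set ps. imp q p \<longrightarrow> f p \<longrightarrow> f q)"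
  using assms by (induction ps) auto

lemma down_closed_rows:
  "down_closed (rows ps) (map g ps) \<longleftrightarrow> sorted_wrt (\<lambda>p q. imp q p \<longrightarrow> g p \<longrightarrow> g q) ps"
  by (induction ps) (auto simp: imp_map)

lemma down_closed_upper_rows:
  "down_closed (upper_rows qs ps @ rs) (map f ps @ map g qs) \<longleftrightarrow>
     sorted_wrt (\<lambda>p q. imp q p \<longrightarrow> f p \<longrightarrow> f q) ps \<and>
     (\<forall>p\<in>set ps. \<forall>q\<in>set qs. f p \<longrightarrow> \<not> imp p q \<longrightarrow> g q) \<and> down_closed rs (map g qs)"
  by (induction ps) (auto simp: imp_map imp_append)

lemma length_pair_rows: "length (pair_rows ps) = 2 * length ps"
proof -
  have "length (upper_rows qs ps) = length ps" "length (rows ps) = length ps" for qs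
    by (induction ps) auto
  then show ?thesis by (simp add: pair_rows_def)
qed

lemma codes_Suc_iff:
  "map f (codes k) @ map g (codes k) \<in> set (codes (Suc k)) \<longleftrightarrow>
     (\<forall>p\<in>set (codes k). \<forall>q\<in>set (codes k).
        (imp q p \<longrightarrow> f p \<longrightarrow> f q) \<and> (imp q p \<longrightarrow> g p \<longrightarrow> g q) \<and> (f p \<longrightarrow> \<not> imp p q \<longrightarrow> g q))"
proof -
  have "map f (codes k) @ map g (codes k) \<in> set (codes (Suc k)) \<longleftrightarrow>
      down_closed (pair_rows (codes k)) (map f (codes k) @ map g (codes k))"
    by (simp add: set_extensions length_pair_rows)
  then show ?thesis
    unfolding pair_rows_def down_closed_upper_rows down_closed_rows sorted_wrt_imp_iff[OF sorted_codes]
    by blast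
qed

text \<open>The codes of day \<open>k\<close> are distinct, so each half of \<open>c\<close> is the
  value list of some function on them.\<close>

lemma codes_Suc_form:
  assumes "c \<in> set (codes (Suc k))"
  obtains f g where "c = map f (codes k) @ map g (codes k)"
proof -
  let ?n = "length (codes k)"
  have len: "length c = 2 * ?n"
    using assms by (auto simp: set_extensions length_pair_rows)
  have *: "\<exists>f. p = map f (codes k)" if "length p = ?n" for p :: "bool list"
  proof -
    have "map (the \<circ> map_of (zip (codes k) p)) (codes k) = p"
      using that distinct_codes[of k] by (intro nth_equalityI) (auto simp: map_of_zip_nth)
    then show ?thesis by metis
  qed
  from len have "length (take ?n c) = ?n" "length (drop ?n c) = ?n" by auto
  then show ?thesis using * append_take_drop_id[of ?n c] that by metis
qed

section \<open>The codes as representatives of all values\<close>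

definition coded :: "nat \<Rightarrow> (bool list \<Rightarrow> game) \<Rightarrow> bool" where
  "coded k rep \<longleftrightarrow>
     (\<forall>p\<in>set (codes k). rep p \<in> born_by k) \<and>
     (\<forall>p\<in>set (codes k). \<forall>q\<in>set (codes k). game_le (rep p) (rep q) \<longleftrightarrow> imp p q) \<and>
     (\<forall>X\<in>born_by k. \<exists>p\<in>set (codes k). X \<approx> rep p)"

lemma coded_0: "coded 0 (\<lambda>_. Game {||} {||})"
  by (simp add: coded_def born_by_0_iff)

lemma coded_Suc:
  assumes "coded k rep"
  obtains rep' where "coded (Suc k) rep'"
proof -
  let ?ps = "codes k"
  note rep_born = assms[unfolded coded_def, THEN conjunct1, rule_format]
  note rep_le = assms[unfolded coded_def, THEN conjunct2, THEN conjunct1, rule_format]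
  note rep_cover = assms[unfolded coded_def, THEN conjunct2, THEN conjunct2, rule_format]
  define code where
    "code X = map (\<lambda>p. game_le (rep p) X) ?ps @ map (\<lambda>p. \<not> game_le X (rep p)) ?ps" for X
  have code_in: "code X \<in> set (codes (Suc k))" for X
    unfolding code_def codes_Suc_iff using rep_le game_le_trans by blast
  have code_le: "game_le X Y \<longleftrightarrow> imp (code X) (code Y)" if XY: "X \<in> born_by (Suc k)" "Y \<in> born_by (Suc k)" for X Y
  proof -
    have "imp (code X) (code Y) \<longleftrightarrow> (\<forall>p\<in>set ?ps. (game_le (rep p) X \<longrightarrow> game_le (rep p) Y) \<and>
        (game_le Y (rep p) \<longrightarrow> game_le X (rep p)))"
      unfolding code_def by (subst imp_append) (auto simp: imp_map)
    also have "\<dots> \<longleftrightarrow> game_le X Y"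
      unfolding born_by_le_iff[OF XY]
    proof (intro iffI ballI conjI impI)
      fix H assume *: "\<forall>p\<in>set ?ps. (game_le (rep p) X \<longrightarrow> game_le (rep p) Y) \<and>
        (game_le Y (rep p) \<longrightarrow> game_le X (rep p))" and H: "H \<in> born_by k"
      obtain p where p: "p \<in> set ?ps" "game_le H (rep p)" "game_le (rep p) H"
        using rep_cover[OF H] by (auto simp: equal_val_def)
      show "game_le H Y" if "game_le H X"
        using * p(1) game_le_trans[OF p(3) that] game_le_trans[OF p(2)] by blast
      show "game_le X H" if "game_le Y H"
        using * p(1) game_le_trans[OF that p(2)] game_le_trans[OF _ p(3)] by blast
    qed (use rep_born in blast)+
    finally show ?thesis by blast
  qed
  have "\<exists>X\<in>born_by (Suc k). code X = c" if c: "c \<in> set (codes (Suc k))" for c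
  proof -
    obtain f g where fg: "c = map f ?ps @ map g ?ps" using codes_Suc_form[OF c] .
    have f: "f q" if "p \<in> set ?ps" "q \<in> set ?ps" "imp q p" "f p" for p q
      using c that unfolding fg codes_Suc_iff by blast
    have g: "g q" if "p \<in> set ?ps" "q \<in> set ?ps" "imp q p" "g p" for p q
      using c that unfolding fg codes_Suc_iff by blast
    have fg': "imp p q" if "p \<in> set ?ps" "q \<in> set ?ps" "f p" "\<not> g q" for p q
      using c that unfolding fg codes_Suc_iff by blast
    \<comment> \<open>The sets given by the code are closed up among all games born by day
      \<open>k\<close>, not just among the chosen representatives, because
      \<open>born_by_realise\<close> works with closed sets of games.\<close>
    define D where "D = {H \<in> born_by k. \<exists>p\<in>set ?ps. f p \<and> game_le H (rep p)}"
    define U where "U = {H \<in> born_by k. \<exists>p\<in>set ?ps. \<not> g p \<and> game_le (rep p) H}"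
    show ?thesis
    proof (rule born_by_realise[of k D U])
      show "H \<in> D" if "H \<in> born_by k" "K \<in> D" "game_le H K" for H K
        using that game_le_trans unfolding D_def by blast
      show "H \<in> U" if "H \<in> born_by k" "K \<in> U" "game_le K H" for H K
        using that game_le_trans unfolding U_def by blast
      show "game_le H K" if HK: "H \<in> D" "K \<in> U" for H K
      proof -
        from HK obtain p q where pq: "p \<in> set ?ps" "q \<in> set ?ps" "f p" "\<not> g q"
          "game_le H (rep p)" "game_le (rep q) K" by (auto simp: D_def U_def)
        then have "game_le (rep p) (rep q)" using rep_le fg' by blast
        from game_le_trans[OF pq(5) this] pq(6) show ?thesis by (rule game_le_trans)
      qed
    next
      fix X assume X: "X \<in> born_by (Suc k)"
        and XD: "\<And>H. H \<in> born_by k \<Longrightarrow> game_le H X \<longleftrightarrow> H \<in> D"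
        and XU: "\<And>H. H \<in> born_by k \<Longrightarrow> game_le X H \<longleftrightarrow> H \<in> U"
      have "game_le (rep p) X \<longleftrightarrow> f p" "game_le X (rep p) \<longleftrightarrow> \<not> g p" if p: "p \<in> set ?ps" for p
        unfolding XD[OF rep_born[OF p]] XU[OF rep_born[OF p]] D_def U_def
        using p f[OF _ p] g[OF p] rep_le[OF p] rep_le[OF _ p] rep_born imp_refl by blast+
      then have "code X = c" unfolding code_def fg by simp
      with X show ?thesis by blast
    qed (auto simp: D_def U_def)
  qed
  then obtain rep' where rep': "\<And>c. c \<in> set (codes (Suc k)) \<Longrightarrow> rep' c \<in> born_by (Suc k) \<and> code (rep' c) = c"
    by metis
  have "coded (Suc k) rep'"
    unfolding coded_def
  proof (intro conjI ballI)
    show "rep' p \<in> born_by (Suc k)" if "p \<in> set (codes (Suc k))" for p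
      using rep'[OF that] by blast
    show "game_le (rep' p) (rep' q) \<longleftrightarrow> imp p q" if "p \<in> set (codes (Suc k))" "q \<in> set (codes (Suc k))" for p q
      using rep'[OF that(1)] rep'[OF that(2)] code_le[of "rep' p" "rep' q"] by simp
    show "\<exists>p\<in>set (codes (Suc k)). X \<approx> rep' p" if X: "X \<in> born_by (Suc k)" for X
      using rep'[OF code_in[of X]] code_in[of X] code_le[OF X] code_le[OF _ X] unfolding equal_val_def
      by (metis imp_refl)
  qed
  then show ?thesis by (rule that)
qed

lemma ex_coded: "\<exists>rep. coded k rep"
  by (induction k) (use coded_0 coded_Suc in blast)+

lemma coded_representatives:
  assumes "coded k rep"
  shows "representatives k (rep ` set (codes k))"
  using assms unfolding coded_def representatives_def by blast

section \<open>Chain decompositions\<close>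

lemma card_pairs_le: "card {(a, b). a + b \<le> n} = (n + 1) * (n + 2) div 2" and
  finite_pairs_le: "finite {(a, b). a + b \<le> (n :: nat)}"
proof -
  have eq: "{(a, b). a + b \<le> n} = (SIGMA a:{..n}. {..n - a})" by auto
  have "card {(a, b). a + b \<le> n} = (\<Sum>a\<le>n. n - a + 1)" unfolding eq by simp
  also have "\<dots> = (\<Sum>a\<le>n. a + 1)"
    by (rule sum.reindex_bij_witness[where i = "\<lambda>a. n - a" and j = "\<lambda>a. n - a"]) auto
  also have "\<dots> = (n + 1) * (n + 2) div 2"
    by (induction n) (auto simp: algebra_simps)
  finally show "card {(a, b). a + b \<le> n} = (n + 1) * (n + 2) div 2" .
  show "finite {(a, b). a + b \<le> n}" unfolding eq by simp
qed

text \<open>Chains may overlap, and only upper bounds are derived from their sizes. Comparability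
  refers to \<open>game_le\<close>, under which distinct games may be equal in value.\<close>

locale chain_cover =
  fixes k :: nat and P :: "game set" and I :: "'i set" and C :: "'i \<Rightarrow> game set"
  assumes P: "representatives k P"
    and I: "finite I"
    and cover: "P = (\<Union>i\<in>I. C i)"
    and chain: "\<And>i H K. i \<in> I \<Longrightarrow> H \<in> C i \<Longrightarrow> K \<in> C i \<Longrightarrow> game_le H K \<or> game_le K H"
begin

lemma finite_C: "i \<in> I \<Longrightarrow> finite (C i)"
  using P cover by (auto simp: representatives_def intro: finite_subset)

lemma chain_max:
  assumes "finite S" "S \<noteq> {}" "S \<subseteq> C i" "i \<in> I"
  shows "\<exists>m\<in>S. \<forall>a\<in>S. game_le a m" and "\<exists>m\<in>S. \<forall>a\<in>S. game_le m a"
proof -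
  have "(\<exists>m\<in>S. \<forall>a\<in>S. game_le a m) \<and> (\<exists>m\<in>S. \<forall>a\<in>S. game_le m a)"
    using assms(1-3)
  proof (induction S rule: finite_ne_induct)
    case (insert x S)
    then obtain m m' where m: "m \<in> S" "\<forall>a\<in>S. game_le a m" and m': "m' \<in> S" "\<forall>a\<in>S. game_le m' a"
      by blast
    have x: "x \<in> C i" "m \<in> C i" "m' \<in> C i" using m(1) m'(1) insert.prems by auto
    have "\<exists>m\<in>insert x S. \<forall>a\<in>insert x S. game_le a m"
    proof (cases "game_le x m")
      case False
      then have "game_le m x" using chain[OF assms(4) x(1,2)] by blast
      then show ?thesis using m(2) game_le_trans[of _ m x] by (intro bexI[of _ x]) auto
    qed (use m in auto)
    moreover have "\<exists>m\<in>insert x S. \<forall>a\<in>insert x S. game_le m a"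
    proof (cases "game_le m' x")
      case False
      then have "game_le x m'" using chain[OF assms(4) x(1,3)] by blast
      then show ?thesis using m'(2) game_le_trans[of x m'] by (intro bexI[of _ x]) auto
    qed (use m' in auto)
    ultimately show ?case ..
  qed simp
  then show "\<exists>m\<in>S. \<forall>a\<in>S. game_le a m" and "\<exists>m\<in>S. \<forall>a\<in>S. game_le m a" by blast+
qed

text \<open>The greatest element of each chain that meets \<open>A\<close>, taken within
  \<open>A\<close>, is enough to dominate all of \<open>A\<close>; least elements are dual. Hence a
  game of the next day needs at most one option per chain on each side.\<close>

lemma extremal_subsets:
  assumes A: "A \<subseteq> P"
  shows "\<exists>B\<subseteq>A. card B \<le> card I \<and> (\<forall>a\<in>A. \<exists>b\<in>B. game_le a b)"
    and "\<exists>B\<subseteq>A. card B \<le> card I \<and> (\<forall>a\<in>A. \<exists>b\<in>B. game_le b a)"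
proof -
  let ?J = "{i \<in> I. A \<inter> C i \<noteq> {}}"
  have fin: "finite (A \<inter> C i)" if "i \<in> I" for i using finite_C[OF that] by blast
  have card: "card (m ` ?J) \<le> card I" for m :: "'i \<Rightarrow> game"
    using I by (intro order.trans[OF card_image_le] card_mono) auto
  have "\<exists>m. \<forall>i\<in>?J. m i \<in> A \<inter> C i \<and> (\<forall>a\<in>A \<inter> C i. game_le a (m i))"
    using chain_max(1)[OF fin] by (intro bchoice) blast
  then obtain m where m: "\<forall>i\<in>?J. m i \<in> A \<inter> C i \<and> (\<forall>a\<in>A \<inter> C i. game_le a (m i))" ..
  show "\<exists>B\<subseteq>A. card B \<le> card I \<and> (\<forall>a\<in>A. \<exists>b\<in>B. game_le a b)"
    by (intro exI[of _ "m ` ?J"] conjI card) (use m A cover in blast)+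
  have "\<exists>m. \<forall>i\<in>?J. m i \<in> A \<inter> C i \<and> (\<forall>a\<in>A \<inter> C i. game_le (m i) a)"
    using chain_max(2)[OF fin] by (intro bchoice) blast
  then obtain m where m: "\<forall>i\<in>?J. m i \<in> A \<inter> C i \<and> (\<forall>a\<in>A \<inter> C i. game_le (m i) a)" ..
  show "\<exists>B\<subseteq>A. card B \<le> card I \<and> (\<forall>a\<in>A. \<exists>b\<in>B. game_le b a)"
    by (intro exI[of _ "m ` ?J"] conjI card) (use m A cover in blast)+
qed

text \<open>A value \<open>X\<close> born by day \<open>k + 1\<close> but not by day \<open>k\<close> cuts off an initial and a disjoint final
  segment of each chain, and it is determined by the sizes of these segments.\<close>

lemma representatives_Suc:
  "\<exists>\<R>. representatives (Suc k) \<R> \<and> card \<R> \<le> card P + (\<Prod>i\<in>I. (card (C i) + 1) * (card (C i) + 2) div 2)"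
proof -
  define lower where "lower X i = {H \<in> C i. game_le H X}" for X i
  define upper where "upper X i = {H \<in> C i. game_le X H}" for X i
  define g where "g X = (\<lambda>i\<in>I. (card (lower X i), card (upper X i)))" for X
  define T where "T = {X \<in> born_by (Suc k). \<forall>H\<in>P. \<not> X \<approx> H}"
  have finP: "finite P" "P \<subseteq> born_by k" using P by (auto simp: representatives_def)
  have g_in: "g X \<in> (\<Pi>\<^sub>E i\<in>I. {(a, b). a + b \<le> card (C i)})" if X: "X \<in> T" for X
  proof -
    have "card (lower X i) + card (upper X i) \<le> card (C i)" if i: "i \<in> I" for i
    proof -
      have "lower X i \<inter> upper X i = {}"
        using X i cover by (auto simp: T_def lower_def upper_def equal_val_def)
      then have "card (lower X i) + card (upper X i) = card (lower X i \<union> upper X i)"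
        using finite_C[OF i] by (subst card_Un_disjoint) (auto simp: lower_def upper_def)
      also have "\<dots> \<le> card (C i)"
        using finite_C[OF i] by (rule card_mono) (auto simp: lower_def upper_def)
      finally show ?thesis .
    qed
    then show ?thesis by (auto simp: g_def)
  qed
  \<comment> \<open>Two initial segments of one chain are nested, as are two final ones, so equal
    cardinality makes them equal.\<close>
  have segments: "A = B" if "A \<subseteq> B \<or> B \<subseteq> A" "card A = card B" "finite A" "finite B" for A B :: "game set"
    using that card_subset_eq by metis
  have g_le: "game_le X Y" if XY: "X \<in> T" "Y \<in> T" and eq: "g X = g Y" for X Y
  proof -
    have low: "lower X i = lower Y i" and upp: "upper X i = upper Y i" if i: "i \<in> I" for i
    proof -
      have c: "card (lower X i) = card (lower Y i)" "card (upper X i) = card (upper Y i)"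
        using fun_cong[OF eq, of i] i by (auto simp: g_def)
      have fin: "finite (lower X i)" "finite (upper X i)" for X
        using finite_C[OF i] by (auto simp: lower_def upper_def)
      have "lower X i \<subseteq> lower Y i \<or> lower Y i \<subseteq> lower X i"
        using chain[OF i] game_le_trans unfolding lower_def by blast
      then show "lower X i = lower Y i" by (rule segments) (use c fin in auto)
      have "upper X i \<subseteq> upper Y i \<or> upper Y i \<subseteq> upper X i"
        using chain[OF i] game_le_trans unfolding upper_def by blast
      then show "upper X i = upper Y i" by (rule segments) (use c fin in auto)
    qed
    have *: "game_le H X \<longleftrightarrow> game_le H Y" "game_le X H \<longleftrightarrow> game_le Y H" if H: "H \<in> P" for H
    proof -
      obtain i where i: "i \<in> I" "H \<in> C i" using H cover by blast
      show "game_le H X \<longleftrightarrow> game_le H Y" using low[OF i(1)] i(2) by (auto simp: lower_def)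
      show "game_le X H \<longleftrightarrow> game_le Y H" using upp[OF i(1)] i(2) by (auto simp: upper_def)
    qed
    have born: "X \<in> born_by (Suc k)" "Y \<in> born_by (Suc k)" using XY by (auto simp: T_def)
    show ?thesis
      unfolding born_by_le_iff[OF born]
    proof (intro ballI conjI impI)
      fix H assume "H \<in> born_by k"
      then obtain K where K: "K \<in> P" "game_le H K" "game_le K H"
        using P by (auto simp: representatives_def equal_val_def)
      show "game_le H Y" if "game_le H X"
        using *(1)[OF K(1)] game_le_trans[OF K(3) that] game_le_trans[OF K(2)] by blast
      show "game_le X H" if "game_le Y H"
        using *(2)[OF K(1)] game_le_trans[OF that K(2)] game_le_trans[OF _ K(3)] by blast
    qed
  qed
  \<comment> \<open>One new representative is chosen for each profile of segment sizes that
    occurs.\<close>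
  define \<R> where "\<R> = P \<union> inv_into T g ` g ` T"
  have finT: "finite T" using finite_born_by[of "Suc k"] by (simp add: T_def)
  have inv: "inv_into T g (g X) \<in> T" "g (inv_into T g (g X)) = g X" if "X \<in> T" for X
    using that by (auto intro: inv_into_into f_inv_into_f)
  have "representatives (Suc k) \<R>"
    unfolding representatives_def
  proof (intro conjI ballI)
    show "finite \<R>" using finP finT by (simp add: \<R>_def)
    have "inv_into T g ` g ` T \<subseteq> born_by (Suc k)" using inv(1) by (auto simp: T_def)
    then show "\<R> \<subseteq> born_by (Suc k)"
      using finP(2) born_by_mono[of k "Suc k"] by (auto simp: \<R>_def)
    fix X assume X: "X \<in> born_by (Suc k)"
    show "\<exists>Y\<in>\<R>. X \<approx> Y"
    proof (cases "X \<in> T")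
      case True
      then have "X \<approx> inv_into T g (g X)"
        using g_le inv[OF True] by (simp add: equal_val_def)
      then show ?thesis using True by (auto simp: \<R>_def)
    next
      case False
      then show ?thesis using X by (auto simp: T_def \<R>_def)
    qed
  qed
  moreover have "card \<R> \<le> card P + (\<Prod>i\<in>I. (card (C i) + 1) * (card (C i) + 2) div 2)"
  proof -
    have "card (g ` T) \<le> card (\<Pi>\<^sub>E i\<in>I. {(a, b). a + b \<le> card (C i)})"
      by (intro card_mono finite_PiE finite_pairs_le image_subsetI g_in I)
    also have "\<dots> = (\<Prod>i\<in>I. (card (C i) + 1) * (card (C i) + 2) div 2)"
      unfolding card_PiE[OF I] card_pairs_le ..
    finally have "card (inv_into T g ` g ` T) \<le> (\<Prod>i\<in>I. (card (C i) + 1) * (card (C i) + 2) div 2)"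
      using order.trans[OF card_image_le] finT by blast
    then show ?thesis unfolding \<R>_def by (intro order.trans[OF card_Un_le]) simp
  qed
  ultimately show ?thesis by blast
qed

end

section \<open>The 1474 values born by day 3\<close>

lemma codes_1: "codes 1 =
    [[True, True], [False, True], [True, False], [False, False]]"
  by (simp add: pair_rows_def)

lemma codes_2: "codes 2 =
    [[True, True, True, True, True, True, True, True], [False, True, True, True, True, True, True, True],
    [False, False, True, True, True, True, True, True], [False, True, False, True, True, True, True,
    True], [False, False, False, True, True, True, True, True], [False, False, False, False, True, True,
    True, True], [True, True, True, True, False, True, True, True], [False, True, True, True, False,
    True, True, True], [False, False, True, True, False, True, True, True], [False, True, False, True,
    False, True, True, True], [False, False, False, True, False, True, True, True], [False, False, False,
    False, False, True, True, True], [False, True, False, True, False, False, True, True], [False, False,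
    False, True, False, False, True, True], [False, False, False, False, False, False, True, True],
    [False, False, True, True, False, True, False, True], [False, False, False, True, False, True, False,
    True], [False, False, False, False, False, True, False, True], [False, False, False, True, False,
    False, False, True], [False, False, False, False, False, False, False, True], [False, False, False,
    True, False, False, False, False], [False, False, False, False, False, False, False, False]]"
proof -
  have "codes 2 = codes (Suc 1)" by (rule arg_cong) simp
  then show ?thesis unfolding codes.simps codes_1 by (simp add: pair_rows_def)
qed

definition rows_3 :: "bool list list" where
  "rows_3 = rev (pair_rows (codes 2))"

lemmas rows_3_eq = rows_3_def[unfolded codes_2 pair_rows_def, simplified]

lemma codes_3: "codes 3 = extensions rows_3 []"
proof -
  have "codes 3 = codes (Suc 2)" by (rule arg_cong) simp
  then show ?thesis unfolding rows_3_def codes.simps .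
qed

text \<open>The chains of a cover of day 3 are given by lists of thresholds: at time \<open>t\<close> the chain has
  reached the code that is true where the threshold is at most \<open>t\<close>. The first component is the length
  of the chain.\<close>

fun cut :: "nat \<Rightarrow> nat list \<Rightarrow> bool list \<Rightarrow> bool" where
  "cut t (s # ss) (True # p) = (s \<le> t \<and> cut t ss p)"
| "cut t (s # ss) (False # p) = (t < s \<and> cut t ss p)"
| "cut t [] [] = True"
| "cut t _ _ = False"

definition is_cut :: "nat \<times> nat list \<Rightarrow> nat \<Rightarrow> bool list \<Rightarrow> bool" where
  "is_cut c t p \<longleftrightarrow> t < fst c \<and> cut t (snd c) p"

text \<open>A certificate with 44 thresholds per chain. Threshold 0 marks an entry that is true
  throughout; a threshold equal to the length is never reached, so the entry stays false. That the
  codes on a row form a chain holds for any thresholds, by monotonicity in time, so the only thing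
  to check is that every code is hit.\<close>

definition chain_table :: "(nat \<times> nat list) list" where
  "chain_table = [
     (45, [44, 43, 42, 41, 40, 39, 38, 37, 36, 35, 34, 33, 32, 31, 30, 29, 28, 27, 26, 25, 24, 23, 22,
     21, 20, 19, 18, 17, 16, 15, 14, 13, 12, 11, 10, 9, 8, 7, 6, 5, 4, 3, 2, 1]),
     (43, [42, 41, 40, 39, 38, 37, 36, 35, 34, 33, 32, 31, 30, 29, 28, 27, 26, 25, 24, 23, 22, 0, 43, 21,
     20, 19, 18, 17, 16, 15, 14, 13, 12, 11, 10, 9, 8, 7, 6, 5, 4, 3, 2, 1]),
     (41, [41, 40, 39, 38, 37, 31, 41, 36, 35, 34, 33, 28, 32, 30, 23, 29, 27, 26, 25, 4, 24, 3, 22, 21,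
     20, 19, 18, 17, 16, 15, 14, 13, 12, 11, 10, 9, 8, 7, 6, 1, 5, 0, 2, 0]),
     (39, [39, 39, 36, 39, 32, 31, 38, 37, 35, 34, 29, 28, 33, 24, 10, 30, 27, 26, 23, 9, 22, 8, 25, 21,
     20, 19, 18, 17, 16, 15, 14, 13, 12, 5, 11, 7, 0, 6, 4, 3, 2, 0, 1, 0]),
     (39, [39, 38, 37, 36, 35, 29, 39, 34, 33, 32, 31, 26, 30, 28, 23, 27, 25, 9, 24, 8, 22, 0, 39, 21,
     20, 19, 18, 17, 16, 15, 14, 13, 12, 11, 7, 6, 1, 10, 5, 4, 3, 0, 2, 0]),
     (37, [37, 37, 36, 33, 32, 31, 37, 37, 35, 30, 29, 28, 23, 22, 21, 34, 27, 26, 20, 19, 14, 13, 25,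
     24, 18, 17, 16, 4, 15, 12, 11, 10, 9, 2, 8, 7, 0, 6, 5, 0, 3, 0, 1, 0]),
     (37, [37, 37, 34, 37, 30, 29, 36, 35, 33, 32, 27, 26, 31, 23, 22, 28, 25, 19, 21, 13, 15, 0, 37, 24,
     20, 18, 17, 7, 16, 14, 12, 11, 10, 3, 9, 8, 1, 6, 5, 0, 4, 0, 2, 0]),
     (37, [37, 36, 35, 34, 33, 32, 37, 31, 30, 29, 28, 27, 26, 25, 24, 23, 21, 20, 15, 0, 13, 0, 37, 37,
     22, 19, 18, 8, 17, 16, 14, 12, 11, 6, 10, 9, 3, 7, 5, 4, 2, 1, 0, 0]),
     (35, [35, 35, 34, 31, 30, 29, 35, 35, 33, 28, 27, 26, 22, 21, 20, 32, 25, 19, 18, 17, 16, 3, 35, 24,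
     14, 23, 9, 1, 15, 13, 12, 11, 7, 0, 10, 6, 0, 8, 5, 0, 4, 0, 2, 0]),
     (33, [33, 33, 32, 33, 31, 30, 33, 33, 26, 33, 25, 22, 29, 24, 9, 23, 20, 19, 18, 7, 14, 6, 28, 27,
     21, 17, 16, 8, 15, 13, 12, 11, 4, 3, 10, 0, 0, 5, 2, 1, 0, 0, 0, 0]),
     (33, [33, 33, 31, 33, 30, 22, 33, 32, 29, 28, 27, 20, 26, 25, 16, 24, 23, 19, 21, 0, 17, 0, 33, 33,
     14, 18, 8, 7, 15, 13, 12, 11, 6, 2, 10, 4, 0, 9, 5, 1, 3, 0, 0, 0]),
     (33, [33, 33, 32, 30, 27, 25, 33, 33, 31, 29, 24, 23, 28, 18, 11, 26, 21, 20, 14, 10, 2, 0, 33, 33,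
     22, 19, 17, 1, 16, 15, 13, 12, 9, 0, 8, 7, 0, 6, 5, 0, 4, 0, 3, 0]),
     (31, [31, 31, 30, 31, 29, 25, 31, 31, 24, 31, 23, 22, 31, 21, 20, 18, 17, 16, 15, 14, 13, 12, 28,
     27, 26, 11, 6, 5, 19, 10, 9, 8, 4, 3, 0, 0, 0, 7, 2, 1, 0, 0, 0, 0]),
     (31, [31, 31, 30, 31, 29, 28, 31, 31, 25, 31, 24, 23, 22, 21, 20, 19, 18, 17, 16, 15, 14, 0, 31, 27,
     12, 9, 8, 7, 26, 13, 11, 6, 5, 2, 4, 0, 0, 10, 3, 1, 0, 0, 0, 0]),
     (29, [29, 29, 28, 29, 24, 21, 29, 29, 25, 29, 23, 17, 29, 22, 12, 20, 19, 6, 18, 5, 16, 4, 29, 27,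
     26, 15, 14, 1, 13, 11, 10, 9, 8, 0, 3, 0, 0, 7, 2, 0, 0, 0, 0, 0]),
     (29, [29, 29, 29, 29, 29, 29, 28, 27, 26, 25, 24, 23, 22, 21, 20, 19, 18, 17, 16, 3, 15, 0, 29, 14,
     13, 9, 8, 7, 29, 12, 11, 6, 5, 2, 0, 0, 0, 10, 4, 1, 0, 0, 0, 0]),
     (28, [28, 28, 28, 28, 27, 22, 28, 28, 28, 28, 26, 20, 25, 24, 15, 28, 23, 3, 21, 0, 19, 0, 18, 17,
     13, 16, 8, 7, 14, 12, 11, 10, 6, 4, 2, 0, 0, 9, 5, 1, 0, 0, 0, 0]),
     (27, [27, 27, 26, 27, 24, 23, 27, 27, 25, 27, 22, 21, 19, 18, 17, 25, 15, 7, 14, 0, 3, 0, 27, 27,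
     16, 20, 13, 0, 12, 11, 10, 9, 8, 0, 6, 5, 0, 4, 2, 0, 1, 0, 0, 0]),
     (27, [27, 27, 27, 26, 25, 24, 27, 27, 27, 22, 21, 16, 20, 19, 15, 27, 18, 13, 17, 12, 3, 2, 27, 27,
     11, 23, 9, 1, 14, 10, 8, 6, 5, 0, 0, 0, 0, 7, 4, 0, 0, 0, 0, 0]),
     (25, [25, 25, 25, 25, 24, 19, 25, 25, 25, 25, 22, 11, 25, 21, 0, 25, 20, 4, 18, 0, 17, 0, 23, 16,
     15, 14, 13, 12, 10, 9, 8, 7, 6, 5, 3, 2, 1, 0, 0, 0, 0, 0, 0, 0]),
     (25, [25, 25, 25, 25, 24, 21, 25, 25, 25, 25, 23, 16, 20, 15, 9, 25, 22, 8, 14, 7, 1, 0, 25, 19, 18,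
     17, 13, 0, 12, 11, 5, 10, 3, 0, 6, 0, 0, 4, 2, 0, 0, 0, 0, 0]),
     (25, [25, 25, 25, 24, 23, 15, 25, 25, 25, 22, 21, 13, 20, 19, 12, 25, 18, 11, 17, 0, 0, 0, 25, 25,
     16, 25, 6, 0, 14, 10, 9, 8, 4, 0, 7, 2, 0, 5, 3, 0, 1, 0, 0, 0]),
     (24, [24, 24, 24, 24, 24, 24, 24, 23, 22, 20, 19, 18, 17, 16, 7, 21, 15, 14, 13, 6, 12, 5, 24, 24,
     11, 10, 4, 0, 24, 9, 2, 8, 0, 0, 3, 0, 0, 1, 0, 0, 0, 0, 0, 0]),
     (23, [23, 23, 23, 23, 20, 19, 23, 23, 23, 23, 18, 16, 23, 15, 13, 23, 12, 8, 0, 0, 0, 0, 23, 22, 21,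
     17, 14, 0, 11, 10, 9, 7, 6, 0, 5, 4, 0, 3, 2, 0, 1, 0, 0, 0]),
     (23, [23, 23, 23, 23, 23, 23, 23, 23, 21, 23, 20, 17, 22, 19, 14, 18, 16, 10, 15, 0, 2, 0, 23, 13,
     12, 7, 6, 1, 23, 11, 9, 5, 4, 1, 0, 0, 0, 8, 3, 1, 0, 0, 0, 0]),
     (22, [22, 22, 22, 22, 22, 22, 22, 21, 20, 19, 18, 17, 16, 15, 14, 13, 12, 11, 10, 9, 2, 0, 22, 22,
     8, 6, 1, 1, 22, 22, 7, 5, 0, 0, 4, 0, 0, 3, 0, 0, 0, 0, 0, 0]),
     (21, [21, 21, 21, 21, 21, 14, 21, 21, 21, 21, 21, 12, 20, 16, 2, 21, 21, 8, 5, 0, 4, 0, 19, 18, 17,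
     15, 13, 1, 11, 10, 9, 7, 6, 1, 3, 0, 0, 2, 0, 0, 0, 0, 0, 0]),
     (21, [21, 21, 21, 21, 21, 15, 21, 21, 20, 21, 20, 12, 19, 17, 11, 20, 7, 4, 1, 0, 1, 0, 21, 21, 18,
     16, 14, 0, 13, 10, 9, 8, 6, 0, 3, 0, 0, 5, 2, 0, 0, 0, 0, 0]),
     (21, [21, 21, 20, 21, 19, 18, 21, 21, 20, 21, 15, 14, 21, 5, 0, 20, 13, 12, 4, 0, 2, 0, 21, 21, 17,
     20, 16, 1, 11, 10, 9, 8, 7, 0, 6, 3, 0, 0, 0, 0, 0, 0, 0, 0]),
     (21, [21, 21, 21, 21, 21, 21, 21, 21, 21, 20, 19, 18, 17, 12, 7, 21, 16, 15, 11, 6, 4, 3, 21, 14,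
     13, 10, 0, 0, 21, 9, 2, 8, 0, 0, 5, 0, 0, 1, 0, 0, 0, 0, 0, 0]),
     (20, [20, 20, 19, 20, 18, 14, 20, 20, 19, 20, 17, 12, 20, 9, 8, 19, 16, 7, 5, 3, 4, 1, 20, 20, 20,
     19, 15, 2, 13, 11, 0, 10, 0, 0, 6, 0, 0, 0, 0, 0, 0, 0, 0, 0]),
     (20, [20, 20, 20, 20, 20, 20, 20, 20, 19, 20, 18, 13, 20, 17, 9, 16, 15, 0, 14, 0, 2, 0, 20, 20, 12,
     10, 5, 1, 20, 11, 8, 7, 4, 1, 0, 0, 0, 6, 3, 1, 0, 0, 0, 0]),
     (19, [19, 19, 19, 19, 19, 19, 19, 19, 17, 19, 16, 13, 18, 15, 8, 14, 12, 11, 10, 7, 9, 7, 19, 19, 6,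
     3, 2, 1, 19, 19, 5, 0, 0, 0, 0, 0, 0, 4, 0, 0, 0, 0, 0, 0]),
     (18, [18, 18, 18, 18, 18, 12, 18, 18, 18, 18, 18, 10, 18, 18, 5, 17, 17, 4, 17, 3, 16, 1, 15, 14, 9,
     13, 7, 2, 11, 8, 0, 6, 0, 0, 0, 0, 0, 0, 0, 0, 0, 0, 0, 0]),
     (18, [18, 18, 18, 18, 18, 18, 18, 18, 18, 18, 18, 13, 15, 12, 11, 18, 18, 10, 4, 3, 2, 0, 17, 17, 9,
     16, 1, 0, 14, 8, 7, 6, 0, 0, 0, 0, 0, 5, 0, 0, 0, 0, 0, 0]),
     (17, [17, 17, 17, 17, 15, 10, 17, 17, 17, 17, 14, 4, 16, 13, 3, 17, 12, 2, 11, 0, 8, 0, 17, 17, 16,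
     17, 16, 7, 9, 6, 0, 5, 0, 0, 1, 0, 0, 0, 0, 0, 0, 0, 0, 0]),
     (17, [17, 17, 17, 17, 17, 17, 17, 17, 17, 17, 16, 11, 17, 14, 0, 17, 15, 7, 13, 0, 12, 0, 17, 10, 4,
     8, 3, 2, 17, 9, 1, 6, 0, 0, 5, 0, 0, 0, 0, 0, 0, 0, 0, 0]),
     (17, [17, 17, 17, 17, 17, 17, 17, 17, 16, 17, 15, 14, 17, 13, 10, 12, 2, 1, 0, 0, 0, 0, 17, 17, 17,
     11, 5, 0, 17, 9, 8, 7, 4, 0, 0, 0, 0, 6, 3, 0, 0, 0, 0, 0]),
     (16, [16, 16, 16, 16, 16, 16, 16, 16, 16, 15, 14, 13, 12, 11, 10, 16, 8, 7, 6, 5, 4, 3, 16, 16, 0,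
     16, 0, 0, 16, 9, 0, 2, 0, 0, 1, 0, 0, 0, 0, 0, 0, 0, 0, 0]),
     (16, [16, 16, 16, 16, 16, 16, 16, 16, 16, 15, 14, 13, 12, 8, 7, 16, 11, 10, 1, 0, 1, 0, 16, 16, 9,
     4, 3, 0, 16, 16, 6, 2, 0, 0, 0, 0, 0, 5, 0, 0, 0, 0, 0, 0]),
     (15, [15, 15, 15, 15, 15, 14, 15, 15, 15, 15, 15, 13, 12, 10, 8, 15, 15, 0, 4, 0, 3, 0, 15, 15, 11,
     9, 2, 1, 14, 7, 6, 0, 0, 0, 0, 0, 0, 5, 0, 0, 0, 0, 0, 0]),
     (15, [15, 15, 15, 15, 15, 15, 15, 15, 15, 15, 15, 14, 10, 9, 3, 15, 15, 13, 0, 0, 0, 0, 15, 12, 8,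
     11, 2, 0, 15, 7, 6, 5, 0, 0, 4, 0, 0, 1, 0, 0, 0, 0, 0, 0]),
     (15, [15, 15, 15, 15, 15, 15, 15, 15, 15, 15, 14, 0, 15, 11, 0, 15, 13, 0, 10, 0, 9, 0, 15, 15, 12,
     8, 6, 4, 15, 7, 5, 3, 2, 1, 0, 0, 0, 0, 0, 0, 0, 0, 0, 0]),
     (14, [14, 14, 14, 14, 14, 14, 14, 14, 13, 14, 12, 11, 14, 10, 1, 9, 8, 4, 5, 0, 3, 0, 14, 14, 14, 7,
     0, 0, 14, 14, 6, 2, 0, 0, 0, 0, 0, 1, 0, 0, 0, 0, 0, 0]),
     (14, [14, 14, 14, 14, 14, 14, 14, 14, 14, 13, 12, 11, 10, 9, 4, 14, 8, 7, 6, 3, 2, 0, 14, 14, 0, 14,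
     0, 0, 14, 14, 0, 5, 0, 0, 1, 0, 0, 0, 0, 0, 0, 0, 0, 0]),
     (13, [13, 13, 13, 13, 13, 12, 13, 13, 13, 13, 13, 4, 13, 13, 0, 11, 9, 0, 6, 0, 3, 0, 13, 12, 12,
     10, 8, 0, 12, 7, 5, 2, 1, 0, 0, 0, 0, 0, 0, 0, 0, 0, 0, 0]),
     (13, [13, 13, 13, 13, 13, 12, 13, 13, 13, 13, 13, 11, 9, 1, 0, 13, 13, 8, 0, 0, 0, 0, 13, 13, 7, 13,
     3, 0, 12, 10, 6, 5, 2, 0, 4, 2, 0, 0, 0, 0, 0, 0, 0, 0]),
     (13, [13, 13, 13, 13, 13, 13, 13, 13, 13, 13, 12, 11, 13, 5, 4, 13, 9, 2, 1, 0, 0, 0, 13, 13, 13,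
     10, 0, 0, 13, 8, 7, 6, 0, 0, 2, 0, 0, 3, 0, 0, 0, 0, 0, 0]),
     (13, [13, 13, 13, 13, 13, 13, 13, 13, 13, 13, 12, 8, 13, 11, 6, 13, 10, 4, 9, 0, 5, 0, 13, 13, 1,
     13, 0, 0, 13, 7, 0, 3, 0, 0, 2, 0, 0, 0, 0, 0, 0, 0, 0, 0]),
     (13, [13, 13, 13, 13, 13, 13, 13, 13, 13, 13, 12, 4, 13, 10, 0, 13, 11, 3, 9, 0, 1, 0, 13, 13, 8, 7,
     0, 0, 13, 13, 6, 5, 0, 0, 2, 0, 0, 0, 0, 0, 0, 0, 0, 0]),
     (13, [13, 13, 13, 13, 13, 13, 13, 13, 13, 12, 11, 10, 9, 8, 0, 13, 7, 6, 3, 0, 2, 0, 13, 13, 5, 13,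
     4, 1, 13, 13, 0, 13, 0, 0, 0, 0, 0, 0, 0, 0, 0, 0, 0, 0]),
     (12, [12, 12, 12, 12, 12, 12, 12, 12, 12, 12, 11, 7, 12, 3, 0, 12, 10, 6, 2, 0, 0, 0, 12, 12, 12,
     12, 5, 0, 12, 9, 1, 8, 0, 0, 4, 0, 0, 0, 0, 0, 0, 0, 0, 0]),
     (12, [12, 12, 12, 12, 12, 12, 12, 12, 11, 12, 10, 9, 12, 8, 7, 6, 5, 2, 4, 2, 0, 0, 12, 12, 12, 1,
     0, 0, 12, 12, 12, 0, 0, 0, 0, 0, 0, 3, 0, 0, 0, 0, 0, 0]),
     (11, [11, 11, 11, 11, 11, 11, 11, 11, 11, 11, 11, 10, 6, 4, 3, 11, 11, 9, 2, 1, 0, 0, 11, 11, 0, 8,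
     0, 0, 11, 11, 0, 7, 0, 0, 5, 0, 0, 0, 0, 0, 0, 0, 0, 0]),
     (11, [11, 11, 11, 11, 11, 11, 11, 11, 11, 11, 10, 9, 11, 7, 0, 11, 3, 0, 2, 0, 0, 0, 11, 11, 11, 8,
     6, 0, 11, 11, 5, 4, 1, 0, 0, 0, 0, 0, 0, 0, 0, 0, 0, 0]),
     (11, [11, 11, 11, 11, 11, 11, 11, 11, 11, 11, 10, 0, 11, 9, 0, 11, 8, 0, 7, 0, 6, 0, 11, 11, 4, 11,
     3, 0, 11, 11, 2, 5, 1, 0, 0, 0, 0, 0, 0, 0, 0, 0, 0, 0]),
     (10, [10, 10, 10, 10, 10, 10, 10, 10, 10, 10, 10, 5, 10, 8, 4, 10, 10, 3, 1, 0, 0, 0, 9, 9, 9, 7, 0,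
     0, 9, 9, 0, 6, 0, 0, 2, 0, 0, 0, 0, 0, 0, 0, 0, 0]),
     (9, [9, 9, 9, 9, 9, 7, 9, 9, 9, 9, 9, 4, 9, 9, 3, 9, 9, 0, 9, 0, 7, 0, 9, 8, 5, 0, 0, 0, 7, 6, 2, 0,
     0, 0, 0, 0, 0, 1, 0, 0, 0, 0, 0, 0]),
     (9, [9, 9, 9, 9, 9, 8, 9, 9, 9, 9, 9, 4, 9, 6, 3, 9, 9, 0, 5, 0, 2, 0, 9, 9, 1, 9, 0, 0, 8, 8, 0, 7,
     0, 0, 0, 0, 0, 0, 0, 0, 0, 0, 0, 0]),
     (9, [9, 9, 9, 9, 9, 9, 9, 9, 9, 9, 8, 7, 9, 1, 0, 9, 4, 0, 0, 0, 0, 0, 9, 9, 9, 9, 9, 0, 9, 6, 5, 3,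
     2, 0, 0, 0, 0, 0, 0, 0, 0, 0, 0, 0]),
     (9, [9, 9, 9, 9, 9, 9, 9, 9, 9, 9, 9, 0, 9, 9, 0, 8, 4, 0, 2, 0, 0, 0, 9, 9, 9, 7, 6, 0, 9, 9, 5, 3,
     1, 0, 0, 0, 0, 0, 0, 0, 0, 0, 0, 0]),
     (9, [9, 9, 9, 9, 9, 9, 9, 9, 9, 9, 8, 4, 9, 2, 1, 9, 0, 0, 0, 0, 0, 0, 9, 9, 9, 9, 7, 0, 9, 9, 6, 5,
     3, 0, 0, 0, 0, 0, 0, 0, 0, 0, 0, 0]),
     (9, [9, 9, 9, 9, 9, 9, 9, 9, 9, 9, 8, 7, 9, 6, 5, 9, 2, 0, 1, 0, 0, 0, 9, 9, 9, 4, 3, 0, 9, 9, 9, 0,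
     0, 0, 0, 0, 0, 5, 0, 0, 0, 0, 0, 0]),
     (8, [8, 8, 8, 8, 8, 8, 8, 8, 8, 8, 8, 5, 8, 8, 0, 7, 6, 0, 4, 0, 3, 0, 8, 8, 8, 2, 0, 0, 8, 8, 8, 1,
     0, 0, 0, 0, 0, 0, 0, 0, 0, 0, 0, 0]),
     (8, [8, 8, 8, 8, 8, 8, 8, 8, 8, 8, 7, 4, 8, 6, 3, 8, 1, 0, 0, 0, 0, 0, 8, 8, 5, 8, 2, 0, 8, 8, 1, 8,
     0, 0, 0, 0, 0, 1, 0, 0, 0, 0, 0, 0]),
     (7, [7, 7, 7, 7, 7, 7, 7, 7, 7, 7, 7, 7, 7, 7, 7, 7, 7, 4, 7, 4, 6, 3, 5, 2, 0, 1, 0, 0, 5, 0, 0, 0,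
     0, 0, 0, 0, 0, 0, 0, 0, 0, 0, 0, 0]),
     (7, [7, 7, 7, 7, 7, 7, 7, 7, 7, 7, 7, 5, 3, 2, 0, 7, 7, 4, 0, 0, 0, 0, 7, 7, 3, 7, 1, 0, 7, 7, 1, 6,
     0, 0, 4, 0, 0, 0, 0, 0, 0, 0, 0, 0]),
     (7, [7, 7, 7, 7, 7, 7, 7, 7, 7, 7, 3, 0, 7, 2, 0, 7, 1, 0, 0, 0, 0, 0, 7, 7, 7, 7, 7, 0, 7, 7, 6, 5,
     4, 0, 0, 0, 0, 0, 0, 0, 0, 0, 0, 0]),
     (6, [6, 6, 6, 6, 6, 6, 6, 6, 6, 6, 6, 6, 5, 4, 0, 6, 6, 6, 3, 0, 0, 0, 6, 6, 1, 6, 0, 0, 3, 2, 0, 2,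
     0, 0, 2, 0, 0, 0, 0, 0, 0, 0, 0, 0]),
     (6, [6, 6, 6, 6, 6, 6, 6, 6, 6, 6, 6, 6, 6, 3, 0, 6, 6, 4, 2, 0, 1, 0, 6, 6, 6, 0, 0, 0, 6, 6, 5, 0,
     0, 0, 0, 0, 0, 0, 0, 0, 0, 0, 0, 0]),
     (6, [6, 6, 6, 6, 6, 6, 6, 6, 6, 6, 5, 0, 6, 4, 0, 6, 3, 0, 2, 0, 2, 0, 6, 6, 6, 6, 0, 0, 6, 6, 6, 1,
     0, 0, 0, 0, 0, 0, 0, 0, 0, 0, 0, 0]),
     (6, [6, 6, 6, 6, 6, 6, 6, 6, 6, 6, 5, 0, 6, 3, 0, 6, 2, 0, 1, 0, 0, 0, 6, 6, 6, 6, 4, 0, 6, 6, 0, 6,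
     0, 0, 0, 0, 0, 0, 0, 0, 0, 0, 0, 0]),
     (5, [5, 5, 5, 5, 5, 0, 5, 5, 5, 5, 5, 0, 5, 5, 0, 5, 5, 0, 5, 0, 4, 0, 5, 5, 5, 3, 2, 1, 0, 0, 0, 0,
     0, 0, 0, 0, 0, 0, 0, 0, 0, 0, 0, 0]),
     (5, [5, 5, 5, 5, 5, 5, 5, 5, 5, 5, 5, 0, 5, 0, 0, 5, 5, 0, 0, 0, 0, 0, 5, 5, 5, 4, 3, 0, 5, 5, 5, 2,
     1, 0, 0, 0, 0, 0, 0, 0, 0, 0, 0, 0]),
     (4, [4, 4, 4, 4, 4, 4, 4, 4, 4, 4, 4, 4, 4, 4, 0, 4, 4, 4, 3, 0, 1, 0, 4, 2, 2, 0, 0, 0, 4, 2, 0, 0,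
     0, 0, 0, 0, 0, 0, 0, 0, 0, 0, 0, 0]),
     (4, [4, 4, 4, 4, 4, 4, 4, 4, 4, 4, 4, 4, 4, 4, 4, 3, 2, 0, 1, 0, 0, 0, 4, 4, 4, 1, 0, 0, 4, 4, 0, 1,
     0, 0, 0, 0, 0, 0, 0, 0, 0, 0, 0, 0]),
     (4, [4, 4, 4, 4, 4, 4, 4, 4, 4, 4, 3, 2, 4, 1, 0, 4, 0, 0, 0, 0, 0, 0, 4, 4, 4, 4, 0, 0, 4, 4, 4, 4,
     0, 0, 0, 0, 0, 0, 0, 0, 0, 0, 0, 0]),
     (3, [3, 3, 3, 3, 3, 3, 3, 3, 3, 3, 3, 2, 3, 3, 0, 3, 3, 0, 3, 0, 3, 0, 2, 2, 1, 2, 0, 0, 2, 2, 0, 2,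
     0, 0, 0, 0, 0, 0, 0, 0, 0, 0, 0, 0]),
     (3, [3, 3, 3, 3, 3, 3, 3, 3, 3, 3, 3, 3, 3, 3, 2, 3, 3, 0, 3, 0, 1, 0, 3, 3, 0, 0, 0, 0, 3, 3, 0, 0,
     0, 0, 0, 0, 0, 0, 0, 0, 0, 0, 0, 0]),
     (3, [3, 3, 3, 3, 3, 3, 3, 3, 3, 3, 3, 3, 3, 3, 3, 3, 2, 1, 0, 0, 0, 0, 3, 3, 0, 3, 0, 0, 3, 3, 0, 3,
     0, 0, 0, 0, 0, 0, 0, 0, 0, 0, 0, 0]),
     (3, [3, 3, 3, 3, 3, 3, 3, 3, 3, 3, 3, 3, 3, 1, 0, 3, 0, 0, 0, 0, 0, 0, 3, 3, 3, 3, 2, 0, 3, 3, 0, 3,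
     0, 0, 0, 0, 0, 0, 0, 0, 0, 0, 0, 0]),
     (2, [2, 2, 2, 2, 2, 2, 2, 2, 2, 2, 2, 2, 2, 2, 0, 2, 2, 2, 2, 0, 2, 0, 2, 1, 0, 1, 0, 0, 2, 0, 0, 0,
     0, 0, 0, 0, 0, 0, 0, 0, 0, 0, 0, 0]),
     (2, [2, 2, 2, 2, 2, 2, 2, 2, 2, 2, 2, 2, 2, 2, 2, 2, 2, 0, 2, 0, 2, 0, 2, 2, 1, 0, 0, 0, 2, 0, 0, 0,
     0, 0, 0, 0, 0, 0, 0, 0, 0, 0, 0, 0]),
     (2, [2, 2, 2, 2, 2, 2, 2, 2, 2, 2, 2, 0, 2, 0, 0, 2, 2, 0, 0, 0, 0, 0, 2, 2, 2, 2, 2, 0, 2, 2, 0, 1,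
     0, 0, 0, 0, 0, 0, 0, 0, 0, 0, 0, 0]),
     (2, [2, 2, 2, 2, 2, 2, 2, 2, 2, 2, 2, 0, 2, 2, 0, 2, 2, 0, 2, 0, 1, 0, 2, 2, 2, 0, 0, 0, 2, 2, 2, 0,
     0, 0, 0, 0, 0, 0, 0, 0, 0, 0, 0, 0]),
     (2, [2, 2, 2, 2, 2, 2, 2, 2, 2, 2, 2, 2, 2, 1, 0, 2, 0, 0, 0, 0, 0, 0, 2, 2, 2, 2, 0, 0, 2, 2, 2, 0,
     0, 0, 0, 0, 0, 0, 0, 0, 0, 0, 0, 0]),
     (2, [2, 2, 2, 2, 2, 2, 2, 2, 2, 2, 2, 2, 2, 1, 0, 2, 2, 0, 1, 0, 0, 0, 2, 2, 1, 2, 0, 0, 2, 2, 0, 2,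
     0, 0, 0, 0, 0, 0, 0, 0, 0, 0, 0, 0]),
     (2, [2, 2, 2, 2, 2, 2, 2, 2, 2, 2, 1, 0, 2, 1, 0, 2, 0, 0, 0, 0, 0, 0, 2, 2, 2, 2, 2, 0, 2, 2, 1, 2,
     0, 0, 0, 0, 0, 0, 0, 0, 0, 0, 0, 0]),
     (2, [2, 2, 2, 2, 2, 2, 2, 2, 2, 2, 2, 0, 2, 2, 0, 2, 1, 0, 0, 0, 0, 0, 2, 2, 2, 2, 0, 0, 2, 2, 2, 2,
     0, 0, 0, 0, 0, 0, 0, 0, 0, 0, 0, 0]),
     (2, [2, 2, 2, 2, 2, 2, 2, 2, 2, 2, 2, 2, 2, 2, 2, 1, 1, 0, 0, 0, 0, 0, 2, 2, 2, 0, 0, 0, 2, 2, 2, 0,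
     0, 0, 0, 0, 0, 2, 0, 0, 0, 0, 0, 0]),
     (1, [1, 1, 1, 1, 1, 1, 1, 1, 1, 1, 1, 1, 1, 1, 1, 1, 1, 1, 1, 1, 1, 1, 1, 1, 0, 1, 0, 0, 0, 0, 0, 0,
     0, 0, 0, 0, 0, 0, 0, 0, 0, 0, 0, 0]),
     (1, [1, 1, 1, 1, 1, 1, 1, 1, 1, 1, 1, 1, 1, 1, 1, 1, 1, 1, 1, 1, 0, 0, 1, 0, 0, 0, 0, 0, 1, 0, 0, 0,
     0, 0, 0, 0, 0, 0, 0, 0, 0, 0, 0, 0]),
     (1, [1, 1, 1, 1, 1, 1, 1, 1, 1, 1, 1, 1, 1, 1, 0, 1, 1, 0, 1, 0, 1, 0, 1, 1, 1, 0, 0, 0, 1, 0, 0, 0,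
     0, 0, 0, 0, 0, 0, 0, 0, 0, 0, 0, 0]),
     (1, [1, 1, 1, 1, 1, 1, 1, 1, 1, 1, 1, 1, 1, 0, 0, 1, 1, 1, 0, 0, 0, 0, 1, 1, 1, 1, 0, 0, 1, 0, 0, 0,
     0, 0, 0, 0, 0, 0, 0, 0, 0, 0, 0, 0]),
     (1, [1, 1, 1, 1, 1, 1, 1, 1, 1, 1, 1, 0, 1, 1, 0, 1, 1, 0, 1, 0, 0, 0, 1, 1, 1, 1, 0, 0, 1, 1, 0, 1,
     0, 0, 0, 0, 0, 0, 0, 0, 0, 0, 0, 0]),
     (1, [1, 1, 1, 1, 1, 1, 1, 1, 1, 1, 1, 0, 1, 0, 0, 1, 1, 0, 0, 0, 0, 0, 1, 1, 1, 1, 0, 0, 1, 1, 1, 1,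
     0, 0, 0, 0, 0, 0, 0, 0, 0, 0, 0, 0])]"

definition cuts :: "nat \<Rightarrow> nat \<times> nat list" where
  "cuts i = chain_table ! i"

text \<open>The nodes of a tree follow the branching of \<^const>\<open>extensions\<close>, and its leaves \<open>Cut i t\<close> locate
  the code in question at time \<open>t\<close> of the \<open>i\<close>-th chain.\<close>

datatype cut_tree = Cut nat nat | Branch cut_tree cut_tree

definition tree_3 :: cut_tree where
  "tree_3 =
     Branch (Branch (Branch (Branch (Branch (Branch (Branch (Branch (Branch (Branch (Branch (Branch
     (Branch (Branch (Branch (Branch (Branch (Branch (Branch (Branch (Branch (Branch (Branch (Branch
     (Branch (Branch (Branch (Branch (Branch (Branch (Branch (Branch (Branch (Branch (Branch (Branch
     (Branch (Branch (Branch (Branch (Branch (Branch (Branch (Branch (Cut 0 44) (Cut 0 43)) (Cut 0 42))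
     (Cut 0 41)) (Branch (Cut 3 38) (Cut 0 40))) (Cut 0 39)) (Cut 0 38)) (Branch (Branch (Branch (Branch
     (Branch (Cut 2 40) (Cut 2 39)) (Cut 2 38)) (Branch (Cut 3 37) (Cut 2 37))) (Cut 2 36)) (Cut 0 37)))
     (Branch (Branch (Branch (Branch (Cut 5 36) (Cut 5 35)) (Branch (Cut 3 36) (Cut 3 35))) (Cut 2 35))
     (Cut 0 36))) (Branch (Branch (Branch (Cut 5 34) (Cut 3 34)) (Cut 2 34)) (Cut 0 35))) (Branch (Branch
     (Branch (Branch (Cut 9 32) (Cut 9 31)) (Cut 9 30)) (Cut 9 29)) (Branch (Branch (Cut 3 33) (Cut 2
     33)) (Cut 0 34)))) (Branch (Cut 2 32) (Cut 0 33))) (Cut 0 32)) (Branch (Branch (Branch (Branch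
     (Branch (Branch (Cut 12 30) (Cut 12 29)) (Cut 12 28)) (Cut 9 28)) (Branch (Branch (Cut 3 32) (Cut 3
     31)) (Cut 3 30))) (Branch (Cut 2 31) (Cut 2 30))) (Cut 0 31))) (Branch (Branch (Cut 33 17) (Cut 2
     29)) (Cut 0 30))) (Cut 0 29)) (Branch (Branch (Branch (Branch (Branch (Branch (Branch (Branch
     (Branch (Cut 5 33) (Cut 5 32)) (Cut 5 31)) (Cut 5 30)) (Branch (Branch (Cut 16 27) (Cut 16 26)) (Cut
     5 29))) (Branch (Cut 16 25) (Cut 5 28))) (Cut 5 27)) (Branch (Branch (Branch (Branch (Cut 19 24)
     (Cut 19 23)) (Cut 3 29)) (Branch (Cut 16 24) (Cut 3 28))) (Cut 3 27))) (Branch (Branch (Cut 16 23)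
     (Cut 2 28)) (Cut 2 27))) (Cut 0 28))) (Branch (Branch (Branch (Branch (Branch (Cut 26 20) (Cut 34
     17)) (Cut 5 26)) (Branch (Branch (Cut 26 19) (Cut 56 9)) (Cut 3 26))) (Branch (Branch (Cut 16 22)
     (Cut 16 21)) (Cut 2 26))) (Cut 0 27))) (Branch (Branch (Branch (Cut 5 25) (Cut 3 25)) (Cut 2 25))
     (Cut 0 26))) (Branch (Branch (Branch (Branch (Cut 33 16) (Cut 16 20)) (Cut 16 19)) (Cut 65 6))
     (Branch (Cut 2 24) (Cut 0 25)))) (Cut 0 24)) (Branch (Branch (Branch (Branch (Branch (Cut 33 15)
     (Cut 77 2)) (Cut 16 18)) (Cut 65 5)) (Branch (Cut 2 23) (Cut 2 22))) (Cut 0 23))) (Cut 0 22))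
     (Branch (Branch (Branch (Branch (Branch (Branch (Branch (Branch (Branch (Branch (Branch (Branch
     (Branch (Branch (Branch (Branch (Branch (Branch (Branch (Branch (Branch (Branch (Cut 1 42) (Cut 1
     41)) (Cut 1 40)) (Cut 1 39)) (Branch (Cut 6 36) (Cut 1 38))) (Cut 1 37)) (Cut 1 36)) (Branch (Branch
     (Branch (Branch (Branch (Cut 4 38) (Cut 4 37)) (Cut 4 36)) (Branch (Cut 6 35) (Cut 4 35))) (Cut 4
     34)) (Cut 1 35))) (Branch (Branch (Branch (Branch (Cut 8 34) (Cut 8 33)) (Branch (Cut 6 34) (Cut 6
     33))) (Cut 4 33)) (Cut 1 34))) (Branch (Branch (Branch (Cut 8 32) (Cut 6 32)) (Cut 4 32)) (Cut 1
     33))) (Branch (Branch (Branch (Branch (Cut 13 30) (Cut 13 29)) (Cut 13 28)) (Cut 13 27)) (Branch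
     (Branch (Cut 6 31) (Cut 4 31)) (Cut 1 32)))) (Branch (Cut 4 30) (Cut 1 31))) (Cut 1 30)) (Branch
     (Branch (Branch (Branch (Branch (Branch (Cut 14 28) (Cut 14 27)) (Cut 12 27)) (Cut 9 27)) (Branch
     (Branch (Cut 6 30) (Cut 6 29)) (Cut 6 28))) (Branch (Cut 4 29) (Cut 4 28))) (Cut 1 29))) (Branch
     (Branch (Cut 45 12) (Cut 4 27)) (Cut 1 28))) (Cut 1 27)) (Branch (Branch (Branch (Branch (Branch
     (Branch (Branch (Branch (Branch (Cut 8 31) (Cut 8 30)) (Cut 8 29)) (Cut 8 28)) (Branch (Branch (Cut
     20 24) (Cut 20 23)) (Cut 8 27))) (Branch (Cut 20 22) (Cut 8 26))) (Cut 8 25)) (Branch (Branch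
     (Branch (Branch (Cut 23 22) (Cut 19 22)) (Cut 6 27)) (Branch (Cut 19 21) (Cut 6 26))) (Cut 6 25)))
     (Branch (Branch (Cut 19 20) (Cut 4 26)) (Cut 4 25))) (Cut 1 26))) (Branch (Branch (Branch (Branch
     (Branch (Cut 20 21) (Cut 20 20)) (Cut 8 24)) (Branch (Branch (Cut 26 18) (Cut 20 19)) (Cut 6 24)))
     (Branch (Branch (Cut 19 19) (Cut 19 18)) (Cut 4 24))) (Cut 1 25))) (Branch (Branch (Branch (Cut 5
     24) (Cut 3 24)) (Cut 3 23)) (Cut 1 24))) (Branch (Branch (Branch (Branch (Cut 57 8) (Cut 19 17))
     (Cut 4 23)) (Cut 4 22)) (Branch (Cut 3 22) (Cut 1 23)))) (Cut 1 22)) (Branch (Branch (Branch (Branch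
     (Branch (Cut 33 14) (Cut 19 16)) (Cut 16 17)) (Cut 4 21)) (Branch (Cut 3 21) (Cut 2 21))) (Cut 1
     21))) (Cut 0 21))) (Branch (Branch (Branch (Branch (Branch (Branch (Branch (Branch (Branch (Branch
     (Branch (Branch (Branch (Branch (Branch (Branch (Branch (Branch (Branch (Branch (Cut 7 36) (Cut 7
     35)) (Cut 7 34)) (Branch (Cut 10 32) (Cut 7 33))) (Cut 7 32)) (Cut 7 31)) (Branch (Branch (Branch
     (Branch (Cut 11 32) (Cut 11 31)) (Branch (Cut 10 31) (Cut 10 30))) (Cut 10 29)) (Cut 7 30))) (Branch
     (Branch (Branch (Cut 11 30) (Cut 11 29)) (Cut 10 28)) (Cut 7 29))) (Branch (Branch (Branch (Branch
     (Cut 17 26) (Cut 17 25)) (Cut 27 20)) (Cut 13 26)) (Branch (Branch (Cut 11 28) (Cut 10 27)) (Cut 7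
     28)))) (Branch (Cut 10 26) (Cut 7 27))) (Cut 7 26)) (Branch (Branch (Branch (Branch (Branch (Branch
     (Cut 28 20) (Cut 14 26)) (Cut 12 26)) (Cut 9 26)) (Branch (Branch (Cut 11 27) (Cut 11 26)) (Cut 9
     25))) (Branch (Cut 10 25) (Cut 9 24))) (Cut 7 25))) (Branch (Branch (Cut 10 24) (Cut 9 23)) (Cut 7
     24))) (Cut 7 23)) (Branch (Branch (Branch (Branch (Branch (Branch (Branch (Branch (Branch (Cut 18
     26) (Cut 18 25)) (Cut 18 24)) (Cut 18 23)) (Branch (Branch (Cut 17 24) (Cut 17 23)) (Cut 17 22)))
     (Branch (Cut 27 19) (Cut 17 21))) (Cut 17 20)) (Branch (Branch (Branch (Branch (Cut 23 21) (Cut 11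
     25)) (Cut 11 24)) (Branch (Cut 27 18) (Cut 11 23))) (Cut 11 22))) (Branch (Branch (Cut 10 23) (Cut 9
     22)) (Cut 9 21))) (Cut 7 22))) (Branch (Branch (Branch (Branch (Branch (Cut 40 14) (Cut 34 16)) (Cut
     8 23)) (Branch (Branch (Cut 26 17) (Cut 20 18)) (Cut 6 23))) (Branch (Branch (Cut 10 22) (Cut 10
     21)) (Cut 6 22))) (Cut 6 21))) (Branch (Branch (Branch (Cut 5 23) (Cut 5 22)) (Cut 5 21)) (Cut 5
     20))) (Branch (Branch (Branch (Branch (Cut 57 7) (Cut 10 20)) (Cut 10 19)) (Cut 6 20)) (Branch (Cut
     10 18) (Cut 5 19)))) (Cut 5 18)) (Branch (Branch (Branch (Branch (Branch (Cut 33 13) (Cut 19 15))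
     (Cut 16 16)) (Cut 4 20)) (Branch (Cut 3 20) (Cut 2 20))) (Cut 1 20))) (Cut 0 20))) (Branch (Branch
     (Branch (Branch (Branch (Branch (Branch (Branch (Branch (Branch (Branch (Branch (Branch (Branch
     (Branch (Cut 30 19) (Cut 14 25)) (Cut 12 25)) (Cut 12 24)) (Branch (Branch (Cut 14 24) (Cut 14 23))
     (Cut 12 23))) (Branch (Cut 14 22) (Cut 12 22))) (Cut 12 21)) (Branch (Branch (Cut 14 21) (Cut 14
     20)) (Cut 12 20))) (Cut 12 19)) (Branch (Branch (Branch (Branch (Branch (Branch (Cut 23 20) (Cut 23
     19)) (Cut 23 18)) (Branch (Cut 27 17) (Cut 23 17))) (Cut 11 21)) (Branch (Branch (Cut 27 16) (Cut 14
     19)) (Cut 9 20))) (Cut 7 21))) (Branch (Branch (Branch (Branch (Cut 26 16) (Cut 20 17)) (Cut 11 20))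
     (Branch (Branch (Cut 26 15) (Cut 14 18)) (Cut 9 19))) (Cut 7 20))) (Branch (Branch (Cut 11 19) (Cut
     9 18)) (Cut 7 19))) (Branch (Branch (Branch (Branch (Cut 72 4) (Cut 14 17)) (Cut 14 16)) (Cut 6 19))
     (Branch (Cut 9 17) (Cut 6 18)))) (Cut 5 17)) (Branch (Branch (Branch (Branch (Branch (Cut 72 3) (Cut
     19 14)) (Cut 14 15)) (Cut 4 19)) (Branch (Cut 3 19) (Cut 2 19))) (Cut 1 19))) (Cut 0 19))) (Branch
     (Branch (Branch (Branch (Branch (Branch (Branch (Branch (Branch (Branch (Branch (Branch (Branch
     (Branch (Branch (Branch (Cut 21 24) (Cut 21 23)) (Cut 21 22)) (Cut 18 22)) (Branch (Branch (Cut 35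
     16) (Cut 21 21)) (Cut 18 21))) (Branch (Cut 21 20) (Cut 18 20))) (Cut 17 19)) (Branch (Branch
     (Branch (Branch (Cut 28 19) (Cut 28 18)) (Cut 28 17)) (Branch (Cut 21 19) (Cut 18 19))) (Cut 17
     18))) (Branch (Branch (Cut 21 18) (Cut 18 18)) (Cut 17 17))) (Cut 17 16)) (Branch (Branch (Branch
     (Branch (Branch (Cut 46 12) (Cut 34 15)) (Cut 8 22)) (Branch (Branch (Cut 58 8) (Cut 34 14)) (Cut 8
     21))) (Branch (Branch (Cut 21 17) (Cut 18 17)) (Cut 8 20))) (Cut 8 19))) (Branch (Branch (Branch
     (Cut 68 5) (Cut 68 4)) (Cut 68 3)) (Cut 8 18))) (Branch (Branch (Branch (Branch (Cut 21 16) (Cut 18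
     16)) (Cut 18 15)) (Cut 18 14)) (Branch (Cut 10 17) (Cut 8 17)))) (Cut 8 16)) (Branch (Branch (Branch
     (Branch (Branch (Cut 33 12) (Cut 33 11)) (Cut 16 15)) (Cut 16 14)) (Branch (Cut 10 16) (Cut 10 15)))
     (Cut 8 15))) (Cut 90 0)) (Branch (Branch (Branch (Branch (Branch (Branch (Branch (Branch (Branch
     (Branch (Branch (Branch (Cut 30 18) (Cut 30 17)) (Cut 28 16)) (Branch (Cut 30 16) (Cut 23 16))) (Cut
     23 15)) (Branch (Branch (Cut 27 15) (Cut 27 14)) (Cut 23 14))) (Cut 17 15)) (Branch (Branch (Branch
     (Branch (Cut 30 15) (Cut 20 16)) (Cut 20 15)) (Branch (Branch (Cut 26 14) (Cut 26 13)) (Cut 20 14)))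
     (Cut 17 14))) (Branch (Branch (Cut 11 18) (Cut 11 17)) (Cut 7 18))) (Branch (Branch (Branch (Branch
     (Cut 21 15) (Cut 21 14)) (Cut 20 13)) (Cut 17 13)) (Branch (Cut 9 16) (Cut 6 17)))) (Cut 5 16))
     (Branch (Branch (Branch (Branch (Branch (Cut 72 2) (Cut 19 13)) (Cut 14 14)) (Cut 4 18)) (Branch
     (Cut 3 18) (Cut 2 18))) (Cut 1 18))) (Cut 0 18)))) (Branch (Branch (Branch (Branch (Branch (Branch
     (Branch (Branch (Branch (Branch (Branch (Branch (Cut 35 15) (Cut 35 14)) (Cut 28 15)) (Branch (Cut
     35 13) (Cut 28 14))) (Cut 28 13)) (Branch (Branch (Cut 35 12) (Cut 27 13)) (Cut 23 13))) (Cut 23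
     12)) (Branch (Branch (Branch (Branch (Cut 30 14) (Cut 30 13)) (Cut 28 12)) (Branch (Branch (Cut 35
     11) (Cut 26 12)) (Cut 26 11))) (Cut 23 11))) (Branch (Branch (Cut 28 11) (Cut 11 16)) (Cut 7 17)))
     (Branch (Branch (Branch (Branch (Cut 35 10) (Cut 35 9)) (Cut 20 12)) (Cut 17 12)) (Branch (Cut 9 15)
     (Cut 6 16)))) (Cut 5 15)) (Branch (Branch (Branch (Branch (Branch (Cut 72 1) (Cut 19 12)) (Cut 14
     13)) (Cut 4 17)) (Branch (Cut 3 17) (Cut 2 17))) (Cut 1 17))) (Cut 0 17))) (Branch (Branch (Branch
     (Branch (Branch (Branch (Cut 72 0) (Cut 19 11)) (Cut 19 10)) (Cut 4 16)) (Branch (Cut 3 16) (Cut 2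
     16))) (Cut 1 16)) (Cut 0 16))) (Branch (Branch (Branch (Branch (Branch (Branch (Branch (Branch
     (Branch (Branch (Branch (Branch (Branch (Branch (Branch (Branch (Branch (Branch (Branch (Branch
     (Branch (Cut 15 28) (Cut 15 27)) (Cut 15 26)) (Cut 15 25)) (Branch (Cut 24 22) (Cut 15 24))) (Cut 15
     23)) (Cut 15 22)) (Branch (Branch (Branch (Cut 24 21) (Cut 24 20)) (Cut 24 19)) (Cut 15 21)))
     (Branch (Cut 24 18) (Cut 15 20))) (Cut 15 19)) (Branch (Branch (Branch (Branch (Branch (Branch (Cut
     29 20) (Cut 29 19)) (Cut 29 18)) (Cut 29 17)) (Branch (Branch (Cut 36 16) (Cut 36 15)) (Cut 29 16)))
     (Branch (Cut 24 17) (Cut 24 16))) (Cut 15 18))) (Branch (Branch (Branch (Branch (Cut 41 14) (Cut 41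
     13)) (Branch (Cut 36 14) (Cut 29 15))) (Branch (Cut 36 13) (Cut 24 15))) (Cut 15 17))) (Branch
     (Branch (Branch (Cut 41 12) (Cut 29 14)) (Cut 74 3)) (Cut 15 16))) (Branch (Branch (Branch (Cut 36
     12) (Cut 24 14)) (Cut 24 13)) (Branch (Cut 74 2) (Cut 15 15)))) (Cut 91 0)) (Branch (Branch (Branch
     (Branch (Cut 36 11) (Cut 36 10)) (Cut 65 4)) (Branch (Cut 81 1) (Cut 15 14))) (Cut 65 3))) (Cut 65
     2)) (Branch (Branch (Branch (Branch (Branch (Branch (Branch (Branch (Branch (Branch (Branch (Branch
     (Branch (Branch (Branch (Cut 22 23) (Cut 22 22)) (Cut 22 21)) (Branch (Cut 13 25) (Cut 13 24))) (Cut
     13 23)) (Cut 13 22)) (Branch (Branch (Branch (Cut 31 19) (Cut 31 18)) (Cut 31 17)) (Cut 13 21)))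
     (Branch (Cut 31 16) (Cut 13 20))) (Cut 13 19)) (Branch (Branch (Branch (Branch (Branch (Branch (Cut
     22 20) (Cut 22 19)) (Cut 22 18)) (Cut 22 17)) (Branch (Branch (Cut 42 14) (Cut 42 13)) (Cut 22 16)))
     (Branch (Cut 31 15) (Cut 22 15))) (Cut 13 18))) (Branch (Branch (Branch (Branch (Cut 40 13) (Cut 40
     12)) (Branch (Cut 42 12) (Cut 40 11))) (Branch (Cut 31 14) (Cut 22 14))) (Cut 13 17))) (Branch
     (Branch (Branch (Cut 41 11) (Cut 29 13)) (Cut 22 13)) (Cut 13 16))) (Branch (Branch (Branch (Cut 31
     13) (Cut 31 12)) (Cut 24 12)) (Branch (Cut 22 12) (Cut 13 15)))) (Cut 13 14)) (Branch (Branch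
     (Branch (Branch (Cut 57 6) (Cut 36 9)) (Cut 82 1)) (Branch (Cut 22 11) (Cut 15 13))) (Cut 13 13)))
     (Cut 65 1))) (Branch (Branch (Branch (Branch (Branch (Branch (Branch (Branch (Branch (Branch (Branch
     (Branch (Cut 37 16) (Cut 37 15)) (Cut 37 14)) (Cut 37 13)) (Branch (Cut 45 11) (Cut 37 12))) (Cut 12
     18)) (Branch (Branch (Branch (Branch (Cut 47 12) (Cut 47 11)) (Cut 47 10)) (Branch (Cut 45 10) (Cut
     37 11))) (Cut 12 17))) (Branch (Branch (Branch (Cut 42 11) (Cut 40 10)) (Branch (Cut 42 10) (Cut 40
     9))) (Cut 12 16))) (Branch (Branch (Cut 29 12) (Cut 29 11)) (Cut 12 15))) (Branch (Branch (Branch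
     (Cut 42 9) (Cut 31 11)) (Cut 24 11)) (Branch (Cut 29 10) (Cut 12 14)))) (Cut 12 13)) (Branch (Branch
     (Branch (Branch (Cut 42 8) (Cut 92 0)) (Cut 82 0)) (Branch (Cut 22 10) (Cut 15 12))) (Cut 12 12)))
     (Cut 12 11))) (Branch (Branch (Branch (Branch (Branch (Branch (Branch (Branch (Branch (Branch
     (Branch (Branch (Branch (Cut 38 15) (Cut 38 14)) (Cut 38 13)) (Cut 38 12)) (Branch (Branch (Cut 48
     12) (Cut 48 11)) (Cut 38 11))) (Branch (Cut 48 10) (Cut 38 10))) (Cut 38 9)) (Branch (Branch (Branch
     (Branch (Cut 46 11) (Cut 46 10)) (Branch (Cut 34 13) (Cut 34 12))) (Branch (Cut 48 9) (Cut 34 11)))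
     (Cut 34 10))) (Branch (Branch (Branch (Cut 41 10) (Cut 41 9)) (Cut 41 8)) (Cut 34 9))) (Branch
     (Branch (Branch (Cut 48 8) (Cut 48 7)) (Cut 18 13)) (Branch (Cut 68 2) (Cut 18 12)))) (Cut 18 11))
     (Branch (Branch (Branch (Branch (Cut 33 10) (Cut 33 9)) (Cut 16 13)) (Branch (Cut 81 0) (Cut 10
     14))) (Cut 8 14))) (Cut 65 0)) (Branch (Branch (Branch (Branch (Branch (Branch (Branch (Branch
     (Branch (Branch (Cut 51 11) (Cut 51 10)) (Cut 47 9)) (Branch (Cut 45 9) (Cut 37 10))) (Cut 37 9))
     (Branch (Branch (Branch (Cut 51 9) (Cut 47 8)) (Branch (Cut 45 8) (Cut 40 8))) (Cut 40 7))) (Branch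
     (Branch (Cut 93 0) (Cut 41 7)) (Cut 34 8))) (Branch (Branch (Branch (Cut 21 13) (Cut 21 12)) (Cut 21
     11)) (Branch (Cut 29 9) (Cut 21 10)))) (Cut 18 10)) (Branch (Branch (Branch (Branch (Cut 42 7) (Cut
     33 8)) (Cut 16 12)) (Branch (Cut 22 9) (Cut 10 13))) (Cut 8 13))) (Cut 12 10)))) (Branch (Branch
     (Branch (Branch (Branch (Branch (Branch (Branch (Branch (Branch (Cut 59 8) (Cut 59 7)) (Cut 59 6))
     (Branch (Cut 27 12) (Cut 27 11))) (Cut 27 10)) (Branch (Branch (Branch (Cut 30 12) (Cut 30 11))
     (Branch (Cut 45 7) (Cut 26 10))) (Cut 23 10))) (Branch (Branch (Cut 28 10) (Cut 11 15)) (Cut 7 16)))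
     (Branch (Branch (Branch (Cut 35 8) (Cut 20 11)) (Cut 17 11)) (Branch (Cut 9 14) (Cut 6 15)))) (Cut 5
     14)) (Branch (Branch (Branch (Branch (Cut 35 7) (Cut 14 12)) (Cut 14 11)) (Branch (Cut 9 13) (Cut 6
     14))) (Cut 5 13))) (Cut 5 12))) (Branch (Branch (Branch (Branch (Branch (Cut 35 6) (Cut 19 9)) (Cut
     4 15)) (Branch (Cut 3 15) (Cut 2 15))) (Cut 1 15)) (Cut 0 15)))) (Branch (Branch (Branch (Branch
     (Branch (Branch (Branch (Branch (Branch (Branch (Branch (Branch (Branch (Branch (Branch (Branch
     (Branch (Branch (Branch (Cut 25 21) (Cut 25 20)) (Cut 25 19)) (Branch (Cut 32 18) (Cut 25 18))) (Cut
     25 17)) (Cut 25 16)) (Branch (Branch (Branch (Cut 32 17) (Cut 32 16)) (Cut 32 15)) (Cut 25 15)))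
     (Branch (Cut 32 14) (Cut 25 14))) (Cut 25 13)) (Branch (Branch (Branch (Branch (Branch (Branch (Cut
     39 15) (Cut 39 14)) (Cut 39 13)) (Cut 39 12)) (Branch (Branch (Cut 49 12) (Cut 49 11)) (Cut 39 11)))
     (Branch (Cut 32 13) (Cut 32 12))) (Cut 25 12))) (Branch (Branch (Branch (Branch (Cut 53 10) (Cut 53
     9)) (Branch (Cut 49 10) (Cut 39 10))) (Branch (Cut 49 9) (Cut 32 11))) (Cut 25 11))) (Branch (Branch
     (Branch (Cut 53 8) (Cut 39 9)) (Cut 32 10)) (Cut 25 10))) (Branch (Branch (Branch (Cut 49 8) (Cut 78
     2)) (Cut 78 1)) (Branch (Cut 32 9) (Cut 25 9)))) (Cut 25 8)) (Branch (Branch (Branch (Branch (Cut 57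
     5) (Cut 36 8)) (Cut 78 0)) (Branch (Cut 32 8) (Cut 32 7))) (Cut 13 12))) (Cut 32 6)) (Branch (Branch
     (Branch (Branch (Branch (Branch (Branch (Branch (Branch (Branch (Branch (Branch (Cut 43 13) (Cut 43
     12)) (Cut 43 11)) (Cut 43 10)) (Branch (Cut 60 8) (Cut 43 9))) (Cut 75 3)) (Branch (Branch (Branch
     (Branch (Cut 54 10) (Cut 54 9)) (Cut 54 8)) (Branch (Cut 60 7) (Cut 43 8))) (Cut 75 2))) (Branch
     (Branch (Branch (Cut 56 8) (Cut 69 5)) (Branch (Cut 56 7) (Cut 43 7))) (Cut 75 1))) (Branch (Branch
     (Cut 39 8) (Cut 39 7)) (Cut 39 6))) (Branch (Branch (Branch (Cut 49 7) (Cut 31 10)) (Cut 24 10))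
     (Branch (Cut 74 1) (Cut 24 9)))) (Cut 25 7)) (Branch (Branch (Branch (Branch (Cut 57 4) (Cut 57 3))
     (Cut 57 2)) (Branch (Cut 74 0) (Cut 15 11))) (Cut 13 11))) (Cut 32 5))) (Branch (Branch (Branch
     (Branch (Branch (Branch (Branch (Branch (Branch (Branch (Branch (Branch (Branch (Cut 44 13) (Cut 44
     12)) (Cut 44 11)) (Cut 44 10)) (Branch (Branch (Cut 55 10) (Cut 55 9)) (Cut 44 9))) (Branch (Cut 55
     8) (Cut 44 8))) (Cut 38 8)) (Branch (Branch (Branch (Branch (Cut 66 6) (Cut 46 9)) (Branch (Cut 58
     7) (Cut 46 8))) (Branch (Cut 55 7) (Cut 44 7))) (Cut 38 7))) (Branch (Branch (Branch (Cut 53 7) (Cut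
     46 7)) (Cut 44 6)) (Cut 38 6))) (Branch (Branch (Branch (Cut 55 6) (Cut 48 6)) (Cut 48 5)) (Branch
     (Cut 44 5) (Cut 38 5)))) (Cut 38 4)) (Branch (Branch (Branch (Branch (Cut 55 5) (Cut 36 7)) (Cut 48
     4)) (Branch (Cut 36 6) (Cut 48 3))) (Cut 38 3))) (Cut 38 2)) (Branch (Branch (Branch (Branch (Branch
     (Branch (Branch (Branch (Branch (Branch (Cut 61 8) (Cut 61 7)) (Cut 54 7)) (Branch (Cut 60 6) (Cut
     54 6))) (Cut 37 8)) (Branch (Branch (Branch (Cut 51 8) (Cut 47 7)) (Branch (Cut 56 6) (Cut 43 6)))
     (Cut 40 6))) (Branch (Branch (Cut 46 6) (Cut 41 6)) (Cut 34 7))) (Branch (Branch (Branch (Cut 49 6)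
     (Cut 31 9)) (Cut 31 8)) (Branch (Cut 29 8) (Cut 21 9)))) (Cut 18 9)) (Branch (Branch (Branch (Branch
     (Cut 42 6) (Cut 33 7)) (Cut 16 11)) (Branch (Cut 22 8) (Cut 10 12))) (Cut 8 12))) (Cut 12 9))))
     (Branch (Branch (Branch (Branch (Branch (Branch (Branch (Branch (Branch (Branch (Cut 67 6) (Cut 61
     6)) (Cut 59 5)) (Branch (Cut 60 5) (Cut 54 5))) (Cut 27 9)) (Branch (Branch (Branch (Cut 83 1) (Cut
     30 10)) (Branch (Cut 45 6) (Cut 26 9))) (Cut 23 9))) (Branch (Branch (Cut 28 9) (Cut 11 14)) (Cut 7
     15))) (Branch (Branch (Branch (Cut 45 5) (Cut 20 10)) (Cut 17 10)) (Branch (Cut 11 13) (Cut 7 14))))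
     (Cut 18 8)) (Branch (Branch (Branch (Branch (Cut 42 5) (Cut 33 6)) (Cut 14 10)) (Branch (Cut 9 12)
     (Cut 6 13))) (Cut 6 12))) (Cut 5 11))) (Branch (Branch (Branch (Branch (Branch (Cut 35 5) (Cut 19
     8)) (Cut 4 14)) (Branch (Cut 3 14) (Cut 2 14))) (Cut 1 14)) (Cut 0 14)))) (Branch (Branch (Branch
     (Branch (Branch (Branch (Branch (Branch (Branch (Branch (Branch (Branch (Branch (Branch (Branch (Cut
     52 11) (Cut 52 10)) (Cut 52 9)) (Cut 52 8)) (Branch (Cut 63 7) (Cut 52 7))) (Cut 52 6)) (Branch
     (Branch (Branch (Branch (Cut 62 8) (Cut 62 7)) (Cut 62 6)) (Branch (Cut 63 6) (Cut 62 5))) (Cut 52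
     5))) (Branch (Branch (Branch (Cut 73 4) (Cut 69 4)) (Branch (Cut 63 5) (Cut 63 4))) (Cut 52 4)))
     (Branch (Branch (Cut 69 3) (Cut 69 2)) (Cut 39 5))) (Branch (Branch (Branch (Cut 84 1) (Cut 63 3))
     (Cut 52 3)) (Branch (Cut 69 1) (Cut 24 8)))) (Cut 25 6)) (Branch (Branch (Branch (Branch (Cut 84 0)
     (Cut 63 2)) (Cut 57 1)) (Branch (Cut 69 0) (Cut 15 10))) (Cut 13 10))) (Cut 32 4)) (Branch (Branch
     (Branch (Branch (Branch (Branch (Branch (Branch (Branch (Branch (Cut 70 5) (Cut 70 4)) (Cut 85 1))
     (Branch (Cut 70 3) (Cut 85 0))) (Cut 37 7)) (Branch (Branch (Branch (Cut 73 3) (Cut 47 6)) (Branch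
     (Cut 70 2) (Cut 43 5))) (Cut 40 5))) (Branch (Branch (Cut 46 5) (Cut 41 5)) (Cut 34 6))) (Branch
     (Branch (Branch (Cut 49 5) (Cut 43 4)) (Cut 31 7)) (Branch (Cut 43 3) (Cut 21 8)))) (Cut 25 5))
     (Branch (Branch (Branch (Branch (Cut 70 1) (Cut 63 1)) (Cut 16 10)) (Branch (Cut 43 2) (Cut 10 11)))
     (Cut 8 11))) (Cut 12 8))) (Branch (Branch (Branch (Branch (Branch (Branch (Branch (Branch (Branch
     (Branch (Cut 67 5) (Cut 61 5)) (Cut 59 4)) (Branch (Cut 60 4) (Cut 54 4))) (Cut 27 8)) (Branch
     (Branch (Branch (Cut 73 2) (Cut 59 3)) (Branch (Cut 60 3) (Cut 26 8))) (Cut 23 8))) (Branch (Branch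
     (Cut 28 8) (Cut 26 7)) (Cut 23 7))) (Branch (Branch (Branch (Cut 45 4) (Cut 45 3)) (Cut 17 9))
     (Branch (Cut 11 12) (Cut 7 13)))) (Cut 18 7)) (Branch (Branch (Branch (Branch (Cut 42 4) (Cut 45 2))
     (Cut 14 9)) (Branch (Cut 9 11) (Cut 7 12))) (Cut 6 11))) (Cut 5 10))) (Branch (Branch (Branch
     (Branch (Branch (Cut 42 3) (Cut 19 7)) (Cut 4 13)) (Branch (Cut 3 13) (Cut 2 13))) (Cut 1 13)) (Cut
     0 13)))) (Branch (Branch (Branch (Branch (Branch (Branch (Branch (Branch (Branch (Branch (Branch
     (Branch (Branch (Branch (Branch (Branch (Cut 50 12) (Cut 50 11)) (Cut 50 10)) (Cut 50 9)) (Branch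
     (Branch (Cut 64 7) (Cut 64 6)) (Cut 50 8))) (Branch (Cut 64 5) (Cut 50 7))) (Cut 79 2)) (Branch
     (Branch (Branch (Branch (Cut 66 5) (Cut 66 4)) (Branch (Cut 58 6) (Cut 86 1))) (Branch (Cut 58 5)
     (Cut 50 6))) (Cut 79 1))) (Branch (Branch (Branch (Cut 53 6) (Cut 53 5)) (Cut 50 5)) (Cut 79 0)))
     (Branch (Branch (Branch (Cut 58 4) (Cut 58 3)) (Cut 58 2)) (Branch (Cut 44 4) (Cut 44 3)))) (Cut 44
     2)) (Branch (Branch (Branch (Branch (Cut 55 4) (Cut 77 1)) (Cut 58 1)) (Branch (Cut 36 5) (Cut 48
     2))) (Cut 44 1))) (Cut 38 1)) (Branch (Branch (Branch (Branch (Branch (Branch (Branch (Branch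
     (Branch (Branch (Cut 71 5) (Cut 71 4)) (Cut 80 2)) (Branch (Cut 64 4) (Cut 64 3))) (Cut 64 2))
     (Branch (Branch (Branch (Cut 51 7) (Cut 51 6)) (Branch (Cut 56 5) (Cut 56 4))) (Cut 56 3))) (Branch
     (Branch (Cut 51 5) (Cut 50 4)) (Cut 56 2))) (Branch (Branch (Branch (Cut 94 0) (Cut 86 0)) (Cut 75
     0)) (Branch (Cut 29 7) (Cut 29 6)))) (Cut 29 5)) (Branch (Branch (Branch (Branch (Cut 55 3) (Cut 77
     0)) (Cut 58 0)) (Branch (Cut 22 7) (Cut 22 6))) (Cut 22 5))) (Cut 22 4))) (Branch (Branch (Branch
     (Branch (Branch (Branch (Branch (Branch (Branch (Branch (Cut 87 1) (Cut 71 3)) (Cut 80 1)) (Branch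
     (Cut 71 2) (Cut 80 0))) (Cut 64 1)) (Branch (Branch (Branch (Cut 83 0) (Cut 30 9)) (Branch (Cut 71
     1) (Cut 30 8))) (Cut 30 7))) (Branch (Branch (Cut 51 4) (Cut 50 3)) (Cut 30 6))) (Branch (Branch
     (Branch (Cut 71 0) (Cut 20 9)) (Cut 20 8)) (Branch (Cut 50 2) (Cut 20 7)))) (Cut 20 6)) (Branch
     (Branch (Branch (Branch (Cut 55 2) (Cut 33 5)) (Cut 33 4)) (Branch (Cut 50 1) (Cut 33 3))) (Cut 33
     2))) (Cut 22 3))) (Branch (Branch (Branch (Branch (Branch (Cut 35 4) (Cut 35 3)) (Cut 35 2)) (Branch
     (Cut 50 0) (Cut 35 1))) (Cut 33 1)) (Cut 33 0))) (Branch (Branch (Branch (Branch (Branch (Branch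
     (Branch (Branch (Branch (Branch (Branch (Branch (Cut 76 3) (Cut 76 2)) (Cut 76 1)) (Branch (Cut 88
     1) (Cut 76 0))) (Cut 37 6)) (Branch (Branch (Branch (Cut 95 0) (Cut 47 5)) (Branch (Cut 88 0) (Cut
     47 4))) (Cut 47 3))) (Branch (Branch (Cut 46 4) (Cut 41 4)) (Cut 34 5))) (Branch (Branch (Branch
     (Cut 49 4) (Cut 49 3)) (Cut 31 6)) (Branch (Cut 49 2) (Cut 21 7)))) (Cut 25 4)) (Branch (Branch
     (Branch (Branch (Cut 70 0) (Cut 63 0)) (Cut 16 9)) (Branch (Cut 43 1) (Cut 10 10))) (Cut 8 10)))
     (Cut 12 7)) (Branch (Branch (Branch (Branch (Branch (Branch (Branch (Branch (Branch (Branch (Cut 67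
     4) (Cut 61 4)) (Cut 61 3)) (Branch (Cut 87 0) (Cut 54 3))) (Cut 27 7)) (Branch (Branch (Branch (Cut
     73 1) (Cut 59 2)) (Branch (Cut 60 2) (Cut 54 2))) (Cut 27 6))) (Branch (Branch (Cut 28 7) (Cut 26
     6)) (Cut 23 6))) (Branch (Branch (Branch (Cut 60 1) (Cut 54 1)) (Cut 17 8)) (Branch (Cut 11 11) (Cut
     11 10)))) (Cut 11 9)) (Branch (Branch (Branch (Branch (Cut 55 1) (Cut 45 1)) (Cut 14 8)) (Branch
     (Cut 9 10) (Cut 7 11))) (Cut 6 10))) (Cut 5 9))) (Branch (Branch (Branch (Branch (Branch (Cut 42 2)
     (Cut 19 6)) (Cut 4 12)) (Branch (Cut 3 12) (Cut 2 12))) (Cut 1 12)) (Cut 0 12))))) (Branch (Branch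
     (Branch (Branch (Branch (Branch (Branch (Branch (Branch (Branch (Branch (Cut 67 3) (Cut 67 2)) (Cut
     61 2)) (Branch (Cut 67 1) (Cut 61 1))) (Cut 61 0)) (Branch (Branch (Branch (Cut 73 0) (Cut 59 1))
     (Branch (Cut 67 0) (Cut 59 0))) (Cut 27 5))) (Branch (Branch (Cut 28 6) (Cut 26 5)) (Cut 23 5)))
     (Branch (Branch (Branch (Cut 60 0) (Cut 54 0)) (Cut 17 7)) (Branch (Cut 26 4) (Cut 17 6)))) (Cut 11
     8)) (Branch (Branch (Branch (Branch (Cut 55 0) (Cut 45 0)) (Cut 14 7)) (Branch (Cut 26 3) (Cut 7
     10))) (Cut 6 9))) (Cut 5 8)) (Branch (Branch (Branch (Branch (Branch (Cut 42 1) (Cut 19 5)) (Cut 4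
     11)) (Branch (Cut 3 11) (Cut 2 11))) (Cut 1 11)) (Cut 0 11)))) (Branch (Branch (Branch (Branch
     (Branch (Cut 42 0) (Cut 19 4)) (Cut 4 10)) (Branch (Cut 19 3) (Cut 2 10))) (Cut 1 10)) (Cut 0 10)))
     (Branch (Branch (Branch (Branch (Branch (Branch (Branch (Branch (Branch (Branch (Branch (Branch
     (Branch (Cut 66 3) (Cut 53 4)) (Cut 53 3)) (Cut 53 2)) (Branch (Cut 68 1) (Cut 53 1))) (Cut 53 0))
     (Branch (Branch (Cut 36 4) (Cut 48 1)) (Cut 44 0))) (Cut 38 0)) (Branch (Branch (Branch (Branch
     (Branch (Branch (Cut 66 2) (Cut 66 1)) (Cut 56 1)) (Branch (Cut 68 0) (Cut 56 0))) (Cut 29 4))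
     (Branch (Branch (Cut 36 3) (Cut 48 0)) (Cut 29 3))) (Cut 29 2))) (Branch (Branch (Branch (Branch
     (Branch (Branch (Cut 51 3) (Cut 51 2)) (Cut 30 5)) (Branch (Cut 51 1) (Cut 30 4))) (Cut 20 5))
     (Branch (Branch (Cut 36 2) (Cut 30 3)) (Cut 30 2))) (Cut 22 2))) (Branch (Branch (Branch (Cut 36 1)
     (Cut 35 0)) (Cut 30 1)) (Cut 30 0))) (Branch (Branch (Branch (Branch (Branch (Branch (Branch (Branch
     (Cut 46 3) (Cut 41 3)) (Cut 41 2)) (Branch (Cut 49 1) (Cut 21 6))) (Cut 25 3)) (Branch (Branch (Cut
     49 0) (Cut 10 9)) (Cut 8 9))) (Cut 29 1)) (Branch (Branch (Branch (Branch (Branch (Branch (Cut 46 2)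
     (Cut 66 0)) (Cut 41 1)) (Branch (Cut 51 0) (Cut 21 5))) (Cut 20 4)) (Branch (Branch (Cut 9 9) (Cut 9
     8)) (Cut 8 8))) (Cut 22 1))) (Branch (Branch (Branch (Cut 36 0) (Cut 9 7)) (Cut 9 6)) (Cut 9 5))))
     (Branch (Branch (Branch (Branch (Branch (Branch (Branch (Cut 28 5) (Cut 28 4)) (Cut 23 4)) (Branch
     (Cut 28 3) (Cut 17 5))) (Cut 11 7)) (Branch (Branch (Cut 26 2) (Cut 7 9)) (Cut 6 8))) (Cut 5 7))
     (Branch (Branch (Branch (Cut 3 10) (Cut 3 9)) (Cut 3 8)) (Cut 3 7)))) (Branch (Branch (Branch (Cut
     19 2) (Cut 2 9)) (Cut 1 9)) (Cut 0 9)))) (Branch (Branch (Branch (Branch (Branch (Branch (Branch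
     (Branch (Cut 46 1) (Cut 46 0)) (Cut 23 3)) (Branch (Cut 28 2) (Cut 17 4))) (Cut 11 6)) (Branch
     (Branch (Cut 28 1) (Cut 7 8)) (Cut 6 7))) (Cut 5 6)) (Branch (Branch (Branch (Cut 28 0) (Cut 7 7))
     (Cut 6 6)) (Cut 3 6))) (Branch (Branch (Branch (Cut 19 1) (Cut 2 8)) (Cut 1 8)) (Cut 0 8)))) (Branch
     (Branch (Branch (Cut 19 0) (Cut 2 7)) (Cut 1 7)) (Cut 0 7))) (Branch (Branch (Branch (Branch (Branch
     (Branch (Branch (Branch (Branch (Branch (Branch (Branch (Branch (Branch (Branch (Branch (Cut 89 1)
     (Cut 62 4)) (Cut 89 0)) (Cut 39 4)) (Branch (Cut 52 2) (Cut 24 7))) (Cut 52 1)) (Branch (Branch (Cut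
     57 0) (Cut 15 9)) (Cut 13 9))) (Cut 32 3)) (Branch (Branch (Branch (Branch (Branch (Branch (Cut 62
     3) (Cut 40 4)) (Cut 39 3)) (Branch (Cut 40 3) (Cut 24 6))) (Cut 52 0)) (Branch (Branch (Cut 40 2)
     (Cut 15 8)) (Cut 13 8))) (Cut 32 2))) (Branch (Branch (Branch (Branch (Branch (Branch (Cut 62 2)
     (Cut 62 1)) (Cut 39 2)) (Branch (Cut 62 0) (Cut 24 5))) (Cut 18 6)) (Branch (Branch (Cut 40 1) (Cut
     15 7)) (Cut 13 7))) (Cut 32 1))) (Branch (Branch (Branch (Cut 40 0) (Cut 15 6)) (Cut 13 6)) (Cut 32
     0))) (Branch (Branch (Branch (Branch (Branch (Branch (Branch (Branch (Cut 37 5) (Cut 47 2)) (Cut 34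
     4)) (Branch (Cut 31 5) (Cut 34 3))) (Cut 34 2)) (Branch (Branch (Cut 16 8) (Cut 43 0)) (Cut 34 1)))
     (Cut 12 6)) (Branch (Branch (Branch (Branch (Branch (Branch (Cut 37 4) (Cut 64 0)) (Cut 39 1))
     (Branch (Cut 31 4) (Cut 24 4))) (Cut 18 5)) (Branch (Branch (Cut 16 7) (Cut 39 0)) (Cut 34 0))) (Cut
     12 5))) (Branch (Branch (Branch (Cut 16 6) (Cut 15 5)) (Cut 13 5)) (Cut 12 4)))) (Branch (Branch
     (Branch (Branch (Branch (Branch (Branch (Cut 37 3) (Cut 27 4)) (Cut 27 3)) (Branch (Cut 31 3) (Cut
     24 3))) (Cut 18 4)) (Branch (Branch (Cut 14 6) (Cut 14 5)) (Cut 14 4))) (Cut 14 3)) (Branch (Branch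
     (Branch (Cut 16 5) (Cut 15 4)) (Cut 13 4)) (Cut 12 3)))) (Branch (Branch (Branch (Cut 4 9) (Cut 4
     8)) (Cut 4 7)) (Cut 12 2))) (Branch (Branch (Branch (Branch (Branch (Branch (Branch (Branch (Cut 47
     1) (Cut 47 0)) (Cut 25 2)) (Branch (Cut 10 8) (Cut 25 1))) (Cut 29 0)) (Branch (Branch (Branch
     (Branch (Cut 41 0) (Cut 21 4)) (Cut 20 3)) (Branch (Cut 10 7) (Cut 8 7))) (Cut 22 0))) (Branch
     (Branch (Cut 10 6) (Cut 25 0)) (Cut 9 4))) (Branch (Branch (Branch (Branch (Branch (Cut 27 2) (Cut
     21 3)) (Cut 20 2)) (Branch (Cut 26 1) (Cut 8 6))) (Cut 14 2)) (Branch (Branch (Cut 10 5) (Cut 13 3))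
     (Cut 9 3)))) (Branch (Branch (Cut 26 0) (Cut 4 6)) (Cut 9 2)))) (Branch (Branch (Branch (Branch
     (Branch (Branch (Cut 23 2) (Cut 17 3)) (Cut 11 5)) (Branch (Cut 17 2) (Cut 8 5))) (Cut 5 5)) (Branch
     (Branch (Cut 7 6) (Cut 6 5)) (Cut 3 5))) (Branch (Branch (Cut 7 5) (Cut 4 5)) (Cut 3 4)))) (Branch
     (Branch (Cut 2 6) (Cut 1 6)) (Cut 0 6)))) (Branch (Branch (Branch (Branch (Branch (Branch (Branch
     (Branch (Branch (Branch (Branch (Cut 37 2) (Cut 37 1)) (Cut 37 0)) (Branch (Cut 31 2) (Cut 24 2)))
     (Cut 18 3)) (Branch (Branch (Cut 31 1) (Cut 24 1)) (Cut 18 2))) (Cut 18 1)) (Branch (Branch (Branch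
     (Cut 16 4) (Cut 15 3)) (Cut 15 2)) (Cut 18 0))) (Branch (Branch (Branch (Cut 16 3) (Cut 16 2)) (Cut
     15 1)) (Cut 12 1))) (Branch (Branch (Branch (Branch (Branch (Branch (Cut 27 1) (Cut 21 2)) (Cut 20
     1)) (Branch (Cut 27 0) (Cut 20 0))) (Cut 14 1)) (Branch (Branch (Cut 10 4) (Cut 13 2)) (Cut 14 0)))
     (Branch (Branch (Cut 16 1) (Cut 13 1)) (Cut 9 1)))) (Branch (Branch (Branch (Branch (Branch (Branch
     (Cut 23 1) (Cut 21 1)) (Cut 11 4)) (Branch (Cut 17 1) (Cut 8 4))) (Cut 5 4)) (Branch (Branch (Cut 10
     3) (Cut 6 4)) (Cut 5 3))) (Branch (Branch (Cut 7 4) (Cut 4 4)) (Cut 3 3)))) (Branch (Branch (Cut 2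
     5) (Cut 1 5)) (Cut 0 5)))) (Branch (Branch (Branch (Branch (Branch (Branch (Cut 31 0) (Cut 24 0))
     (Cut 15 0)) (Cut 12 0)) (Branch (Branch (Cut 16 0) (Cut 13 0)) (Cut 9 0))) (Branch (Branch (Cut 7 3)
     (Cut 4 3)) (Cut 3 2))) (Branch (Branch (Cut 7 2) (Cut 1 4)) (Cut 0 4)))) (Branch (Branch (Branch
     (Branch (Branch (Branch (Branch (Branch (Cut 23 0) (Cut 21 0)) (Cut 11 3)) (Branch (Cut 17 0) (Cut 8
     3))) (Cut 8 2)) (Branch (Branch (Cut 10 2) (Cut 6 3)) (Cut 5 2))) (Branch (Branch (Cut 10 1) (Cut 6
     2)) (Cut 5 1))) (Branch (Branch (Cut 2 4) (Cut 2 3)) (Cut 2 2))) (Branch (Branch (Branch (Cut 10 0)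
     (Cut 4 2)) (Cut 3 1)) (Branch (Branch (Cut 7 1) (Cut 1 3)) (Cut 0 3))))) (Branch (Branch (Cut 7 0)
     (Cut 1 2)) (Cut 0 2))) (Branch (Branch (Branch (Branch (Branch (Branch (Branch (Cut 11 2) (Cut 11
     1)) (Cut 8 1)) (Branch (Cut 11 0) (Cut 8 0))) (Branch (Cut 6 1) (Cut 5 0))) (Branch (Cut 6 0) (Cut 2
     1))) (Branch (Branch (Cut 4 1) (Cut 3 0)) (Branch (Cut 4 0) (Cut 2 0)))) (Branch (Cut 1 1) (Cut 0
     1)))) (Branch (Cut 1 0) (Cut 0 0))"

text \<open>The tree branches only where both truth values are possible; a forced
  \<open>False\<close> consumes no node. An accepted tree thus has one leaf per code, and the check
  never builds the list \<open>codes 3\<close>.\<close>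

fun covered :: "bool list list \<Rightarrow> bool list \<Rightarrow> cut_tree \<Rightarrow> bool" where
  "covered (r # rs) p (Branch u v) =
     (if imp r p then covered rs (True # p) u \<and> covered rs (False # p) v else covered rs (False # p) (Branch u v))"
| "covered (r # rs) p (Cut i t) = (if imp r p then False else covered rs (False # p) (Cut i t))"
| "covered [] p (Cut i t) = (i < 96 \<and> is_cut (cuts i) t p)"
| "covered [] p (Branch u v) = False"

lemma covered_extensions:
  "covered rs p T \<Longrightarrow> x \<in> set (extensions rs p) \<Longrightarrow> \<exists>i<96. \<exists>t. is_cut (cuts i) t x"
proof (induction rs arbitrary: p T)
  case Nil
  then show ?case by (cases T) auto
next
  case (Cons r rs)
  show ?case
  proof (cases T)
    case (Cut i t)
    with Cons.prems Cons.IH[of "False # p" T] show ?thesis by (auto split: if_splits)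
  next
    case (Branch u v)
    with Cons.prems Cons.IH[of "True # p" u] Cons.IH[of "False # p" v] Cons.IH[of "False # p" T]
    show ?thesis by (auto split: if_splits)
  qed
qed

section \<open>Counting the codes of a given rank above or below the pivot\<close>

fun count_codes :: "bool list list \<Rightarrow> bool option list \<Rightarrow> nat \<Rightarrow> bool list \<Rightarrow> nat" where
  "count_codes (r # rs) (None # cs) (Suc n) p =
     (if imp r p then count_codes rs cs n (True # p) + count_codes rs cs (Suc n) (False # p)
      else count_codes rs cs (Suc n) (False # p))"
| "count_codes (r # rs) (None # cs) 0 p = count_codes rs cs 0 (False # p)"
| "count_codes (r # rs) (Some True # cs) (Suc n) p = (if imp r p then count_codes rs cs n (True # p) else 0)"
| "count_codes (r # rs) (Some True # cs) 0 p = 0"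
| "count_codes (r # rs) (Some False # cs) n p = count_codes rs cs n (False # p)"
| "count_codes [] cs n p = (if n = 0 then 1 else 0)"
| "count_codes rs [] n p = 0"

definition agrees :: "bool option list \<Rightarrow> bool list \<Rightarrow> bool" where
  "agrees = list_all2 (\<lambda>c b. \<forall>b'. c = Some b' \<longrightarrow> b = b')"

definition rank :: "bool list \<Rightarrow> nat" where
  "rank p = length (filter id p)"

lemma rank_simps [simp]: "rank [] = 0" "rank (True # p) = Suc (rank p)" "rank (False # p) = rank p"
  by (simp_all add: rank_def)

lemma extensions_form: "x \<in> set (extensions rs p) \<Longrightarrow> \<exists>q. x = q @ p \<and> length q = length rs"
  using set_extensions[of "rev rs" p] by auto

lemma rank_append: "rank (p @ q) = rank p + rank q"
  by (simp add: rank_def)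

text \<open>Codes grow at the front, so constraints are consumed from the end of the code, hence
  \<open>rev cs\<close>. The part \<open>p\<close> already fixed is exempt from them but counts for
  the rank; \<open>n\<close> is the number of entries still to be made true, which prunes the
  search.\<close>

lemma count_codes_eq:
  assumes "length cs = length rs"
  shows "count_codes rs cs n p =
     length (filter (\<lambda>x. agrees (rev cs) (take (length rs) x) \<and> rank x = n + rank p) (extensions rs p))"
  using assms
proof (induction rs arbitrary: cs n p)
  case Nil
  then show ?case by (simp add: agrees_def)
next
  case (Cons r rs)
  then obtain c cs' where cs: "cs = c # cs'" "length cs' = length rs" by (cases cs) auto
  let ?P = "\<lambda>n p x. agrees (rev cs') (take (length rs) x) \<and> rank x = n + rank p"
  let ?Q = "\<lambda>x. agrees (rev cs) (take (length (r # rs)) x) \<and> rank x = n + rank p"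
  have step: "?Q x \<longleftrightarrow> (\<forall>b'. c = Some b' \<longrightarrow> b = b') \<and> agrees (rev cs') (take (length rs) x) \<and> rank x = n + rank p"
    if x: "x \<in> set (extensions rs (b # p))" for b x
  proof -
    obtain q where q: "x = q @ b # p" "length q = length rs" using extensions_form[OF x] by blast
    then have "length q = length (rev cs')" using cs by simp
    then have "agrees (rev cs) (q @ [b]) \<longleftrightarrow> agrees (rev cs') q \<and> (\<forall>b'. c = Some b' \<longrightarrow> b = b')"
      by (auto simp: agrees_def cs list_all2_append)
    then show ?thesis using q by auto
  qed
  have rank_ge: "rank x \<ge> rank (b # p)" if x: "x \<in> set (extensions rs (b # p))" for b x
    using extensions_form[OF x] by (auto simp: rank_append)
  have F: "length (filter ?Q (extensions rs (False # p))) =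
      (if c = Some True then 0 else count_codes rs cs' n (False # p))"
  proof (cases "c = Some True")
    case True
    then show ?thesis using step[of _ False] by (auto simp: filter_empty_conv)
  next
    case False
    then have "filter ?Q (extensions rs (False # p)) = filter (?P n (False # p)) (extensions rs (False # p))"
      using step[of _ False] by (intro filter_cong) auto
    then show ?thesis using False Cons.IH[OF cs(2), of n "False # p"] by simp
  qed
  have T: "length (filter ?Q (extensions rs (True # p))) =
      (if c = Some False \<or> n = 0 then 0 else count_codes rs cs' (n - 1) (True # p))"
  proof (cases "c = Some False \<or> n = 0")
    case True
    then have "\<not> ?Q x" if "x \<in> set (extensions rs (True # p))" for x
      using step[OF that] rank_ge[OF that] by auto
    then show ?thesis using True by (auto simp: filter_empty_conv)
  next
    case False
    then have "filter ?Q (extensions rs (True # p)) = filter (?P (n - 1) (True # p)) (extensions rs (True # p))"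
      using step[of _ True] by (intro filter_cong) auto
    then show ?thesis using False Cons.IH[OF cs(2), of "n - 1" "True # p"] by simp
  qed
  have "length (filter ?Q (extensions (r # rs) p)) =
      (if imp r p then length (filter ?Q (extensions rs (True # p))) else 0) +
      length (filter ?Q (extensions rs (False # p)))" by simp
  also have "\<dots> = count_codes (r # rs) cs n p"
  proof -
    consider "c = None" | "c = Some True" | "c = Some False" by (cases c) auto
    then show ?thesis unfolding F T unfolding cs(1) by cases (cases n; simp)+
  qed
  finally show ?case ..
qed

text \<open>A truth table with 29 true entries that separates the two antichains: the codes of rank
  21 below it number 79, those of rank 34 above it number 20.\<close>

definition pivot :: "bool list" where
  "pivot =
     [False, False, False, False, False, False, False, False, False, False, False, True, False, True,
     True, False, True, True, True, True, True, True, False, False, True, True, True, True, True, True,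
     True, True, True, True, True, True, True, True, True, True, True, True, True, True]"

definition below_pivot :: "bool option list" where
  "below_pivot = map (\<lambda>b. if b then None else Some False) pivot"

definition above_pivot :: "bool option list" where
  "above_pivot = map (\<lambda>b. if b then Some True else None) pivot"

text \<open>The congruence rules keep the simplifier from traversing data that is already in normal form.\<close>

lemma no_descent_congs:
  "imp p q = imp p q" "covered rs p T = covered rs p T" "cut t ts p = cut t ts p"
  "count_codes rs cs n p = count_codes rs cs n p"
  by (rule refl)+

lemma is_cut_cong: "c = c' \<Longrightarrow> is_cut c t p = is_cut c' t p"
  by simp

lemma is_cut_Pair: "is_cut (l, ts) t p \<longleftrightarrow> t < l \<and> cut t ts p"
  by (simp add: is_cut_def)

lemma imp_Nil: "imp [] q = True"
  by simp

declare One_nat_def [simp del]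

text \<open>One rewrite rule per chain, so that a leaf of the tree fetches a single row instead of
  unfolding the whole table. With \<open>One_nat_def\<close> switched off, the entry 1 is not turned
  into \<open>Suc 0\<close> and can be compared by \<open>rel_simps\<close>.\<close>

lemmas cuts_simps =
  cuts_def[of 0, unfolded chain_table_def, simplified] cuts_def[of 1, unfolded chain_table_def,
  simplified] cuts_def[of 2, unfolded chain_table_def, simplified] cuts_def[of 3, unfolded
  chain_table_def, simplified] cuts_def[of 4, unfolded chain_table_def, simplified] cuts_def[of 5,
  unfolded chain_table_def, simplified] cuts_def[of 6, unfolded chain_table_def, simplified] cuts_def[of
  7, unfolded chain_table_def, simplified] cuts_def[of 8, unfolded chain_table_def, simplified]
  cuts_def[of 9, unfolded chain_table_def, simplified] cuts_def[of 10, unfolded chain_table_def,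
  simplified] cuts_def[of 11, unfolded chain_table_def, simplified] cuts_def[of 12, unfolded
  chain_table_def, simplified] cuts_def[of 13, unfolded chain_table_def, simplified] cuts_def[of 14,
  unfolded chain_table_def, simplified] cuts_def[of 15, unfolded chain_table_def, simplified] cuts_def[of
  16, unfolded chain_table_def, simplified] cuts_def[of 17, unfolded chain_table_def, simplified]
  cuts_def[of 18, unfolded chain_table_def, simplified] cuts_def[of 19, unfolded chain_table_def,
  simplified] cuts_def[of 20, unfolded chain_table_def, simplified] cuts_def[of 21, unfolded
  chain_table_def, simplified] cuts_def[of 22, unfolded chain_table_def, simplified] cuts_def[of 23,
  unfolded chain_table_def, simplified] cuts_def[of 24, unfolded chain_table_def, simplified] cuts_def[of
  25, unfolded chain_table_def, simplified] cuts_def[of 26, unfolded chain_table_def, simplified]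
  cuts_def[of 27, unfolded chain_table_def, simplified] cuts_def[of 28, unfolded chain_table_def,
  simplified] cuts_def[of 29, unfolded chain_table_def, simplified] cuts_def[of 30, unfolded
  chain_table_def, simplified] cuts_def[of 31, unfolded chain_table_def, simplified] cuts_def[of 32,
  unfolded chain_table_def, simplified] cuts_def[of 33, unfolded chain_table_def, simplified] cuts_def[of
  34, unfolded chain_table_def, simplified] cuts_def[of 35, unfolded chain_table_def, simplified]
  cuts_def[of 36, unfolded chain_table_def, simplified] cuts_def[of 37, unfolded chain_table_def,
  simplified] cuts_def[of 38, unfolded chain_table_def, simplified] cuts_def[of 39, unfolded
  chain_table_def, simplified] cuts_def[of 40, unfolded chain_table_def, simplified] cuts_def[of 41,
  unfolded chain_table_def, simplified] cuts_def[of 42, unfolded chain_table_def, simplified] cuts_def[of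
  43, unfolded chain_table_def, simplified] cuts_def[of 44, unfolded chain_table_def, simplified]
  cuts_def[of 45, unfolded chain_table_def, simplified] cuts_def[of 46, unfolded chain_table_def,
  simplified] cuts_def[of 47, unfolded chain_table_def, simplified] cuts_def[of 48, unfolded
  chain_table_def, simplified] cuts_def[of 49, unfolded chain_table_def, simplified] cuts_def[of 50,
  unfolded chain_table_def, simplified] cuts_def[of 51, unfolded chain_table_def, simplified] cuts_def[of
  52, unfolded chain_table_def, simplified] cuts_def[of 53, unfolded chain_table_def, simplified]
  cuts_def[of 54, unfolded chain_table_def, simplified] cuts_def[of 55, unfolded chain_table_def,
  simplified] cuts_def[of 56, unfolded chain_table_def, simplified] cuts_def[of 57, unfolded
  chain_table_def, simplified] cuts_def[of 58, unfolded chain_table_def, simplified] cuts_def[of 59,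
  unfolded chain_table_def, simplified] cuts_def[of 60, unfolded chain_table_def, simplified] cuts_def[of
  61, unfolded chain_table_def, simplified] cuts_def[of 62, unfolded chain_table_def, simplified]
  cuts_def[of 63, unfolded chain_table_def, simplified] cuts_def[of 64, unfolded chain_table_def,
  simplified] cuts_def[of 65, unfolded chain_table_def, simplified] cuts_def[of 66, unfolded
  chain_table_def, simplified] cuts_def[of 67, unfolded chain_table_def, simplified] cuts_def[of 68,
  unfolded chain_table_def, simplified] cuts_def[of 69, unfolded chain_table_def, simplified] cuts_def[of
  70, unfolded chain_table_def, simplified] cuts_def[of 71, unfolded chain_table_def, simplified]
  cuts_def[of 72, unfolded chain_table_def, simplified] cuts_def[of 73, unfolded chain_table_def,
  simplified] cuts_def[of 74, unfolded chain_table_def, simplified] cuts_def[of 75, unfolded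
  chain_table_def, simplified] cuts_def[of 76, unfolded chain_table_def, simplified] cuts_def[of 77,
  unfolded chain_table_def, simplified] cuts_def[of 78, unfolded chain_table_def, simplified] cuts_def[of
  79, unfolded chain_table_def, simplified] cuts_def[of 80, unfolded chain_table_def, simplified]
  cuts_def[of 81, unfolded chain_table_def, simplified] cuts_def[of 82, unfolded chain_table_def,
  simplified] cuts_def[of 83, unfolded chain_table_def, simplified] cuts_def[of 84, unfolded
  chain_table_def, simplified] cuts_def[of 85, unfolded chain_table_def, simplified] cuts_def[of 86,
  unfolded chain_table_def, simplified] cuts_def[of 87, unfolded chain_table_def, simplified] cuts_def[of
  88, unfolded chain_table_def, simplified] cuts_def[of 89, unfolded chain_table_def, simplified]
  cuts_def[of 90, unfolded chain_table_def, simplified] cuts_def[of 91, unfolded chain_table_def,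
  simplified] cuts_def[of 92, unfolded chain_table_def, simplified] cuts_def[of 93, unfolded
  chain_table_def, simplified] cuts_def[of 94, unfolded chain_table_def, simplified] cuts_def[of 95,
  unfolded chain_table_def, simplified]

declare One_nat_def [simp]

lemma covered_3: "covered rows_3 [] tree_3"
  unfolding rows_3_eq tree_3_def
  by (simp only: covered.simps imp.simps(1-3) imp_Nil if_True if_False simp_thms is_cut_Pair cut.simps
      cuts_simps rel_simps cong: no_descent_congs is_cut_cong if_weak_cong)

lemma length_rows_3: "length rows_3 = 44"
  by (simp add: rows_3_eq)

lemma length_pivot: "length pivot = 44"
  by (simp add: pivot_def)

lemma count_below_pivot: "count_codes rows_3 (rev below_pivot) 21 [] = 79"
proof -
  \<comment> \<open>The equations of \<open>count_codes\<close> match on \<open>Suc\<close>, so the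
    rank is written in unary.\<close>
  have n: "(21 :: nat) = Suc (Suc (Suc (Suc (Suc (Suc (Suc (Suc (Suc (Suc (Suc (Suc (Suc (Suc (Suc
    (Suc (Suc (Suc (Suc (Suc (Suc 0))))))))))))))))))))"
    by simp
  show ?thesis
    unfolding n rows_3_eq below_pivot_def pivot_def list.map rev.simps append.simps if_True if_False
    by (simp only: count_codes.simps imp.simps(1-3) imp_Nil if_True if_False simp_thms nat.simps
        arith_simps arith_special add_0 add_0_right rel_simps cong: no_descent_congs if_weak_cong)
qed

lemma count_above_pivot: "count_codes rows_3 (rev above_pivot) 34 [] = 20"
proof -
  have n: "(34 :: nat) = Suc (Suc (Suc (Suc (Suc (Suc (Suc (Suc (Suc (Suc (Suc (Suc (Suc (Suc (Suc
    (Suc (Suc (Suc (Suc (Suc (Suc (Suc (Suc (Suc (Suc (Suc (Suc (Suc (Suc (Suc (Suc (Suc (Suc (Suc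
    0)))))))))))))))))))))))))))))))))"
    by simp
  show ?thesis
    unfolding n rows_3_eq above_pivot_def pivot_def list.map rev.simps append.simps if_True if_False
    by (simp only: count_codes.simps imp.simps(1-3) imp_Nil if_True if_False simp_thms nat.simps
        arith_simps arith_special add_0 add_0_right rel_simps cong: no_descent_congs if_weak_cong)
qed

section \<open>The bounds\<close>

lemma length_codes_3: "p \<in> set (codes 3) \<Longrightarrow> length p = 44"
  using extensions_form[of p rows_3 "[]"] by (auto simp: codes_3 length_rows_3)

lemma imp_iff_nth: "length p = length q \<Longrightarrow> imp p q \<longleftrightarrow> (\<forall>i<length p. p ! i \<longrightarrow> q ! i)"
  using imp_map[where f = "(!) p" and g = "(!) q" and xs = "[0..<length p]"] map_nth[of p] map_nth[of q] by auto

lemma rank_mono: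
  assumes "length p = length q" "imp p q"
  shows "rank p \<le> rank q \<and> (rank p = rank q \<longrightarrow> p = q)"
  using assms
proof (induction p q rule: list_induct2)
  case (Cons a p b q)
  then show ?case by (cases a; cases b) auto
qed simp

lemma card_level:
  assumes "length cs = 44"
  shows "card {p \<in> set (codes 3). agrees cs p \<and> rank p = n} = count_codes rows_3 (rev cs) n []"
proof -
  have "filter (\<lambda>x. agrees cs (take 44 x) \<and> rank x = n) (codes 3) =
      filter (\<lambda>x. agrees cs x \<and> rank x = n) (codes 3)"
    by (intro filter_cong refl) (simp add: length_codes_3)
  then have "count_codes rows_3 (rev cs) n [] = length (filter (\<lambda>x. agrees cs x \<and> rank x = n) (codes 3))"
    using assms by (subst count_codes_eq) (simp_all add: length_rows_3 codes_3)
  also have "\<dots> = card (set (filter (\<lambda>x. agrees cs x \<and> rank x = n) (codes 3)))"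
    by (rule distinct_card[symmetric]) (simp add: distinct_codes)
  finally show ?thesis by simp
qed

lemma agrees_below_pivot: "agrees below_pivot p \<Longrightarrow> i < 44 \<Longrightarrow> p ! i \<Longrightarrow> pivot ! i"
  by (auto simp: agrees_def below_pivot_def list_all2_conv_all_nth length_pivot split: if_splits)

lemma agrees_above_pivot: "agrees above_pivot p \<Longrightarrow> i < 44 \<Longrightarrow> pivot ! i \<Longrightarrow> p ! i"
  by (auto simp: agrees_def above_pivot_def list_all2_conv_all_nth length_pivot split: if_splits)

text \<open>Two codes of the same rank are incomparable. The two levels used here are an antichain
  below and an antichain above the pivot.\<close>

lemma boolean_lattice_4:
  "\<exists>(C :: game set) f. finite C \<and> card C = 99 \<and> (\<forall>S. f S \<in> born_by 4) \<and>
     (\<forall>S T. S \<subseteq> C \<longrightarrow> T \<subseteq> C \<longrightarrow> game_le (f S) (f T) = (S \<subseteq> T))"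
proof -
  obtain rep where rep: "coded 3 rep" using ex_coded by blast
  have rep_le: "game_le (rep p) (rep q) \<longleftrightarrow> imp p q" if "p \<in> set (codes 3)" "q \<in> set (codes 3)" for p q
    using rep that by (simp add: coded_def)
  have rank_le: "rank p \<le> rank q \<and> (rank p = rank q \<longrightarrow> p = q)"
    if "p \<in> set (codes 3)" "q \<in> set (codes 3)" "game_le (rep p) (rep q)" for p q
    using that rep_le rank_mono[of p q] length_codes_3 by simp
  define A where "A = {p \<in> set (codes 3). agrees below_pivot p \<and> rank p = 21}"
  define B where "B = {p \<in> set (codes 3). agrees above_pivot p \<and> rank p = 34}"
  have AB: "A \<subseteq> set (codes 3)" "B \<subseteq> set (codes 3)" "A \<inter> B = {}" by (auto simp: A_def B_def)
  have rep_inj: "inj_on rep (set (codes 3))"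
  proof (rule inj_onI)
    fix p q assume pq: "p \<in> set (codes 3)" "q \<in> set (codes 3)" "rep p = rep q"
    then show "p = q" using rank_le[OF pq(1,2)] rank_le[OF pq(2,1)] by auto
  qed
  have "card (rep ` A \<union> rep ` B) = card (A \<union> B)"
    unfolding image_Un[symmetric] using rep_inj AB by (intro card_image) (auto intro: inj_on_subset)
  also have "\<dots> = card A + card B"
    using AB finite_subset[of _ "set (codes 3)"] by (intro card_Un_disjoint) auto
  also have "\<dots> = 99"
    unfolding A_def B_def
    by (simp add: card_level count_below_pivot count_above_pivot below_pivot_def[THEN arg_cong[of _ _ length]]
        above_pivot_def[THEN arg_cong[of _ _ length]] length_pivot)
  finally have card: "card (rep ` A \<union> rep ` B) = 99" .
  have four: "Suc 3 = 4" by simp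
  show ?thesis
  proof (rule boolean_lattice[of "rep ` A" "rep ` B" 3])
    show "rep ` A \<union> rep ` B \<subseteq> born_by 3" using rep AB by (auto simp: coded_def)
    show "a = a'" if "a \<in> rep ` A" "a' \<in> rep ` A" "game_le a a'" for a a'
    proof -
      from that obtain p q where "a = rep p" "a' = rep q" "p \<in> A" "q \<in> A" by blast
      then show ?thesis using rank_le[of p q] that(3) by (auto simp: A_def)
    qed
    show "b = b'" if "b \<in> rep ` B" "b' \<in> rep ` B" "game_le b b'" for b b'
    proof -
      from that obtain p q where "b = rep p" "b' = rep q" "p \<in> B" "q \<in> B" by blast
      then show ?thesis using rank_le[of p q] that(3) by (auto simp: B_def)
    qed
    show "game_le a b" if "a \<in> rep ` A" "b \<in> rep ` B" for a b
    proof -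
      from that obtain p q where pq: "a = rep p" "b = rep q" "p \<in> A" "q \<in> B" by blast
      then have len: "length p = 44" "length q = 44" using AB length_codes_3 by auto
      \<comment> \<open>The comparison goes entry by entry through the pivot: true in
        \<open>p\<close>, hence in \<open>pivot\<close>, hence in \<open>q\<close>.\<close>
      have "imp p q"
        using pq agrees_below_pivot agrees_above_pivot unfolding A_def B_def
        by (subst imp_iff_nth) (auto simp: len)
      then show ?thesis using pq AB rep_le[of p q] by blast
    qed
  next
    fix f assume f: "\<And>S. f S \<in> born_by (Suc 3)" "\<And>S T. S \<subseteq> rep ` A \<union> rep ` B \<Longrightarrow>
      T \<subseteq> rep ` A \<union> rep ` B \<Longrightarrow> game_le (f S) (f T) \<longleftrightarrow> S \<subseteq> T"
    show ?thesis
      by (intro exI[of _ "rep ` A \<union> rep ` B"] exI[of _ f])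
         (use f card card_ge_0_finite[of "rep ` A \<union> rep ` B"] in \<open>simp add: four\<close>)
  qed
qed

lemma F_4_lower: "10 < F 4"
proof -
  from boolean_lattice_4 obtain C :: "game set" and f where "finite C" "card C = 99" "\<forall>S. f S \<in> born_by 4"
    "\<forall>S T. S \<subseteq> C \<longrightarrow> T \<subseteq> C \<longrightarrow> game_le (f S) (f T) = (S \<subseteq> T)"
    by blast
  note C = this(1,2) this(3,4)[rule_format]
  \<comment> \<open>With \<open>n = 10\<close> the count is \<open>11^2 * 2^90\<close>, which is
    less than \<open>2^99\<close>.\<close>
  show ?thesis
    by (rule le_F_of_boolean_lattice[OF C(3,4) C(1)]) (simp_all add: C(2))
qed

lemma F_5_lower: "2580000000000 < F 5"
proof -
  from boolean_lattice_4 obtain C :: "game set" and f where "finite C" "card C = 99" "\<forall>S. f S \<in> born_by 4"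
    "\<forall>S T. S \<subseteq> C \<longrightarrow> T \<subseteq> C \<longrightarrow> game_le (f S) (f T) = (S \<subseteq> T)"
    by blast
  note C = this(1,2) this(3,4)[rule_format]
  obtain A where A: "A \<subseteq> born_by 4" "card A = 99 choose 49"
    "\<And>a a'. a \<in> A \<Longrightarrow> a' \<in> A \<Longrightarrow> game_le a a' \<Longrightarrow> a = a'"
    by (rule antichain_of_boolean_lattice[OF C(3,4) C(1), of 49]) (simp_all add: C(2))
  have finA: "finite A" using A(1) finite_born_by finite_subset by blast
  \<comment> \<open>The middle level is the only antichain used on this day; the one above it is
    taken to be empty.\<close>
  have "\<exists>g. (\<forall>S. g S \<in> born_by (Suc 4)) \<and> (\<forall>S T. S \<subseteq> A \<longrightarrow> T \<subseteq> A \<longrightarrow> game_le (g S) (g T) = (S \<subseteq> T))"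
    by (rule boolean_lattice[of A "{}" 4]) (use A in \<open>simp_all, blast\<close>)
  then obtain g where "\<forall>S. g S \<in> born_by (Suc 4)" "\<forall>S T. S \<subseteq> A \<longrightarrow> T \<subseteq> A \<longrightarrow> game_le (g S) (g T) = (S \<subseteq> T)"
    by (elim exE conjE)
  note g = this[rule_format]
  define n :: nat where "n = 2580000000000"
  \<comment> \<open>The exponent 84 merely absorbs the polynomial factor. What matters is that
    \<open>n^2\<close>, about \<open>6.7 * 10^24\<close>, stays below the binomial coefficient,
    about \<open>5 * 10^28\<close>.\<close>
  have "(n + 1) ^ 2 \<le> 2 ^ 84" by (simp add: n_def)
  then have "(n + 1) ^ 2 * 2 ^ (n * (n - 1)) \<le> 2 ^ 84 * 2 ^ (n * (n - 1))" by simp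
  also have "\<dots> = 2 ^ (84 + n * (n - 1))" by (simp only: power_add)
  also have "\<dots> < (2 :: nat) ^ card A"
  proof (rule power_strict_increasing)
    have "99 choose 49 = fact 99 div (fact 49 * fact (99 - 49) :: nat)"
      by (rule binomial_fact') simp
    then have "99 choose 49 = (50445672272782096667406248628 :: nat)"
      by (simp add: fact_numeral)
    then show "84 + n * (n - 1) < card A" by (simp add: A(2) n_def)
  qed simp
  finally have n: "(n + 1) ^ 2 * 2 ^ (n * (n - 1)) < (2 :: nat) ^ card A" .
  have "n < F (Suc 4)"
    by (rule le_F_of_boolean_lattice[where f = g and C = A, OF _ _ finA n]) (use g in blast)+
  then show ?thesis by (simp add: n_def)
qed

section \<open>The upper bounds from the 96 chains\<close>

lemma cut_iff: "cut t ss p \<longleftrightarrow> p = map (\<lambda>s. s \<le> t) ss"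
  by (induction t ss p rule: cut.induct) auto

definition chain_3 :: "(bool list \<Rightarrow> game) \<Rightarrow> nat \<Rightarrow> game set" where
  "chain_3 rep i = rep ` {p \<in> set (codes 3). \<exists>t. is_cut (cuts i) t p}"

lemma chain_cover_3:
  assumes rep: "coded 3 rep"
  shows "chain_cover 3 (rep ` set (codes 3)) {..<96} (chain_3 rep)"
proof
  show "representatives 3 (rep ` set (codes 3))" by (rule coded_representatives[OF rep])
  show "finite {..<96 :: nat}" by simp
  show "rep ` set (codes 3) = (\<Union>i<96. chain_3 rep i)"
    using covered_extensions[OF covered_3] by (fastforce simp: chain_3_def codes_3)
  fix i H K assume "H \<in> chain_3 rep i" "K \<in> chain_3 rep i"
  then obtain p q t u where pq: "H = rep p" "K = rep q" "p \<in> set (codes 3)" "q \<in> set (codes 3)"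
    "p = map (\<lambda>s. s \<le> t) (snd (cuts i))" "q = map (\<lambda>s. s \<le> u) (snd (cuts i))"
    by (auto simp: chain_3_def is_cut_def cut_iff)
  \<comment> \<open>Letting time advance only turns entries from false to true.\<close>
  have "imp p q \<or> imp q p"
    unfolding pq(5,6) imp_map using le_trans nle_le[of t u] by blast
  then show "game_le H K \<or> game_le K H" using rep pq(1-4) by (auto simp: coded_def)
qed

text \<open>Each time below the stored length contributes at most one code.\<close>

lemma card_chain_3: "card (chain_3 rep i) \<le> fst (cuts i)"
proof -
  have "{p \<in> set (codes 3). \<exists>t. is_cut (cuts i) t p} \<subseteq>
      (\<lambda>t. map (\<lambda>s. s \<le> t) (snd (cuts i))) ` {..<fst (cuts i)}" (is "?K \<subseteq> ?f ` _")
    by (auto simp: is_cut_def cut_iff)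
  then have "card ?K \<le> card {..<fst (cuts i)}"
    by (intro surj_card_le) auto
  moreover have "card (chain_3 rep i) \<le> card ?K"
    unfolding chain_3_def by (rule card_image_le) simp
  ultimately show ?thesis by simp
qed

lemma length_chain_table: "length chain_table = 96"
  by (simp add: chain_table_def)

lemma sum_cuts: "(\<Sum>i<96. fst (cuts i)) = 1474"
proof -
  have "(\<Sum>i<96. fst (cuts i)) = sum_list (map fst chain_table)"
    unfolding sum_list_sum_nth by (simp add: length_chain_table cuts_def atLeast0LessThan)
  also have "\<dots> = 1474" by (simp add: chain_table_def)
  finally show ?thesis .
qed

text \<open>This is the number of possible profiles of segment sizes over all chains. The margin up
  to \<open>10^183\<close> later absorbs the factor 2 for the two colours and the small additive
  terms.\<close>

lemma prod_cuts: "(\<Prod>i<96. (fst (cuts i) + 1) * (fst (cuts i) + 2) div 2) \<le> 10 ^ 182"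
proof -
  let ?f = "\<lambda>n :: nat. (n + 1) * (n + 2) div 2"
  have "(\<Prod>i<96. ?f (fst (cuts i))) = prod_list (map ?f (map fst chain_table))"
    unfolding prod.list_conv_set_nth by (simp add: length_chain_table cuts_def atLeast0LessThan)
  also have "map fst chain_table = 
     [45, 43, 41, 39, 39, 37, 37, 37, 35, 33, 33, 33, 31, 31, 29, 29, 28, 27, 27, 25, 25, 25, 24, 23, 23,
     22, 21, 21, 21, 21, 20, 20, 19, 18, 18, 17, 17, 17, 16, 16, 15, 15, 15, 14, 14, 13, 13, 13, 13, 13,
     13, 12, 12, 11, 11, 11, 10, 9, 9, 9, 9, 9, 9, 8, 8, 7, 7, 7, 6, 6, 6, 6, 5, 5, 4, 4, 4, 3, 3, 3, 3,
     2, 2, 2, 2, 2, 2, 2, 2, 2, 1, 1, 1, 1, 1, 1]"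
    by (simp add: chain_table_def)
  also have "prod_list (map ?f \<dots>) \<le> 10 ^ 182" by simp
  finally show ?thesis .
qed

lemma representatives_codes:
  obtains \<R> where "representatives k \<R>" "card \<R> \<le> length (codes k)"
proof -
  obtain rep where "coded k rep" using ex_coded by blast
  from coded_representatives[OF this] show ?thesis
    by (rule that) (use card_image_le[of "set (codes k)" rep] card_length[of "codes k"] in simp)
qed

lemma universal_mono: "universal k m \<Longrightarrow> m \<le> n \<Longrightarrow> universal k n"
  unfolding universal_def using le_trans by blast

text \<open>With 1, 4 and 22 values on days 0, 1 and 2, the sizes grow as 0, 14, 38, 102.\<close>

lemma universal_3: "universal 3 102"
proof -
  have len: "length (codes 0) = 1" "length (codes 1) = 4" "length (codes 2) = 22"
    by (simp, simp only: codes_1, simp, simp only: codes_2, simp)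
  have step: "universal l m"
    if U: "universal k n" and l: "l = Suc k" and m: "n + 2 * length (codes k) + 4 * k + 12 \<le> m" for k l n m
  proof -
    obtain \<R> where "representatives k \<R>" "card \<R> \<le> length (codes k)"
      by (rule representatives_codes)
    then show ?thesis
      unfolding l using m by (intro universal_mono[OF universal_Suc[OF U]]) auto
  qed
  have "universal 1 14" by (rule step[OF universal_0]) (simp, unfold len, simp)
  then have "universal 2 38" by (rule step) (simp, unfold len, simp)
  then show ?thesis by (rule step) (simp, unfold len, simp)
qed

lemma F_4_upper: "F 4 \<le> 318"
  unfolding F_le_iff
proof
  fix X assume "X \<in> born_by 4"
  then have X: "X \<in> born_by (Suc 3)" by simp
  obtain rep where rep: "coded 3 rep" using ex_coded by blast
  interpret chain_cover 3 "rep ` set (codes 3)" "{..<96}" "chain_3 rep"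
    by (rule chain_cover_3[OF rep])
  \<comment> \<open>The bound is \<open>102 + 2 * 96 + 4 * 3 + 12\<close>: at most 96 options on
    each side.\<close>
  show "min_verts X \<le> 318"
    using min_verts_le_extension[OF universal_3 P X, of 96] extremal_subsets by simp
qed

lemma F_5_upper: "F 5 \<le> 10 ^ 183"
  unfolding F_le_iff
proof
  fix X assume "X \<in> born_by 5"
  then have X: "X \<in> born_by (Suc 4)" by simp
  obtain rep where rep: "coded 3 rep" using ex_coded by blast
  interpret chain_cover 3 "rep ` set (codes 3)" "{..<96}" "chain_3 rep"
    by (rule chain_cover_3[OF rep])
  \<comment> \<open>The number of values on day 3 is bounded by the total length of the chains, so
    the codes need not be counted separately.\<close>
  have "card (rep ` set (codes 3)) \<le> (\<Sum>i<96. card (chain_3 rep i))"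
    unfolding cover by (rule card_UN_le) simp
  also have "\<dots> \<le> 1474"
    unfolding sum_cuts[symmetric] by (intro sum_mono card_chain_3)
  finally have cardP: "card (rep ` set (codes 3)) \<le> 1474" .
  \<comment> \<open>The size is \<open>102 + 2 * 1474 + 4 * 3 + 12\<close>.\<close>
  have U: "universal 4 3074"
    using universal_mono[OF universal_Suc[OF universal_3 P], of 3074] cardP by simp
  obtain \<R> where R: "representatives (Suc 3) \<R>"
    "card \<R> \<le> card (rep ` set (codes 3)) + (\<Prod>i<96. (card (chain_3 rep i) + 1) * (card (chain_3 rep i) + 2) div 2)"
    using representatives_Suc by blast
  have "(\<Prod>i<96. (card (chain_3 rep i) + 1) * (card (chain_3 rep i) + 2) div 2)
      \<le> (\<Prod>i<96. (fst (cuts i) + 1) * (fst (cuts i) + 2) div 2)"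
    by (intro prod_mono conjI div_le_mono mult_le_mono add_right_mono card_chain_3) simp
  with R(2) cardP prod_cuts have cardR: "card \<R> \<le> 1474 + 10 ^ 182" by linarith
  have R4: "representatives 4 \<R>" using R(1) by simp
  have finR: "finite \<R>" using R4 by (simp add: representatives_def)
  have "min_verts X \<le> 3074 + 2 * card \<R> + 4 * 4 + 12"
  proof (rule min_verts_le_extension[OF U R4 X])
    fix A assume "A \<subseteq> \<R>"
    then have "card A \<le> card \<R>" by (rule card_mono[OF finR])
    then show "\<exists>B\<subseteq>A. card B \<le> card \<R> \<and> (\<forall>a\<in>A. \<exists>b\<in>B. game_le a b)"
      and "\<exists>B\<subseteq>A. card B \<le> card \<R> \<and> (\<forall>a\<in>A. \<exists>b\<in>B. game_le b a)"
      by (intro exI[of _ A], use game_le_refl in blast)+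
  qed
  also have "\<dots> \<le> 10 ^ 183" using cardR by simp
  finally show "min_verts X \<le> 10 ^ 183" .
qed

theorem theorem4p7:
  shows "11 \<le> F 4 \<and> F 4 \<le> 2087 \<and>
         2.58 * 10 ^ 12 < real (F 5) \<and> real (F 5) < 10 powr 187.63"
proof -
  have "real (F 5) \<le> 10 ^ 183"
    using F_5_upper by (metis of_nat_le_iff of_nat_numeral of_nat_power)
  also have "(10 :: real) ^ 183 = 10 powr 183" by (subst powr_numeral) simp_all
  also have "\<dots> < 10 powr 187.63" by (rule powr_less_mono) simp_all
  finally have "real (F 5) < 10 powr 187.63" .
  moreover have "real 2580000000000 < real (F 5)" using F_5_lower by (simp only: of_nat_less_iff)
  ultimately show ?thesis using F_4_lower F_4_upper by simp
qed

end
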